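(* Let $X=M\#_{\Sigma_M=\Sigma_N}N$ be the generalized fibre sum of closed, oriented, connected 4-manifolds $M$ and $N$ along embedded surfaces $\Sigma_M=i_M(\Sigma)$ and $\Sigma_N=i_N(\Sigma)$ of genus $g$ and self-intersection zero, representing non-torsion classes of maximal divisibilities $k_M$ and $k_N$, where the gluing diffeomorphism is described in adapted framings by a map $C\colon\Sigma\to S^1$. Let $n_{MN}=\gcd(k_M,k_N)$ and let $r\colon H_1(\Sigma;\mathbb{Z})\to\mathbb{Z}_{n_{MN}}$ be the homomorphism $\lambda\mapsto\langle[C],\lambda\rangle \bmod n_{MN}$. Consider the homomorphism $$i_M\oplus i_N\oplus r\colon H_1(\Sigma;\mathbb{Z})\to H_1(M;\mathbb{Z})\oplus H_1(N;\mathbb{Z})\oplus\mathbb{Z}_{n_{MN}},\quad\lambda\mapsto((i_M)_*\lambda,(i_N)_*\lambda,r(\lambda)).$$ Then $H_1(X;\mathbb{Z})$ is isomorphic to the cokernel of $i_M\oplus i_N\oplus r$.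
   Context: Fibre sum: $\Sigma$ is a closed oriented connected surface of genus $g$; $i_M\colon\Sigma\to M$, $i_N\colon\Sigma\to N$ are embeddings with images $\Sigma_M,\Sigma_N$; framings are orientation preserving embeddings $\tau_M\colon\Sigma\times D^2\to M$, $\tau_N\colon\Sigma\times D^2\to N$ extending $i_M,i_N$ onto closed tubular neighbourhoods $\nu\Sigma_M,\nu\Sigma_N$, with restrictions $\bar\tau_M,\bar\tau_N$ to $\Sigma\times S^1$; $M'=M\setminus\mathrm{int}\,\nu\Sigma_M$, $N'=N\setminus\mathrm{int}\,\nu\Sigma_N$. For a smooth map $C\colon\Sigma\to S^1$ let $\rho(z,\alpha)=(z,C(z)\overline\alpha)$, $\phi=\bar\tau_N\circ\rho\circ\bar\tau_M^{-1}$, and $X=M'\cup_\phi N'$. $[C]\in H^1(\Sigma;\mathbb{Z})$ is the pullback under $C$ of the standard generator of $H^1(S^1)$. Maximal divisibility: the image of $\langle PD(\Sigma_M),-\rangle\colon H_2(M)\to\mathbb{Z}$ is $k_M\mathbb{Z}$ with $k_M>0$, and it is assumed that $\Sigma_M=k_MA_M$ for some $A_M\in H_2(M)$; similarly for $N$. Adapted framing: let $\sigma^M=\bar\tau_M(\{pt\}\times S^1)$ be the meridian. There is an isomorphism $s\colon H_1(M')\to H_1(M)\oplus\mathbb{Z}_{k_M}$ of the form $\alpha\mapsto((\rho_M)_*\alpha,\mathcal{A}(\alpha))$, with $\rho_M\colon M'\to M$ the inclusion and $\mathcal{A}$ of the meridian class equal to $1$; fix one. The framing $\tau_M$ is adapted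 if for every $\gamma\in H_1(\Sigma)$ the class in $H_1(M')$ of $\gamma^M=(\bar\tau_M)_*(\gamma\times pt)$ is sent by $s$ to $((i_M)_*\gamma,0)$. If $k_M=1$ every framing is adapted. The same for $N$. Both framings $\tau_M,\tau_N$ are assumed adapted. *)

theory Defs
  imports "HOL-Analysis.Analysis" "HOL-Homology.Homology"
begin

section \<open>Oriented smooth manifolds\<close>

text \<open>
  \<open>C_diff k S f\<close> and \<open>smooth_on\<close> are intended for open \<open>S\<close>: \<open>f\<close> is \<open>C\<^sup>k\<^sup>+\<^sup>1\<close> iff it is
  differentiable and each directional derivative is \<open>C\<^sup>k\<close>.
\<close>

primrec C_diff ::
  "nat \<Rightarrow> 'e::real_normed_vector set \<Rightarrow> ('e \<Rightarrow> 'f::real_normed_vector) \<Rightarrow> bool" where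
  "C_diff 0 S f \<longleftrightarrow> continuous_on S f"
| "C_diff (Suc k) S f \<longleftrightarrow>
     (\<forall>x\<in>S. f differentiable (at x)) \<and> (\<forall>v. C_diff k S (\<lambda>x. frechet_derivative f (at x) v))"

definition smooth_on ::
  "'e::real_normed_vector set \<Rightarrow> ('e \<Rightarrow> 'f::real_normed_vector) \<Rightarrow> bool" where
  "smooth_on S f \<longleftrightarrow> (\<forall>k. C_diff k S f)"

text \<open>A chart is a pair of its domain and the coordinate map; only the values of the latter on the
  domain are relevant.\<close>

type_synonym ('a, 'e) atlas = "('a set \<times> ('a \<Rightarrow> 'e)) set"

definition chart :: "'a topology \<Rightarrow> 'a set \<Rightarrow> ('a \<Rightarrow> 'e::euclidean_space) \<Rightarrow> bool" where
  "chart X U \<phi> \<longleftrightarrow> openin X U \<and> open (\<phi> ` U) \<and>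
     homeomorphic_map (subtopology X U) (top_of_set (\<phi> ` U)) \<phi>"

definition smooth_wrt ::
  "('a, 'e::euclidean_space) atlas \<Rightarrow> ('b, 'f::euclidean_space) atlas \<Rightarrow> ('a \<Rightarrow> 'b) \<Rightarrow> bool" where
  "smooth_wrt A B f \<longleftrightarrow> (\<forall>(U, \<phi>)\<in>A. \<forall>(V, \<psi>)\<in>B.
     smooth_on (\<phi> ` (U \<inter> f -` V)) (\<psi> \<circ> f \<circ> inv_into U \<phi>))"

definition immersive_wrt ::
  "('a, 'e::euclidean_space) atlas \<Rightarrow> ('b, 'f::euclidean_space) atlas \<Rightarrow> ('a \<Rightarrow> 'b) \<Rightarrow> bool" where
  "immersive_wrt A B f \<longleftrightarrow> (\<forall>(U, \<phi>)\<in>A. \<forall>(V, \<psi>)\<in>B. \<forall>x\<in>\<phi> ` (U \<inter> f -` V).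
     inj (frechet_derivative (\<psi> \<circ> f \<circ> inv_into U \<phi>) (at x)))"

definition orientation_preserving_wrt ::
  "('a, real^'n) atlas \<Rightarrow> ('b, real^'n) atlas \<Rightarrow> ('a \<Rightarrow> 'b) \<Rightarrow> bool" where
  "orientation_preserving_wrt A B f \<longleftrightarrow> (\<forall>(U, \<phi>)\<in>A. \<forall>(V, \<psi>)\<in>B. \<forall>x\<in>\<phi> ` (U \<inter> f -` V).
     det (matrix (frechet_derivative (\<psi> \<circ> f \<circ> inv_into U \<phi>) (at x))) > 0)"

text \<open>The smooth structure and the orientation are both given by the atlas (not necessarily
  maximal); smoothness and orientation preservation of the identity are the conditions on the
  transition maps.\<close>

definition oriented_manifold :: "'a topology \<Rightarrow> ('a, real^'n) atlas \<Rightarrow> bool" where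
  "oriented_manifold X A \<longleftrightarrow>
     Hausdorff_space X \<and> second_countable X \<and>
     (\<forall>(U, \<phi>)\<in>A. chart X U \<phi>) \<and> \<Union>(fst ` A) = topspace X \<and>
     smooth_wrt A A id \<and> orientation_preserving_wrt A A id"

definition closed_oriented_connected_manifold ::
  "'a topology \<Rightarrow> ('a, real^'n) atlas \<Rightarrow> bool" where
  "closed_oriented_connected_manifold X A \<longleftrightarrow>
     oriented_manifold X A \<and> compact_space X \<and> connected_space X"

definition smooth_embedding ::
  "'a topology \<Rightarrow> ('a, 'e::euclidean_space) atlas \<Rightarrow> 'b topology \<Rightarrow> ('b, 'f::euclidean_space) atlas
    \<Rightarrow> ('a \<Rightarrow> 'b) \<Rightarrow> bool" where
  "smooth_embedding X A Y B f \<longleftrightarrow>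
     embedding_map X Y f \<and> smooth_wrt A B f \<and> immersive_wrt A B f"

definition restrict_atlas :: "'a set \<Rightarrow> ('a, 'e) atlas \<Rightarrow> ('a, 'e) atlas" where
  "restrict_atlas W A = (\<lambda>(U, \<phi>). (U \<inter> W, \<phi>)) ` A"

text \<open>The product orientation of \<open>S \<times> \<complex>\<close> for an oriented surface \<open>S\<close>, where \<open>\<complex>\<close> is oriented by
  \<open>(1, \<i>)\<close>.\<close>

definition times_complex_atlas :: "('s, real^2) atlas \<Rightarrow> ('s \<times> complex, real^4) atlas" where
  "times_complex_atlas A =
     (\<lambda>(U, \<phi>). (U \<times> UNIV, \<lambda>(z, w). vector [\<phi> z $ 1, \<phi> z $ 2, Re w, Im w])) ` A"

section \<open>Circle and fundamental classes\<close>

abbreviation circle :: "complex topology" where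
  "circle \<equiv> top_of_set (sphere 0 1)"

text \<open>The homology class of the loop \<open>s \<mapsto> e\<^sup>2\<^sup>\<pi>\<^sup>i\<^sup>s\<close>; the coordinate \<open>t 1\<close> runs from 0 to 1 along the
  standard 1-simplex.\<close>

definition circle_class :: "complex chain set" where
  "circle_class = homologous_rel_set 1 circle {}
     (frag_of (restrict (\<lambda>t. cis (2 * pi * t 1)) (standard_simplex 1)))"

definition smooth_circle_map ::
  "'a topology \<Rightarrow> ('a, 'e::euclidean_space) atlas \<Rightarrow> ('a \<Rightarrow> complex) \<Rightarrow> bool" where
  "smooth_circle_map X A C \<longleftrightarrow> continuous_map X circle C \<and>
     (\<forall>(U, \<phi>)\<in>A. smooth_on (\<phi> ` U) (C \<circ> inv_into U \<phi>))"

text \<open>For \<open>'n\<close> a numeral type, the coordinates are ordered as \<open>of_nat 1, ..., of_nat CARD('n)\<close>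
  (the last index being 0), which is also the order used by \<^const>\<open>vector\<close>.\<close>

definition positive_simplex :: "(nat \<Rightarrow> (real, 'n::{finite,comm_ring_1}) vec) \<Rightarrow> bool" where
  "positive_simplex v \<longleftrightarrow>
     (\<exists>D::((real, 'n) vec, 'n) vec. (\<forall>j\<in>{1..CARD('n)}. column (of_nat j) D = v j - v 0) \<and> det D > 0)"

text \<open>At every point \<open>x\<close> the class restricts to the generator of \<open>H\<^sub>n(X, X - x)\<close> given by the
  orientation, which is represented by any positively oriented affine simplex around \<open>x\<close> in any
  chart.\<close>

definition fundamental_class ::
  "'a topology \<Rightarrow> ('a, (real, 'n::{finite,comm_ring_1}) vec) atlas \<Rightarrow> 'a chain set \<Rightarrow> bool" where
  "fundamental_class X A \<mu> \<longleftrightarrow>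
     \<mu> \<in> carrier (homology_group (int CARD('n)) X) \<and>
     (\<forall>(U, \<phi>)\<in>A. \<forall>x\<in>U. \<forall>v. positive_simplex v \<and>
        convex hull (v ` {..CARD('n)}) \<subseteq> \<phi> ` U \<and>
        \<phi> x \<in> interior (convex hull (v ` {..CARD('n)})) \<longrightarrow>
        hom_induced (int CARD('n)) X {} X (topspace X - {x}) id \<mu> =
        homologous_rel_set CARD('n) X (topspace X - {x})
          (frag_of (restrict (\<lambda>t. inv_into U \<phi> (\<Sum>i\<le>CARD('n). t i *\<^sub>R v i))
                             (standard_simplex CARD('n)))))"

section \<open>Singular cohomology and Poincare duality\<close>

text \<open>Integral \<open>p\<close>-cochains are functions on singular simplices, of which only the values on the
  singular \<open>p\<close>-simplices of the space matter; \<open>coboundary p\<close> is the differential from degree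
  \<open>p - 1\<close> to degree \<open>p\<close> (zero for \<open>p = 0\<close>).\<close>

type_synonym 'a cochain = "((nat \<Rightarrow> real) \<Rightarrow> 'a) \<Rightarrow> int"

definition eval_cochain :: "'a cochain \<Rightarrow> 'a chain \<Rightarrow> int" where
  "eval_cochain u c = (\<Sum>\<sigma>\<in>Poly_Mapping.keys c. Poly_Mapping.lookup c \<sigma> * u \<sigma>)"

definition coboundary :: "nat \<Rightarrow> 'a cochain \<Rightarrow> 'a cochain" where
  "coboundary p u \<sigma> = eval_cochain u (chain_boundary p (frag_of \<sigma>))"

definition cocycle :: "nat \<Rightarrow> 'a topology \<Rightarrow> 'a cochain \<Rightarrow> bool" where
  "cocycle p X u \<longleftrightarrow> (\<forall>\<sigma>. singular_simplex (Suc p) X \<sigma> \<longrightarrow> coboundary (Suc p) u \<sigma> = 0)"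

definition cohomology_class :: "nat \<Rightarrow> 'a topology \<Rightarrow> 'a cochain \<Rightarrow> 'a cochain set" where
  "cohomology_class p X u =
     {v. \<exists>w. \<forall>\<sigma>. singular_simplex p X \<sigma> \<longrightarrow> v \<sigma> = u \<sigma> + coboundary p w \<sigma>}"

definition cohomology :: "nat \<Rightarrow> 'a topology \<Rightarrow> 'a cochain set set" where
  "cohomology p X = cohomology_class p X ` {u. cocycle p X u}"

definition cohomology_pullback ::
  "nat \<Rightarrow> 'a topology \<Rightarrow> ('a \<Rightarrow> 'b) \<Rightarrow> 'b cochain set \<Rightarrow> 'a cochain set" where
  "cohomology_pullback p X f \<xi> = (\<Union>u\<in>\<xi>. cohomology_class p X (\<lambda>\<sigma>. u (simplex_map p f \<sigma>)))"

definition kronecker :: "'a cochain set \<Rightarrow> 'a chain set \<Rightarrow> int" where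
  "kronecker \<xi> a = (THE n. \<exists>u\<in>\<xi>. \<exists>c\<in>a. n = eval_cochain u c)"

lemma eval_cochain_0 [simp]: "eval_cochain u 0 = 0"
  by (simp add: eval_cochain_def)

lemma eval_cochain_of [simp]: "eval_cochain u (frag_of \<sigma>) = u \<sigma>"
  by (simp add: eval_cochain_def)

lemma eval_cochain_superset:
  assumes "finite F" "Poly_Mapping.keys c \<subseteq> F"
  shows "eval_cochain u c = (\<Sum>\<sigma>\<in>F. Poly_Mapping.lookup c \<sigma> * u \<sigma>)"
  unfolding eval_cochain_def
  using assms by (intro sum.mono_neutral_left) (auto simp: in_keys_iff)

lemma eval_cochain_diff: "eval_cochain u (a - b) = eval_cochain u a - eval_cochain u b"
proof -
  let ?F = "Poly_Mapping.keys a \<union> Poly_Mapping.keys b"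
  have "eval_cochain u (a - b) = (\<Sum>\<sigma>\<in>?F. Poly_Mapping.lookup (a - b) \<sigma> * u \<sigma>)"
    by (rule eval_cochain_superset) (use keys_diff [of a b] in auto)
  also have "\<dots> = (\<Sum>\<sigma>\<in>?F. Poly_Mapping.lookup a \<sigma> * u \<sigma>)
                  - (\<Sum>\<sigma>\<in>?F. Poly_Mapping.lookup b \<sigma> * u \<sigma>)"
    by (simp add: lookup_minus left_diff_distrib sum_subtractf)
  also have "\<dots> = eval_cochain u a - eval_cochain u b"
    using eval_cochain_superset [of ?F a u] eval_cochain_superset [of ?F b u] by simp
  finally show ?thesis .
qed

lemma eval_coboundary: "eval_cochain (coboundary p w) c = eval_cochain w (chain_boundary p c)"
proof (rule frag_induction [of c UNIV])
  fix a b
  assume "eval_cochain (coboundary p w) a = eval_cochain w (chain_boundary p a)"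
    and "eval_cochain (coboundary p w) b = eval_cochain w (chain_boundary p b)"
  then show "eval_cochain (coboundary p w) (a - b) = eval_cochain w (chain_boundary p (a - b))"
    by (simp add: eval_cochain_diff chain_boundary_diff)
qed (auto simp: coboundary_def)

lemma eval_cocycle_boundary:
  assumes "cocycle p X u" "singular_chain (Suc p) X c"
  shows "eval_cochain u (chain_boundary (Suc p) c) = 0"
proof -
  have "eval_cochain (coboundary (Suc p) u) c = 0"
    unfolding eval_cochain_def
    using assms by (intro sum.neutral) (auto simp: cocycle_def singular_chain_def)
  then show ?thesis by (simp add: eval_coboundary)
qed

lemma kronecker_eq:
  assumes u: "cocycle p X u" and c: "singular_relcycle p X {} c"
  shows "kronecker (cohomology_class p X u) (homologous_rel_set p X {} c) = eval_cochain u c"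
proof -
  have *: "eval_cochain v d = eval_cochain u c"
    if v: "v \<in> cohomology_class p X u" and d: "d \<in> homologous_rel_set p X {} c" for v d
  proof -
    have rb: "singular_relboundary p X {} (c - d)"
      using d by (simp add: homologous_rel_def)
    then have dcyc: "singular_relcycle p X {} d"
      by (metis c d homologous_rel_singular_relcycle mem_Collect_eq)
    obtain w where w: "\<And>\<sigma>. singular_simplex p X \<sigma> \<Longrightarrow> v \<sigma> = u \<sigma> + coboundary p w \<sigma>"
      using v by (auto simp: cohomology_class_def)
    have "eval_cochain v d = eval_cochain u d + eval_cochain (coboundary p w) d"
      unfolding eval_cochain_def sum.distrib [symmetric]
      using dcyc
      by (intro sum.cong) (auto simp: singular_relcycle_def singular_chain_def w algebra_simps)
    moreover have "eval_cochain (coboundary p w) d = 0"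
      using dcyc by (simp add: eval_coboundary singular_cycle)
    moreover obtain e where "singular_chain (Suc p) X e" "chain_boundary (Suc p) e = c - d"
      using rb by (auto simp: singular_boundary)
    then have "eval_cochain u (c - d) = 0"
      using eval_cocycle_boundary [OF u] by metis
    ultimately show ?thesis by (simp add: eval_cochain_diff)
  qed
  have "u \<in> cohomology_class p X u"
    unfolding cohomology_class_def
    by (rule CollectI, rule exI [where x = "\<lambda>_. 0"]) (simp add: coboundary_def eval_cochain_def)
  moreover have "c \<in> homologous_rel_set p X {} c" by simp
  ultimately show ?thesis
    unfolding kronecker_def using * by (intro the_equality) blast+
qed

text \<open>The cap product \<open>C\<^sub>n \<times> C\<^sup>q \<rightarrow> C\<^sub>n\<^sub>-\<^sub>q\<close>, \<open>\<sigma> \<frown> u = u(\<sigma>|[e\<^sub>0,...,e\<^sub>q]) \<sigma>|[e\<^sub>q,...,e\<^sub>n]\<close>.\<close>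

definition cap_chain :: "nat \<Rightarrow> nat \<Rightarrow> 'a chain \<Rightarrow> 'a cochain \<Rightarrow> 'a chain" where
  "cap_chain n q c u = frag_extend (\<lambda>\<sigma>.
     frag_cmul (u (restrict \<sigma> (standard_simplex q)))
       (frag_of (restrict (\<lambda>x. \<sigma> (\<lambda>i. if i < q then 0 else x (i - q)))
                          (standard_simplex (n - q))))) c"

text \<open>For a fundamental class \<open>\<mu>\<close> of a closed oriented \<open>n\<close>-manifold \<open>X\<close> and \<open>a \<in> H\<^sub>n\<^sub>-\<^sub>q(X)\<close>: the class
  \<open>\<xi> \<in> H\<^sup>q(X)\<close> with \<open>\<mu> \<frown> \<xi> = a\<close>, which exists uniquely by Poincare duality.\<close>

definition poincare_dual ::
  "nat \<Rightarrow> nat \<Rightarrow> 'a topology \<Rightarrow> 'a chain set \<Rightarrow> 'a chain set \<Rightarrow> 'a cochain set" where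
  "poincare_dual n q X \<mu> a =
     (THE \<xi>. \<xi> \<in> cohomology q X \<and> (\<exists>u\<in>\<xi>. \<exists>c\<in>\<mu>. cap_chain n q c u \<in> a))"

definition surface_class :: "'s topology \<Rightarrow> 's chain set \<Rightarrow> 'a topology \<Rightarrow> ('s \<Rightarrow> 'a) \<Rightarrow> 'a chain set"
  where "surface_class S \<mu>S M i = hom_induced 2 S {} M {} i \<mu>S"

definition genus_of :: "'s topology \<Rightarrow> nat \<Rightarrow> bool" where
  "genus_of S g \<longleftrightarrow> homology_group 1 S \<cong> free_Abelian_group {..<2 * g}"

definition non_torsion :: "'a topology \<Rightarrow> 'a chain set \<Rightarrow> bool" where
  "non_torsion M a \<longleftrightarrow>
     (\<forall>n>0::nat. a [^]\<^bsub>homology_group 2 M\<^esub> n \<noteq> \<one>\<^bsub>homology_group 2 M\<^esub>)"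

definition self_intersection_4 :: "'a topology \<Rightarrow> 'a chain set \<Rightarrow> 'a chain set \<Rightarrow> int" where
  "self_intersection_4 M \<mu> a = kronecker (poincare_dual 4 2 M \<mu> a) a"

definition maximal_divisibility :: "'a topology \<Rightarrow> 'a chain set \<Rightarrow> 'a chain set \<Rightarrow> nat \<Rightarrow> bool" where
  "maximal_divisibility M \<mu> a k \<longleftrightarrow> k > 0 \<and>
     kronecker (poincare_dual 4 2 M \<mu> a) ` carrier (homology_group 2 M) = range (\<lambda>m. int k * m) \<and>
     (\<exists>b\<in>carrier (homology_group 2 M). a = b [^]\<^bsub>homology_group 2 M\<^esub> k)"

section \<open>Framings and fibre sums\<close>

text \<open>\<open>D\<^sup>2\<close> and \<open>S\<^sup>1\<close> are the unit disc and circle in \<open>\<complex>\<close>. A smooth embedding of the subset \<open>S \<times> D\<^sup>2\<close>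
  of the manifold \<open>S \<times> \<complex>\<close> is a map that extends to a smooth embedding of an open neighbourhood;
  the values of \<open>\<tau>\<close> outside \<open>S \<times> D\<^sup>2\<close> are irrelevant.\<close>

definition framing ::
  "'s topology \<Rightarrow> ('s, real^2) atlas \<Rightarrow> 'a topology \<Rightarrow> ('a, real^4) atlas \<Rightarrow> ('s \<Rightarrow> 'a)
    \<Rightarrow> ('s \<times> complex \<Rightarrow> 'a) \<Rightarrow> bool" where
  "framing S AS M A i \<tau> \<longleftrightarrow>
     (\<forall>z\<in>topspace S. \<tau> (z, 0) = i z) \<and>
     (\<exists>W T. openin (prod_topology S euclidean) W \<and> topspace S \<times> cball 0 1 \<subseteq> W \<and>
        smooth_embedding (subtopology (prod_topology S euclidean) W)
          (restrict_atlas W (times_complex_atlas AS)) M A T \<and>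
        orientation_preserving_wrt (restrict_atlas W (times_complex_atlas AS)) A T \<and>
        (\<forall>p\<in>topspace S \<times> cball 0 1. \<tau> p = T p))"

definition exterior :: "'s topology \<Rightarrow> 'a topology \<Rightarrow> ('s \<times> complex \<Rightarrow> 'a) \<Rightarrow> 'a topology" where
  "exterior S M \<tau> =
     subtopology M (topspace M - M interior_of (\<tau> ` (topspace S \<times> cball 0 1)))"

definition disjoint_union_topology :: "'a topology \<Rightarrow> 'b topology \<Rightarrow> ('a + 'b) topology" where
  "disjoint_union_topology X Y = topology (\<lambda>U. openin X (Inl -` U) \<and> openin Y (Inr -` U))"

lemma openin_disjoint_union_topology:
  "openin (disjoint_union_topology X Y) U \<longleftrightarrow> openin X (Inl -` U) \<and> openin Y (Inr -` U)"
proof -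
  have "istopology (\<lambda>U. openin X (Inl -` U) \<and> openin Y (Inr -` U))"
    unfolding istopology_def by (auto simp: vimage_Union intro!: openin_Int openin_Union)
  then show ?thesis by (simp add: disjoint_union_topology_def)
qed

lemma topspace_disjoint_union_topology:
  "topspace (disjoint_union_topology X Y) = Inl ` topspace X \<union> Inr ` topspace Y"
proof
  show "topspace (disjoint_union_topology X Y) \<subseteq> Inl ` topspace X \<union> Inr ` topspace Y"
  proof
    fix s assume "s \<in> topspace (disjoint_union_topology X Y)"
    moreover have "openin (disjoint_union_topology X Y) (topspace (disjoint_union_topology X Y))"
      by simp
    ultimately show "s \<in> Inl ` topspace X \<union> Inr ` topspace Y"
      unfolding openin_disjoint_union_topology by (cases s) (auto dest!: openin_subset)
  qed
  have "Inl -` (Inl ` topspace X \<union> Inr ` topspace Y) = topspace X"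
       "Inr -` (Inl ` topspace X \<union> Inr ` topspace Y) = topspace Y" by auto
  then show "Inl ` topspace X \<union> Inr ` topspace Y \<subseteq> topspace (disjoint_union_topology X Y)"
    by (intro openin_subset) (simp add: openin_disjoint_union_topology)
qed

text \<open>The points are the classes of points of \<open>X\<close> under the equivalence relation \<open>r\<close>.\<close>

definition quotient_space_topology :: "'a topology \<Rightarrow> ('a \<times> 'a) set \<Rightarrow> 'a set topology" where
  "quotient_space_topology X r = topology (\<lambda>\<U>. \<U> \<subseteq> topspace X // r \<and>
     openin X {x \<in> topspace X. r `` {x} \<in> \<U>})"

lemma openin_quotient_space_topology:
  "openin (quotient_space_topology X r) \<U> \<longleftrightarrow>
     \<U> \<subseteq> topspace X // r \<and> openin X {x \<in> topspace X. r `` {x} \<in> \<U>}"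
proof -
  have "istopology (\<lambda>\<U>. \<U> \<subseteq> topspace X // r \<and> openin X {x \<in> topspace X. r `` {x} \<in> \<U>})"
    unfolding istopology_def
  proof (intro conjI allI impI)
    fix \<U> \<V> :: "'a set set"
    assume "\<U> \<subseteq> topspace X // r \<and> openin X {x \<in> topspace X. r `` {x} \<in> \<U>}"
       and "\<V> \<subseteq> topspace X // r \<and> openin X {x \<in> topspace X. r `` {x} \<in> \<V>}"
    moreover have "{x \<in> topspace X. r `` {x} \<in> \<U> \<inter> \<V>} =
        {x \<in> topspace X. r `` {x} \<in> \<U>} \<inter> {x \<in> topspace X. r `` {x} \<in> \<V>}" by auto
    ultimately show "\<U> \<inter> \<V> \<subseteq> topspace X // r"
      "openin X {x \<in> topspace X. r `` {x} \<in> \<U> \<inter> \<V>}" by (auto simp: openin_Int)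
  next
    fix K :: "'a set set set"
    assume K: "\<forall>\<U>\<in>K. \<U> \<subseteq> topspace X // r \<and> openin X {x \<in> topspace X. r `` {x} \<in> \<U>}"
    then show "\<Union>K \<subseteq> topspace X // r" by blast
    have "{x \<in> topspace X. r `` {x} \<in> \<Union>K} = (\<Union>\<U>\<in>K. {x \<in> topspace X. r `` {x} \<in> \<U>})"
      by auto
    then show "openin X {x \<in> topspace X. r `` {x} \<in> \<Union>K}"
      using K by auto
  qed
  then show ?thesis by (simp add: quotient_space_topology_def)
qed

text \<open>\<open>X \<union>\<^sub>\<phi> Y\<close> for a map \<open>\<phi>\<close> from \<open>B \<subseteq> X\<close> to \<open>Y\<close>.\<close>

definition adjunction_space ::
  "'a topology \<Rightarrow> 'b topology \<Rightarrow> 'a set \<Rightarrow> ('a \<Rightarrow> 'b) \<Rightarrow> ('a + 'b) set topology" where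
  "adjunction_space X Y B \<phi> =
     (let G = {(Inl x, Inr (\<phi> x)) | x. x \<in> B}
      in quotient_space_topology (disjoint_union_topology X Y) ((G \<union> G\<inverse>)\<^sup>*))"

definition gluing_map ::
  "'s topology \<Rightarrow> ('s \<times> complex \<Rightarrow> 'a) \<Rightarrow> ('s \<times> complex \<Rightarrow> 'b) \<Rightarrow> ('s \<Rightarrow> complex) \<Rightarrow> 'a \<Rightarrow> 'b" where
  "gluing_map S \<tau>M \<tau>N C =
     \<tau>N \<circ> (\<lambda>(z, \<alpha>). (z, C z * cnj \<alpha>)) \<circ> inv_into (topspace S \<times> sphere 0 1) \<tau>M"

definition fibre_sum ::
  "'s topology \<Rightarrow> 'a topology \<Rightarrow> ('s \<times> complex \<Rightarrow> 'a) \<Rightarrow> 'b topology \<Rightarrow> ('s \<times> complex \<Rightarrow> 'b)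
    \<Rightarrow> ('s \<Rightarrow> complex) \<Rightarrow> ('a + 'b) set topology" where
  "fibre_sum S M \<tau>M N \<tau>N C =
     adjunction_space (exterior S M \<tau>M) (exterior S N \<tau>N)
       (\<tau>M ` (topspace S \<times> sphere 0 1)) (gluing_map S \<tau>M \<tau>N C)"

text \<open>The basepoint \<open>z\<close> below is a point of \<open>S\<close>, the one of the circle is \<open>1\<close>.\<close>

definition meridian ::
  "'s topology \<Rightarrow> 'a topology \<Rightarrow> ('s \<times> complex \<Rightarrow> 'a) \<Rightarrow> 's \<Rightarrow> 'a chain set" where
  "meridian S M \<tau> z = hom_induced 1 circle {} (exterior S M \<tau>) {} (\<lambda>\<alpha>. \<tau> (z, \<alpha>)) circle_class"

definition parallel ::
  "'s topology \<Rightarrow> 'a topology \<Rightarrow> ('s \<times> complex \<Rightarrow> 'a) \<Rightarrow> 's chain set \<Rightarrow> 'a chain set" where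
  "parallel S M \<tau> = hom_induced 1 S {} (exterior S M \<tau>) {} (\<lambda>z. \<tau> (z, 1))"

text \<open>The isomorphism \<open>s\<close> with second component \<open>\<A>\<close>.\<close>

definition split_map ::
  "'s topology \<Rightarrow> 'a topology \<Rightarrow> ('s \<times> complex \<Rightarrow> 'a) \<Rightarrow> ('a chain set \<Rightarrow> int)
    \<Rightarrow> 'a chain set \<Rightarrow> 'a chain set \<times> int" where
  "split_map S M \<tau> \<A> \<alpha> = (hom_induced 1 (exterior S M \<tau>) {} M {} id \<alpha>, \<A> \<alpha>)"

text \<open>The unit of \<open>\<int>\<^sub>k\<close> is \<open>1 mod k\<close>, as \<^term>\<open>integer_mod_group k\<close> has carrier \<open>{0..<k}\<close>,
  also for \<open>k = 1\<close>.\<close>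

definition splitting ::
  "'s topology \<Rightarrow> 'a topology \<Rightarrow> ('s \<times> complex \<Rightarrow> 'a) \<Rightarrow> nat \<Rightarrow> ('a chain set \<Rightarrow> int) \<Rightarrow> bool" where
  "splitting S M \<tau> k \<A> \<longleftrightarrow>
     split_map S M \<tau> \<A> \<in> iso (homology_group 1 (exterior S M \<tau>))
                             (homology_group 1 M \<times>\<times> integer_mod_group k) \<and>
     (\<forall>z\<in>topspace S. \<A> (meridian S M \<tau> z) = 1 mod int k)"

definition adapted ::
  "'s topology \<Rightarrow> 'a topology \<Rightarrow> ('s \<Rightarrow> 'a) \<Rightarrow> ('s \<times> complex \<Rightarrow> 'a) \<Rightarrow> ('a chain set \<Rightarrow> int) \<Rightarrow> bool"
  where
  "adapted S M i \<tau> \<A> \<longleftrightarrow> (\<forall>\<gamma>\<in>carrier (homology_group 1 S).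
     split_map S M \<tau> \<A> (parallel S M \<tau> \<gamma>) = (hom_induced 1 S {} M {} i \<gamma>, 0))"

definition cokernel :: "('a, 'c) monoid_scheme \<Rightarrow> ('b, 'd) monoid_scheme \<Rightarrow> ('a \<Rightarrow> 'b) \<Rightarrow> 'b set monoid"
  where "cokernel G H f = H Mod (f ` carrier G)"

end

theory Submission
  imports Defs
begin

text \<open>
  The Mayer-Vietoris argument for \<open>X = M' \<union> N'\<close>, whose pieces meet in a copy of the connected space
  \<open>\<Sigma> \<times> S\<^sup>1\<close>, presents \<open>H\<^sub>1(X)\<close> as the quotient of \<open>H\<^sub>1(M') \<oplus> H\<^sub>1(N')\<close> by the classes
  \<open>(a, -\<phi>\<^sub>* a)\<close>, \<open>a \<in> H\<^sub>1(\<Sigma> \<times> S\<^sup>1)\<close>. The group \<open>H\<^sub>1(\<Sigma> \<times> S\<^sup>1)\<close> is generated by the classes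
  \<open>\<lambda> \<times> pt\<close> and the meridian. In \<open>N'\<close> the former become \<open>\<lambda>\<^sup>N + \<langle>[C], \<lambda>\<rangle> \<sigma>\<^sup>N\<close> and the latter becomes
  \<open>-\<sigma>\<^sup>N\<close>. Under the splittings of \<open>H\<^sub>1(M')\<close> and \<open>H\<^sub>1(N')\<close> and for adapted framings, the relations
  are therefore \<open>(i\<^sub>M \<lambda>, 0, -i\<^sub>N \<lambda>, -\<langle>[C], \<lambda>\<rangle>)\<close> and \<open>(0, 1, 0, 1)\<close>. The map
  \<open>(a, x, b, y) \<mapsto> (a, -b, x - y)\<close> identifies the quotient by the second relation with
  \<open>H\<^sub>1(M) \<oplus> H\<^sub>1(N) \<oplus> \<int>\<^sub>n\<close>, where \<open>n = gcd(k\<^sub>M, k\<^sub>N)\<close> by the Chinese remainder theorem, and sends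
  the first relation to the image of \<open>\<lambda>\<close>.
\<close>

section \<open>Mayer-Vietoris arguments for singular chains\<close>

text \<open>\<open>M'\<close> and \<open>N'\<close> are closed in \<open>X\<close> and meet only
  along their common boundary, so their interiors do not cover \<open>X\<close> and chains cannot be
  cut along them directly. A collar removes the obstacle. A framing is the restriction of an
  embedding of an open neighbourhood of the surface times the closed unit disc, and compactness of
  the surface leaves room for discs of some radius \<open>R > 1\<close>. Squeezing the radii between
  1 and \<open>R\<close> inside \<open>M'\<close> gives a self-map of \<open>X\<close>, homotopic to
  the identity through maps preserving both pieces, that carries a neighbourhood of
  \<open>N'\<close> into \<open>N'\<close>. The collar is one-sided: \<open>N'\<close> stays
  pointwise fixed. Invariance of domain enters because open tubes must have open image in the
  4-manifold. Exactness is proved on chains, and the same cutting device, applied to two slit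
  cylinders, finds the generators of the homology of the product with the circle. The degree of
  \<open>C\<close> on a loop is read off by pairing with a class of value 1 on the standard loop, so
  the group \<open>H_1\<close> of the circle itself is never computed.\<close>

lemma frag_cmul_diff_distrib2: "frag_cmul c (a - b) = frag_cmul c a - frag_cmul c b"
  using frag_cmul_distrib2 [of c "a - b" b] by simp

lemma eval_cochain_minus: "eval_cochain u (- c) = - eval_cochain u c"
  using eval_cochain_diff [of u 0 c] by simp

lemma eval_cochain_add: "eval_cochain u (a + b) = eval_cochain u a + eval_cochain u b"
  using eval_cochain_diff [of u a "- b"] by (simp add: eval_cochain_minus)

text \<open>The constant cochain 1 is the augmentation: the two faces of a 1-simplex enter its
  boundary with opposite signs and cancel.\<close>

lemma eval_cochain_1_boundary:
  fixes c :: "'a chain"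
  shows "eval_cochain (\<lambda>_. 1) (chain_boundary 1 c) = 0"
proof -
  have "coboundary 1 (\<lambda>_. 1) = (\<lambda>_ :: (nat \<Rightarrow> real) \<Rightarrow> 'a. 0)"
    by (auto simp: coboundary_def chain_boundary_of eval_cochain_diff eval_cochain_add eval_cochain_minus)
  moreover have "eval_cochain (\<lambda>_. 0) c = 0"
    by (simp add: eval_cochain_def)
  ultimately show ?thesis by (metis eval_coboundary)
qed

text \<open>All points of a path connected space are homologous, so only the coefficient sum of a
  0-chain survives.\<close>

lemma homologous_rel_0_frag_cmul:
  assumes "path_connected_space Y" "singular_simplex 0 Y f" "singular_chain 0 Y c"
  shows "homologous_rel 0 Y {} c (frag_cmul (eval_cochain (\<lambda>_. 1) c) (frag_of f))"
  using assms(3) unfolding singular_chain_def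
proof (induction c rule: frag_induction)
  case (one g)
  then show ?case
    using iso_integer_zeroth_homology_group_aux assms by auto
next
  case (diff a b)
  then show ?case
    using homologous_rel_diff by (fastforce simp: eval_cochain_diff frag_cmul_diff_distrib)
qed auto

lemma zero_chain_boundary_path_connected:
  assumes "path_connected_space Y" "singular_chain 0 Y c" "eval_cochain (\<lambda>_. 1) c = 0"
  obtains w where "singular_chain 1 Y w" "chain_boundary 1 w = c"
proof (cases "c = 0")
  case True
  with that[of 0] show ?thesis by auto
next
  case False
  \<comment> \<open>A nonzero chain supplies the point of comparison; \<open>Y\<close> might
    otherwise be empty.\<close>
  then obtain f where "singular_simplex 0 Y f"
    using assms(2) by (auto simp: singular_chain_def) (metis keys_eq_empty all_not_in_conv mem_Collect_eq subsetD)
  then have "homologous_rel 0 Y {} c 0"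
    using homologous_rel_0_frag_cmul assms by fastforce
  then show ?thesis
    using that by (auto simp: homologous_rel_def singular_boundary)
qed

text \<open>By a Lebesgue number argument, iterated subdivision makes every simplex lie in one of
  the two interiors; the chain is then split according to which one.\<close>

lemma small_chain_decomposition:
  assumes c: "singular_chain p X c" and cov: "topspace X \<subseteq> X interior_of U \<union> X interior_of V"
  obtains n c1 c2 where "(singular_subdivision p ^^ n) c = c1 + c2"
    "singular_chain p (subtopology X U) c1" "singular_chain p (subtopology X V) c2"
proof -
  obtain n where n: "\<And>m f. \<lbrakk>n \<le> m; f \<in> Poly_Mapping.keys ((singular_subdivision p ^^ m) c)\<rbrakk>
      \<Longrightarrow> \<exists>W \<in> {X interior_of U, X interior_of V}. f \<in> (standard_simplex p) \<rightarrow> W"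
    by (rule sufficient_iterated_singular_subdivision_exists
          [of "{X interior_of U, X interior_of V}" X p c]) (use c cov in auto)
  let ?c = "(singular_subdivision p ^^ n) c"
  have sc: "singular_chain p X ((singular_subdivision p ^^ m) c)" for m
    by (induction m) (auto simp: singular_chain_singular_subdivision c)
  have "Poly_Mapping.keys ?c \<subseteq> singular_simplex_set p (subtopology X U)
                              \<union> singular_simplex_set p (subtopology X V)"
  proof
    fix f assume f: "f \<in> Poly_Mapping.keys ?c"
    then have "singular_simplex p X f" using sc by (auto simp: singular_chain_def)
    then show "f \<in> singular_simplex_set p (subtopology X U)
                              \<union> singular_simplex_set p (subtopology X V)"
      using n [OF order_refl f] interior_of_subset [of X U] interior_of_subset [of X V]
      by (fastforce simp: singular_simplex_subtopology)
  qed
  then show ?thesis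
    using that frag_split unfolding singular_chain_def by metis
qed

lemma homologous_rel_iterated_subdivision:
  assumes "singular_relcycle p X T c"
  shows "homologous_rel p X T c ((singular_subdivision p ^^ n) c)"
proof (induction n)
  case 0
  then show ?case by simp
next
  case (Suc n)
  have "singular_relcycle p X T ((singular_subdivision p ^^ n) c)"
    using Suc assms homologous_rel_singular_relcycle_1 by blast
  from homologous_rel_singular_subdivision [OF this] Suc show ?case
    by simp (metis homologous_rel_eq)
qed

lemma chain_boundary_iterated_subdivision:
  assumes "singular_chain p X c"
  shows "chain_boundary p ((singular_subdivision p ^^ n) c) =
         (singular_subdivision (p - Suc 0) ^^ n) (chain_boundary p c)"
proof (induction n)
  case (Suc n)
  have "singular_chain p X ((singular_subdivision p ^^ n) c)"
    by (induction n) (auto simp: singular_chain_singular_subdivision assms)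
  with Suc show ?case by (simp add: chain_boundary_singular_subdivision)
qed auto

lemma iterated_subdivision_add:
  "(singular_subdivision p ^^ n) (a + b) = (singular_subdivision p ^^ n) a + (singular_subdivision p ^^ n) b"
  by (induction n) (auto simp: singular_subdivision_add)

lemma singular_chain_Int:
  "\<lbrakk>singular_chain p (subtopology X P) c; singular_chain p (subtopology X Q) c\<rbrakk>
    \<Longrightarrow> singular_chain p (subtopology X (P \<inter> Q)) c"
  by (auto simp: singular_chain_subtopology)

text \<open>The predicate is imposed on every stage of the homotopy, not only on its two ends, and
  this lets the homotopy restrict to \<open>P\<close>.\<close>

lemma homotopic_with_subtopology:
  assumes "homotopic_with (\<lambda>f. f \<in> P \<rightarrow> P) X X f g"
  shows "homotopic_with (\<lambda>_. True) (subtopology X P) (subtopology X P) f g"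
proof -
  obtain h where h: "continuous_map (prod_topology (top_of_set {0..1::real}) X) X h"
    "\<And>x. h (0, x) = f x" "\<And>x. h (1, x) = g x"
    "\<And>t x. \<lbrakk>t \<in> {0..1}; x \<in> P\<rbrakk> \<Longrightarrow> h (t, x) \<in> P"
    using assms by (fastforce simp: homotopic_with_def)
  have "continuous_map (prod_topology (top_of_set {0..1::real}) (subtopology X P)) (subtopology X P) h"
    using h continuous_map_from_subtopology [OF h(1), of "{0..1} \<times> P"]
    by (auto simp: continuous_map_in_subtopology prod_topology_subtopology)
  with h show ?thesis by (auto simp: homotopic_with_def)
qed

text \<open>\<open>P\<close> and \<open>Q\<close> need not be open: the chains are cut along the neighbourhoods
  \<open>d -` P\<close> and \<open>d -` Q\<close> and pushed back into \<open>P\<close> and \<open>Q\<close> by \<open>d\<close>.\<close>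

locale squeezed_cover =
  fixes X :: "'a topology" and P Q :: "'a set" and d :: "'a \<Rightarrow> 'a"
  assumes homP: "homotopic_with (\<lambda>f. f \<in> P \<rightarrow> P) X X id d"
    and homQ: "homotopic_with (\<lambda>f. f \<in> Q \<rightarrow> Q) X X id d"
    and cover: "topspace X \<subseteq> X interior_of {x. d x \<in> P} \<union> X interior_of {x. d x \<in> Q}"
begin

lemma contd: "continuous_map X X d"
  using homotopic_with_imp_continuous_maps [OF homP] by blast

text \<open>The homotopy from the identity to \<open>d\<close> never leaves \<open>P\<close>, so the
  homology between \<open>c\<close> and its image already exists inside \<open>P\<close>.\<close>

lemma homologous_rel_squeeze:
  assumes "singular_relcycle p (subtopology X P) {} c"
  shows "homologous_rel p (subtopology X P) {} c (chain_map p d c)"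
  using homotopic_imp_homologous_rel_chain_maps
    [OF homotopic_with_mono [OF homotopic_with_subtopology [OF homP]] assms]
    chain_map_ident assms unfolding singular_cycle by fastforce

lemma squeeze_decomposition:
  assumes "singular_chain p X c"
  obtains n c1 c2 where "chain_map p d ((singular_subdivision p ^^ n) c) = c1 + c2"
    "singular_chain p (subtopology X P) c1" "singular_chain p (subtopology X Q) c2"
proof -
  obtain n c1 c2 where n: "(singular_subdivision p ^^ n) c = c1 + c2"
    and c1: "singular_chain p (subtopology X {x. d x \<in> P}) c1"
    and c2: "singular_chain p (subtopology X {x. d x \<in> Q}) c2"
    using small_chain_decomposition [OF assms cover] by metis
  have "continuous_map (subtopology X {x. d x \<in> W}) (subtopology X W) d" for W
    using contd by (auto simp: continuous_map_in_subtopology continuous_map_from_subtopology)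
  then have "singular_chain p (subtopology X P) (chain_map p d c1)"
            "singular_chain p (subtopology X Q) (chain_map p d c2)"
    using c1 c2 singular_chain_chain_map by metis+
  then show ?thesis using that n chain_map_add by metis
qed

lemma cycle_decomposition:
  assumes "singular_relcycle p X {} z"
  obtains c1 c2 where "homologous_rel p X {} z (c1 + c2)"
    "singular_chain p (subtopology X P) c1" "singular_chain p (subtopology X Q) c2"
proof -
  obtain n c1 c2 where n: "chain_map p d ((singular_subdivision p ^^ n) z) = c1 + c2"
    and *: "singular_chain p (subtopology X P) c1" "singular_chain p (subtopology X Q) c2"
    using squeeze_decomposition assms by (metis singular_cycle)
  let ?z = "(singular_subdivision p ^^ n) z"
  have z: "homologous_rel p X {} z ?z"
    using homologous_rel_iterated_subdivision assms by blast
  then have z': "singular_relcycle p X {} ?z"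
    using assms homologous_rel_singular_relcycle by blast
  have "homologous_rel p X {} (chain_map p id ?z) (chain_map p d ?z)"
    by (rule homotopic_imp_homologous_rel_chain_maps [OF homotopic_with_mono [OF homP] z']) auto
  then have "homologous_rel p X {} z (c1 + c2)"
    using z z' n chain_map_ident by (metis homologous_rel_trans singular_cycle)
  with * that show ?thesis by blast
qed

lemma swap: "squeezed_cover X Q P d"
  by unfold_locales (use homP homQ cover in auto)

text \<open>Exactness of Mayer-Vietoris in the middle: a chain bounding \<open>a + b\<close> is cut
  into a part in \<open>P\<close> and a part in \<open>Q\<close>, and the boundary of the cut yields
  the cycle \<open>c\<close> in the intersection. Cutting replaces \<open>a\<close> and
  \<open>b\<close> by their subdivided and squeezed versions, which are homologous to them in
  \<open>P\<close> and \<open>Q\<close> respectively.\<close>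

lemma cycle_kernel:
  assumes a: "singular_relcycle p (subtopology X P) {} a"
    and b: "singular_relcycle p (subtopology X Q) {} b"
    and ab: "homologous_rel p X {} (a + b) 0"
  obtains c where "singular_relcycle p (subtopology X (P \<inter> Q)) {} c"
    "homologous_rel p (subtopology X P) {} a c" "homologous_rel p (subtopology X Q) {} b (- c)"
proof -
  obtain e where e: "singular_chain (Suc p) X e" "chain_boundary (Suc p) e = a + b"
    using ab by (auto simp: homologous_rel_def singular_boundary)
  obtain n e1 e2 where n: "chain_map (Suc p) d ((singular_subdivision (Suc p) ^^ n) e) = e1 + e2"
    and e1: "singular_chain (Suc p) (subtopology X P) e1"
    and e2: "singular_chain (Suc p) (subtopology X Q) e2"
    using squeeze_decomposition e by metis
  let ?s = "\<lambda>c. chain_map p d ((singular_subdivision p ^^ n) c)"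
  have sde: "singular_chain (Suc p) X ((singular_subdivision (Suc p) ^^ m) e)" for m
    by (induction m) (auto simp: singular_chain_singular_subdivision e)
  have "chain_boundary (Suc p) (e1 + e2) = ?s (a + b)"
    using chain_boundary_chain_map [OF sde] chain_boundary_iterated_subdivision [OF e(1)] e(2)
    by (simp flip: n)
  \<comment> \<open>The left side is a chain in \<open>P\<close> and the right side one in
    \<open>Q\<close>, so their common value lies in both.\<close>
  then have eq: "?s a - chain_boundary (Suc p) e1 = - (?s b - chain_boundary (Suc p) e2)"
    by (simp add: iterated_subdivision_add chain_map_add chain_boundary_add algebra_simps)
  have ha: "homologous_rel p (subtopology X P) {} a (?s a)"
    using homologous_rel_iterated_subdivision [OF a] homologous_rel_squeeze
    by (metis a homologous_rel_singular_relcycle homologous_rel_trans)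
  have hb: "homologous_rel p (subtopology X Q) {} b (?s b)"
    using homologous_rel_iterated_subdivision [OF b] squeezed_cover.homologous_rel_squeeze [OF swap]
    by (metis b homologous_rel_singular_relcycle homologous_rel_trans)
  define c where "c = ?s a - chain_boundary (Suc p) e1"
  have 1: "homologous_rel p (subtopology X P) {} (?s a) c"
    unfolding c_def homologous_rel_def singular_boundary using e1 by auto
  have "homologous_rel p (subtopology X Q) {} (?s b) (?s b - chain_boundary (Suc p) e2)"
    unfolding homologous_rel_def singular_boundary using e2 by auto
  then have 2: "homologous_rel p (subtopology X Q) {} (?s b) (- c)"
    unfolding c_def eq by simp
  have Pc: "homologous_rel p (subtopology X P) {} a c"
    using ha 1 homologous_rel_trans by blast
  have Qc: "homologous_rel p (subtopology X Q) {} b (- c)"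
    using hb 2 homologous_rel_trans by blast
  have "singular_relcycle p (subtopology X P) {} c" "singular_relcycle p (subtopology X Q) {} c"
    using Pc Qc a b homologous_rel_singular_relcycle singular_relcycle_minus by metis+
  then have "singular_relcycle p (subtopology X (P \<inter> Q)) {} c"
    using singular_chain_Int by (auto simp: singular_cycle)
  then show ?thesis using that Pc Qc by blast
qed

text \<open>Cutting a cycle leaves two chains with opposite boundaries. Their boundary is a 0-chain
  of augmentation zero in the path connected intersection, hence bounds some \<open>w\<close> there;
  moving \<open>w\<close> from one piece to the other closes both.\<close>

lemma one_cycle_splits:
  assumes z: "singular_relcycle 1 X {} z" and K: "path_connectedin X (P \<inter> Q)"
  obtains a b where "singular_relcycle 1 (subtopology X P) {} a"
    "singular_relcycle 1 (subtopology X Q) {} b" "homologous_rel 1 X {} z (a + b)"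
proof -
  obtain c1 c2 where h: "homologous_rel 1 X {} z (c1 + c2)"
    and c1: "singular_chain 1 (subtopology X P) c1" and c2: "singular_chain 1 (subtopology X Q) c2"
    using cycle_decomposition z by metis
  have "chain_boundary 1 (c1 + c2) = 0"
    using h z homologous_rel_singular_relcycle singular_cycle by metis
  then have eq: "chain_boundary 1 c1 = - chain_boundary 1 c2"
    by (simp add: chain_boundary_add eq_neg_iff_add_eq_0)
  have "singular_chain 0 (subtopology X P) (chain_boundary 1 c1)"
       "singular_chain 0 (subtopology X Q) (chain_boundary 1 c1)"
    using singular_chain_boundary c1 c2 singular_chain_minus eq by fastforce+
  then have "singular_chain 0 (subtopology X (P \<inter> Q)) (chain_boundary 1 c1)"
    using singular_chain_Int by blast
  then obtain w where w: "singular_chain 1 (subtopology X (P \<inter> Q)) w"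
      "chain_boundary 1 w = chain_boundary 1 c1"
    using zero_chain_boundary_path_connected eval_cochain_1_boundary K
    unfolding path_connectedin_def by metis
  have wPQ: "singular_chain 1 (subtopology X P) w" "singular_chain 1 (subtopology X Q) w"
    using w singular_chain_mono by blast+
  show ?thesis
  proof
    show "singular_relcycle 1 (subtopology X P) {} (c1 - w)"
      using wPQ c1 w by (simp add: singular_cycle singular_chain_diff chain_boundary_diff)
    show "singular_relcycle 1 (subtopology X Q) {} (c2 + w)"
      using wPQ c2 w eq by (simp add: singular_cycle singular_chain_add chain_boundary_add)
    show "homologous_rel 1 X {} z (c1 - w + (c2 + w))" using h by simp
  qed
qed

end

section \<open>First homology classes\<close>

abbreviation hcl :: "'a topology \<Rightarrow> 'a chain \<Rightarrow> 'a chain set" where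
  "hcl X c \<equiv> homologous_rel_set (Suc 0) X {} c"

lemma carrier_homology_1:
  "carrier (homology_group 1 X) = hcl X ` singular_relcycle_set (Suc 0) X {}"
  using carrier_relative_homology_group [of 1 X "{}"] by simp

lemma hcl_carrier [simp]:
  "singular_relcycle (Suc 0) X {} c \<Longrightarrow> hcl X c \<in> carrier (homology_group 1 X)"
  by (auto simp: carrier_homology_1)

lemma homology_1_cases:
  assumes "x \<in> carrier (homology_group 1 X)"
  obtains c where "singular_relcycle (Suc 0) X {} c" "x = hcl X c"
  using assms by (auto simp: carrier_homology_1)

lemma hcl_eq_iff: "hcl X a = hcl X b \<longleftrightarrow> homologous_rel (Suc 0) X {} a b"
  by (rule homologous_rel_set_eq)

lemma hcl_zero: "\<one>\<^bsub>homology_group 1 X\<^esub> = hcl X 0"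
  using one_relative_homology_group [of 1 X "{}"]
  by (metis One_nat_def homologous_rel_set_eq_relboundary of_nat_1 singular_relboundary_0)

lemma hcl_add: "hcl X a \<otimes>\<^bsub>homology_group 1 X\<^esub> hcl X b = hcl X (a + b)"
proof -
  \<comment> \<open>Classes multiply as cosets, by forming all sums of representatives; writing
    \<open>c\<close> as \<open>(c - b) + b\<close> shows that these sums exhaust the class of
    \<open>a + b\<close>.\<close>
  have "homologous_rel (Suc 0) X {} (a + b) c \<Longrightarrow>
      \<exists>r. homologous_rel (Suc 0) X {} a r \<and> (\<exists>s. homologous_rel (Suc 0) X {} b s \<and> c = r + s)" for c
    by (rule exI [of _ "c - b"])
      (metis add_diff_cancel_right' diff_add_cancel homologous_rel_diff homologous_rel_refl)
  then show ?thesis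
    using mult_relative_homology_group [of 1 X "{}"] by (auto simp: homologous_rel_add)
qed

lemma hcl_uminus:
  assumes "singular_relcycle (Suc 0) X {} a"
  shows "inv\<^bsub>homology_group 1 X\<^esub> hcl X a = hcl X (- a)"
  by (rule group.inv_equality) (use assms in \<open>auto simp: hcl_add hcl_zero singular_relcycle_minus\<close>)

lemma hcl_int_pow:
  assumes "singular_relcycle (Suc 0) X {} a"
  shows "hcl X a [^]\<^bsub>homology_group 1 X\<^esub> (m::int) = hcl X (frag_cmul m a)"
proof -
  interpret group "homology_group 1 X" by simp
  have nat: "hcl X a [^]\<^bsub>homology_group 1 X\<^esub> n = hcl X (frag_cmul (int n) a)" for n :: nat
    by (induction n) (auto simp: hcl_zero hcl_add frag_cmul_distrib add.commute)
  show ?thesis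
  proof (cases "m \<ge> 0")
    case True
    then show ?thesis using nat [of "nat m"] by (metis int_nat_eq int_pow_int)
  next
    case False
    then have "hcl X a [^]\<^bsub>homology_group 1 X\<^esub> m = inv\<^bsub>homology_group 1 X\<^esub> hcl X (frag_cmul (- m) a)"
      using nat [of "nat (- m)"] int_pow_neg_int [of "hcl X a" "nat (-m)"] assms by simp
    then show ?thesis
      using assms by (simp add: hcl_uminus singular_relcycle_cmul)
  qed
qed

lemma hom_induced_hcl:
  assumes "continuous_map X Y f" "singular_relcycle (Suc 0) X {} c"
  shows "hom_induced 1 X {} Y {} f (hcl X c) = hcl Y (chain_map (Suc 0) f c)"
  using hom_induced_chain_map [OF assms(1) _ assms(2)] by simp

lemma hom_induced_group_hom:
  "group_hom (homology_group p X) (homology_group p Y) (hom_induced p X {} Y {} f)"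
  by (simp add: group_hom_def group_hom_axioms_def hom_induced_hom)

section \<open>The circle\<close>

text \<open>The angles are real numbers rather than residues mod 2 pi, so arcs may wind around, and
  \<open>b < a\<close> gives a clockwise arc.\<close>

definition circle_arc :: "real \<Rightarrow> real \<Rightarrow> (nat \<Rightarrow> real) \<Rightarrow> complex" where
  "circle_arc a b = restrict (\<lambda>t. cis (a * t 0 + b * t 1)) (standard_simplex 1)"

section \<open>Continuous maps into the circle\<close>

lemma continuous_map_simplex_coord:
  "continuous_map (subtopology (powertop_real UNIV) (standard_simplex p)) euclideanreal (\<lambda>x. x i)"
  by (metis UNIV_I continuous_map_from_subtopology continuous_map_product_projection)

lemma continuous_map_cis: "continuous_map Y euclideanreal f \<Longrightarrow> continuous_map Y circle (\<lambda>t. cis (f t))"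
proof -
  assume f: "continuous_map Y euclideanreal f"
  have "continuous_map euclidean circle cis"
    by (auto simp: continuous_map_in_subtopology continuous_on_cis)
  from continuous_map_compose [OF f this] show ?thesis by (simp add: o_def)
qed

lemma continuous_map_circle_mult:
  assumes "continuous_map Y circle f" "continuous_map Y circle g"
  shows "continuous_map Y circle (\<lambda>y. f y * g y)"
proof -
  have "continuous_map Y (prod_topology circle circle) (\<lambda>y. (f y, g y))"
    using assms by (rule continuous_map_pairedI)
  moreover have "continuous_map (prod_topology circle circle) circle (\<lambda>(a, b). a * b)"
    unfolding prod_topology_subtopology_eu continuous_map_in_subtopology
    by (auto simp: norm_mult case_prod_unfold intro!: continuous_intros)
  ultimately have "continuous_map Y circle ((\<lambda>(a, b). a * b) \<circ> (\<lambda>y. (f y, g y)))"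
    by (rule continuous_map_compose)
  then show ?thesis by (simp add: o_def)
qed

lemma continuous_map_circle_cnj: "continuous_map circle circle cnj"
  by (auto simp: continuous_map_in_subtopology intro!: continuous_intros)

section \<open>Arcs and the loops they form\<close>

lemma singular_simplex_cis:
  "singular_simplex p circle (restrict (\<lambda>t. cis (a * t 0 + b * t 1 + c * t 2)) (standard_simplex p))"
  unfolding singular_simplex_def
  by (auto intro!: continuous_map_cis continuous_map_add continuous_map_real_mult_left continuous_map_simplex_coord)

lemma singular_simplex_arc: "singular_simplex (Suc 0) circle (circle_arc a b)"
  using singular_simplex_cis [of 1 a b 0] by (simp add: circle_arc_def)

lemma arc_boundary:
  "chain_boundary (Suc 0) (frag_of (circle_arc a b)) =
     frag_of (restrict (\<lambda>_. cis b) (standard_simplex 0)) - frag_of (restrict (\<lambda>_. cis a) (standard_simplex 0))"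
proof -
  have face: "simplical_face k x \<in> standard_simplex (Suc 0)" if "x \<in> standard_simplex 0" "k \<le> Suc 0" for k and x :: "nat \<Rightarrow> real"
    using simplical_face_in_standard_simplex [of 1 k x] that by simp
  have "singular_face (Suc 0) k (circle_arc a b) = restrict (\<lambda>x. cis (a * simplical_face k x 0 + b * simplical_face k x 1))
      (standard_simplex 0)" if "k \<le> 1" for k
    using that by (auto simp: fun_eq_iff singular_face_def circle_arc_def face restrict_def)
  then have "singular_face (Suc 0) 0 (circle_arc a b) = restrict (\<lambda>_. cis b) (standard_simplex 0)"
       "singular_face (Suc 0) (Suc 0) (circle_arc a b) = restrict (\<lambda>_. cis a) (standard_simplex 0)"
    by (simp_all add: simplical_face_def standard_simplex_0 restrict_def fun_eq_iff)
  then show ?thesis by (simp add: chain_boundary_of)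
qed

text \<open>The triangle whose angle function is affine with values \<open>a\<close>,
  \<open>b\<close>, \<open>c\<close> at its vertices has exactly the three arcs as faces.\<close>

lemma arc_concat: "homologous_rel (Suc 0) circle {} (frag_of (circle_arc a b) + frag_of (circle_arc b c)) (frag_of (circle_arc a c))"
proof -
  define \<sigma> where "\<sigma> = restrict (\<lambda>t. cis (a * t 0 + b * t 1 + c * t 2)) (standard_simplex 2)"
  have face: "simplical_face k x \<in> standard_simplex 2" if "x \<in> standard_simplex (Suc 0)" "k \<le> 2" for k and x :: "nat \<Rightarrow> real"
    using simplical_face_in_standard_simplex [of 2 k x] that by simp
  have "singular_face 2 k \<sigma> = restrict (\<lambda>x. cis (a * simplical_face k x 0 + b * simplical_face k x 1
          + c * simplical_face k x 2)) (standard_simplex 1)" if "k \<le> 2" for k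
    using that by (auto simp: fun_eq_iff singular_face_def \<sigma>_def face restrict_def)
  then have "singular_face 2 0 \<sigma> = circle_arc b c" "singular_face 2 1 \<sigma> = circle_arc a c" "singular_face 2 2 \<sigma> = circle_arc a b"
    by (simp_all add: circle_arc_def simplical_face_def)
  then have "chain_boundary (Suc (Suc 0)) (frag_of \<sigma>) = frag_of (circle_arc b c) - frag_of (circle_arc a c) + frag_of (circle_arc a b)"
    by (simp add: chain_boundary_of numeral_2_eq_2)
  moreover have "singular_simplex (Suc (Suc 0)) circle \<sigma>"
    using singular_simplex_cis [of 2 a b c] by (simp add: \<sigma>_def numeral_2_eq_2)
  ultimately show ?thesis
    unfolding homologous_rel_def singular_boundary
    by (intro exI [of _ "frag_of \<sigma>"]) (simp add: singular_chain_of)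
qed

text \<open>Barycentric coordinates sum to 1, so shifting both end angles shifts every intermediate
  angle by the same multiple of 2 pi.\<close>

lemma arc_shift: "circle_arc (a + 2 * pi * of_int k) (b + 2 * pi * of_int k) = circle_arc a b"
proof -
  have "cis ((a + 2 * pi * of_int k) * t 0 + (b + 2 * pi * of_int k) * t 1) = cis (a * t 0 + b * t 1)"
    if "t \<in> standard_simplex 1" for t
  proof -
    have t: "t 1 = 1 - t 0" using that by (simp add: standard_simplex_def)
    have eq: "(a + 2 * pi * of_int k) * t 0 + (b + 2 * pi * of_int k) * t 1 = (a * t 0 + b * t 1) + 2 * pi * of_int k"
      unfolding t by (simp add: algebra_simps)
    show ?thesis unfolding eq by (simp add: cis_multiple_2pi flip: cis_mult)
  qed
  then show ?thesis unfolding circle_arc_def by (intro restrict_ext)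
qed

lemma circle_class_arc: "circle_class = hcl circle (frag_of (circle_arc 0 (2 * pi)))"
  by (simp add: circle_class_def circle_arc_def)

lemma arc_cycle: "cis a = cis b \<Longrightarrow> singular_relcycle (Suc 0) circle {} (frag_of (circle_arc a b))"
  by (simp add: singular_cycle singular_chain_of singular_simplex_arc arc_boundary)

lemma circle_class_carrier [simp]: "circle_class \<in> carrier (homology_group 1 circle)"
  by (simp add: circle_class_arc arc_cycle)

text \<open>Adding \<open>circle_arc 0 a\<close> in front moves the starting point of the backward loop to 1.\<close>

lemma arc_backwards:
  "homologous_rel (Suc 0) circle {} (frag_of (circle_arc a (a - 2 * pi))) (- frag_of (circle_arc 0 (2 * pi)))"
proof -
  let ?R = "homologous_rel (Suc 0) circle {}"
  let ?f = "\<lambda>a b. frag_of (circle_arc a b)"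
  have sh: "circle_arc (- (2*pi)) (a - 2 * pi) = circle_arc 0 a" "circle_arc (2*pi) 0 = circle_arc 0 (- (2*pi))"
    using arc_shift [of 0 "-1" a] arc_shift [of 0 1 "- (2*pi)"] by simp_all
  have 1: "?R (?f 0 a + ?f a (a - 2 * pi)) (?f 0 (a - 2 * pi))" by (rule arc_concat)
  have 2: "?R (?f 0 (- (2*pi)) + ?f 0 a) (?f 0 (a - 2 * pi))"
    using arc_concat [of 0 "- (2*pi)" "a - 2*pi"] sh by simp
  have 3: "?R (?f 0 (2*pi) + ?f 0 (- (2*pi))) (?f 0 0)"
    using arc_concat [of 0 "2*pi" 0] sh by simp
  have 4: "?R (?f 0 0 + ?f 0 0) (?f 0 0)" by (rule arc_concat)
  \<comment> \<open>In the combination (1) - (2) + (3) + (4) everything cancels except the two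
    loops; (4) disposes of the constant arc \<open>?f 0 0\<close>.\<close>
  show ?thesis
    using singular_relboundary_diff [OF singular_relboundary_add [OF singular_relboundary_diff
        [OF 1 [unfolded homologous_rel_def] 2 [unfolded homologous_rel_def]] 3 [unfolded homologous_rel_def]]
         singular_relboundary_minus [THEN iffD2, OF 4 [unfolded homologous_rel_def]]]
    unfolding homologous_rel_def by (simp add: algebra_simps)
qed

text \<open>A segment joining two non-antipodal points of the circle misses the origin, so the
  straight-line homotopy can be normalised.\<close>

lemma homotopic_circle_maps:
  assumes f: "continuous_map Y circle f" and g: "continuous_map Y circle g"
    and ne: "\<And>y. y \<in> topspace Y \<Longrightarrow> f y \<noteq> - g y"
  shows "homotopic_with (\<lambda>_. True) Y circle f g"
proof -
  define k where "k = (\<lambda>(t::real, y). (1 - t) *\<^sub>R f y + t *\<^sub>R g y)"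
  let ?Z = "prod_topology (top_of_set {0..1::real}) Y"
  have nf: "norm (f y) = 1" "norm (g y) = 1" if "y \<in> topspace Y" for y
    using f g that by (auto simp: continuous_map_in_subtopology Pi_iff)
  have "continuous_map Y euclidean f" "continuous_map Y euclidean g"
    using f g by (auto simp: continuous_map_in_subtopology)
  then have "continuous_map ?Z (prod_topology euclidean (prod_topology euclidean euclidean))
      (\<lambda>p. (fst p, f (snd p), g (snd p)))"
    by (intro continuous_map_pairedI continuous_map_compose [OF continuous_map_snd, unfolded o_def]
        continuous_map_into_fulltopology [OF continuous_map_fst])
  then have "continuous_map ?Z euclidean (\<lambda>p. (fst p, f (snd p), g (snd p)))"
    by simp
  moreover have "continuous_map euclidean euclidean (\<lambda>(t::real, a::complex, b). (1 - t) *\<^sub>R a + t *\<^sub>R b)"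
    by (auto simp: case_prod_unfold intro!: continuous_intros)
  ultimately have "continuous_map ?Z euclidean
      ((\<lambda>(t, a, b). (1 - t) *\<^sub>R a + t *\<^sub>R b) \<circ> (\<lambda>p. (fst p, f (snd p), g (snd p))))"
    by (rule continuous_map_compose)
  then have k: "continuous_map ?Z euclidean k"
    by (simp add: k_def o_def case_prod_unfold)
  have k0: "k (t, y) \<noteq> 0" if "0 \<le> t" "t \<le> 1" "y \<in> topspace Y" for t y
  proof
    assume "k (t, y) = 0"
    then have eq: "(1 - t) *\<^sub>R f y = - (t *\<^sub>R g y)"
      by (simp add: k_def eq_neg_iff_add_eq_0)
    have "norm ((1 - t) *\<^sub>R f y) = norm (t *\<^sub>R g y)"
      by (simp only: eq norm_minus_cancel)
    \<comment> \<open>A zero of the segment forces equal weights, and then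
      \<open>f y = - g y\<close>.\<close>
    then have "1 - t = t"
      using nf [OF that(3)] that by simp
    then have "(1 - t) *\<^sub>R f y = (1 - t) *\<^sub>R (- g y)" "1 - t \<noteq> 0"
      using eq by auto
    then show False using ne [OF that(3)] scaleR_left_imp_eq by blast
  qed
  let ?h = "\<lambda>p. k p / of_real (norm (k p))"
  have "continuous_map ?Z circle ?h"
  proof -
    have "continuous_map ?Z (top_of_set (- {0})) k"
      using k k0 by (auto simp: continuous_map_in_subtopology)
    moreover have "continuous_map (top_of_set (- {0::complex})) circle (\<lambda>x. x / of_real (norm x))"
      by (auto simp: continuous_map_in_subtopology norm_divide intro!: continuous_intros)
    ultimately have "continuous_map ?Z circle ((\<lambda>x. x / of_real (norm x)) \<circ> k)"
      by (rule continuous_map_compose)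
    then show ?thesis by (simp add: o_def)
  qed
  moreover have "?h (0, y) = f y" "?h (1, y) = g y" if "y \<in> topspace Y" for y
    using nf that by (simp_all add: k_def)
  ultimately show ?thesis
    by (subst homotopic_with, simp, intro exI [of _ ?h]) simp
qed

section \<open>First homology of the product with a circle\<close>

lemma homotopic_into_times_circle:
  assumes p: "continuous_map Y S p" and h: "homotopic_with (\<lambda>_. True) Y circle f g"
  shows "homotopic_with (\<lambda>_. True) Y (prod_topology S circle) (\<lambda>y. (p y, f y)) (\<lambda>y. (p y, g y))"
proof -
  obtain k where k: "continuous_map (prod_topology (top_of_set {0..1::real}) Y) circle k"
    "\<And>x. k (0, x) = f x" "\<And>x. k (1, x) = g x"
    using h by (auto simp: homotopic_with_def)
  show ?thesis
    unfolding homotopic_with_def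
  proof (intro exI [of _ "\<lambda>q. (p (snd q), k q)"] conjI)
    show "continuous_map (prod_topology (top_of_set {0..1}) Y) (prod_topology S circle) (\<lambda>q. (p (snd q), k q))"
      by (intro continuous_map_pairedI continuous_map_compose [OF continuous_map_snd p, unfolded o_def] k)
  qed (use k in auto)
qed

text \<open>Off the slit at \<open>- w\<close> the circle coordinate is never antipodal to
  \<open>w\<close>, so it contracts to the constant \<open>w\<close>. Since \<open>w\<close> is not
  antipodal to 1, that constant moves on to 1. The second homotopy takes place in the full
  product.\<close>

lemma cycle_off_a_point:
  assumes w: "norm w = 1" "w \<noteq> - 1"
    and c: "singular_relcycle (Suc 0) (subtopology (prod_topology S circle) (UNIV \<times> {\<alpha>. \<alpha> \<noteq> - w})) {} c"
  shows "homologous_rel (Suc 0) (prod_topology S circle) {} c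
           (chain_map (Suc 0) (\<lambda>s. (s, 1)) (chain_map (Suc 0) fst c))"
proof -
  let ?T = "prod_topology S circle"
  let ?Y = "subtopology ?T (UNIV \<times> {\<alpha>. \<alpha> \<noteq> - w})"
  have fst: "continuous_map ?Y S fst" and snd: "continuous_map ?Y circle snd"
    by (simp_all add: continuous_map_from_subtopology continuous_map_fst continuous_map_snd)
  have const: "continuous_map ?Y circle (\<lambda>_. v)" if "norm v = 1" for v
    using that by simp
  have "homotopic_with (\<lambda>_. True) ?Y circle snd (\<lambda>_. w)"
    using w by (intro homotopic_circle_maps snd const) auto
  moreover have "homotopic_with (\<lambda>_. True) ?Y circle (\<lambda>_. w) (\<lambda>_. 1)"
    using w by (intro homotopic_circle_maps const) auto
  ultimately have "homotopic_with (\<lambda>_. True) ?Y ?T (\<lambda>y. (fst y, snd y)) (\<lambda>y. (fst y, 1))"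
    using homotopic_into_times_circle [OF fst] homotopic_with_trans by blast
  then have "homologous_rel (Suc 0) ?T {} (chain_map (Suc 0) id c) (chain_map (Suc 0) ((\<lambda>s. (s, 1)) \<circ> fst) c)"
    using homotopic_imp_homologous_rel_chain_maps [OF homotopic_with_mono c]
    by (simp add: o_def id_def)
  then show ?thesis
    using chain_map_ident c singular_cycle by (metis chain_map_compose comp_apply)
qed

text \<open>The sign \<open>\<epsilon>\<close> treats the open right and left half circles together;
  the left one is the negative of the right one, which is an arc of angles.\<close>

lemma path_connected_half_circle:
  assumes "\<epsilon> = 1 \<or> \<epsilon> = (-1::real)"
  shows "path_connected {\<alpha> \<in> sphere 0 1. \<epsilon> * Re \<alpha> > 0}"
proof -
  have "{\<alpha> \<in> sphere 0 1. \<epsilon> * Re \<alpha> > 0} = (\<lambda>t. complex_of_real \<epsilon> * cis t) ` {- (pi/2) <..< pi/2}"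
  proof (intro equalityI subsetI)
    fix \<alpha> :: complex assume "\<alpha> \<in> {\<alpha> \<in> sphere 0 1. \<epsilon> * Re \<alpha> > 0}"
    then have n: "norm (complex_of_real \<epsilon> * \<alpha>) = 1" "Re (complex_of_real \<epsilon> * \<alpha>) > 0"
      using assms by auto
    then have ne: "complex_of_real \<epsilon> * \<alpha> \<noteq> 0" by auto
    have "\<bar>Arg (complex_of_real \<epsilon> * \<alpha>)\<bar> < pi/2"
      using n Arg_Re_pos by blast
    moreover have "cis (Arg (complex_of_real \<epsilon> * \<alpha>)) = complex_of_real \<epsilon> * \<alpha>"
      using cis_Arg [OF ne] n by (simp add: sgn_eq)
    ultimately show "\<alpha> \<in> (\<lambda>t. complex_of_real \<epsilon> * cis t) ` {- (pi/2) <..< pi/2}"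
      using assms by (intro image_eqI [of _ _ "Arg (complex_of_real \<epsilon> * \<alpha>)"]) auto
  next
    fix \<alpha> assume "\<alpha> \<in> (\<lambda>t. complex_of_real \<epsilon> * cis t) ` {- (pi/2) <..< pi/2}"
    then obtain t where t: "\<alpha> = complex_of_real \<epsilon> * cis t" "t \<in> {- (pi/2) <..< pi/2}" by blast
    then show "\<alpha> \<in> {\<alpha> \<in> sphere 0 1. \<epsilon> * Re \<alpha> > 0}"
      using assms cos_gt_zero_pi [of t] by (auto simp: norm_mult)
  qed
  moreover have "path_connected ((\<lambda>t. complex_of_real \<epsilon> * cis t) ` {- (pi/2) <..< pi/2})"
    by (intro path_connected_continuous_image continuous_intros convex_imp_path_connected) auto
  ultimately show ?thesis by simp
qed

lemma path_connected_times_half_circle: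
  assumes "path_connected_space S" "\<epsilon> = 1 \<or> \<epsilon> = (-1::real)"
  shows "path_connected_space (subtopology (prod_topology S circle) (UNIV \<times> {\<alpha>. \<epsilon> * Re \<alpha> > 0}))"
proof -
  have "sphere 0 1 \<inter> {\<alpha>. \<epsilon> * Re \<alpha> > 0} = {\<alpha> \<in> sphere 0 1. \<epsilon> * Re \<alpha> > 0}" by blast
  then have "subtopology (prod_topology S circle) (UNIV \<times> {\<alpha>. \<epsilon> * Re \<alpha> > 0}) =
        prod_topology S (top_of_set {\<alpha> \<in> sphere 0 1. \<epsilon> * Re \<alpha> > 0})"
    unfolding subtopology_Times subtopology_subtopology subtopology_UNIV by (rule arg_cong)
  moreover have "path_connected_space (top_of_set {\<alpha> \<in> sphere 0 1. \<epsilon> * Re \<alpha> > 0})"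
    using path_connected_half_circle [OF assms(2)] by simp
  ultimately show ?thesis
    using assms(1) by (metis path_connected_space_prod_topology)
qed

text \<open>This takes the place of the Kuenneth formula. The circle is covered by its complements
  of \<open>- \<i>\<close> and of \<open>\<i>\<close>, and each resulting slit cylinder deforms onto
  a copy of \<open>S\<close>. The overlap has two path components, over the right and the left half
  circle, which is why the pieces of a cut cycle cannot simply be closed up in the overlap: the
  defect \<open>m\<close> is the number of meridians.\<close>

lemma times_circle_cycle:
  fixes S :: "'s topology"
  assumes S: "path_connected_space S" and z: "z \<in> topspace S"
    and x: "singular_relcycle (Suc 0) (prod_topology S circle) {} x"
  obtains y m where "singular_relcycle (Suc 0) S {} y"
    "homologous_rel (Suc 0) (prod_topology S circle) {} x
       (chain_map (Suc 0) (\<lambda>s. (s, 1)) y +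
        frag_cmul m (chain_map (Suc 0) (\<lambda>\<alpha>. (z, \<alpha>)) (frag_of (circle_arc 0 (2 * pi)))))"
proof -
  let ?T = "prod_topology S circle"
  let ?off = "\<lambda>w. UNIV \<times> {\<alpha>. \<alpha> \<noteq> - w} :: ('s \<times> complex) set"
  let ?H = "\<lambda>\<epsilon>. UNIV \<times> {\<alpha>. \<epsilon> * Re \<alpha> > (0::real)} :: ('s \<times> complex) set"
  have op: "openin ?T (topspace ?T \<inter> ?off w)" for w
  proof -
    have "openin ?T {p \<in> topspace ?T. snd p \<in> sphere 0 1 - {- w}}"
      by (rule openin_continuous_map_preimage [OF continuous_map_snd]) (auto intro: openin_delete)
    moreover have "{p \<in> topspace ?T. snd p \<in> sphere 0 1 - {- w}} = topspace ?T \<inter> ?off w" by auto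
    ultimately show ?thesis by simp
  qed
  then have int: "topspace ?T \<inter> ?off w \<subseteq> ?T interior_of ?off w" for w
    by (simp add: interior_of_maximal)
  have "topspace ?T \<subseteq> ?T interior_of ?off \<i> \<union> ?T interior_of ?off (- \<i>)"
  proof
    fix p assume p: "p \<in> topspace ?T"
    have "p \<in> ?off \<i> \<or> p \<in> ?off (- \<i>)"
      by (cases p) (auto simp: complex_eq_iff)
    with p show "p \<in> ?T interior_of ?off \<i> \<union> ?T interior_of ?off (- \<i>)"
      using int by blast
  qed
  then obtain n c1 c2 where n: "(singular_subdivision (Suc 0) ^^ n) x = c1 + c2"
    and c1: "singular_chain (Suc 0) (subtopology ?T (?off \<i>)) c1"
    and c2: "singular_chain (Suc 0) (subtopology ?T (?off (- \<i>))) c2"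
    using small_chain_decomposition x by (metis singular_cycle)
  have h: "homologous_rel (Suc 0) ?T {} x (c1 + c2)"
    using homologous_rel_iterated_subdivision [OF x] n by metis
  then have "chain_boundary (Suc 0) (c1 + c2) = 0"
    using x homologous_rel_singular_relcycle singular_cycle by metis
  then have eq: "chain_boundary (Suc 0) c1 = - chain_boundary (Suc 0) c2"
    by (simp add: chain_boundary_add eq_neg_iff_add_eq_0)
  let ?b = "chain_boundary (Suc 0) c1"
  have "singular_chain 0 (subtopology ?T (?off \<i>)) ?b"
       "singular_chain 0 (subtopology ?T (?off (- \<i>))) ?b"
    using singular_chain_boundary [OF c1] singular_chain_boundary [OF c2] eq
    by (simp_all add: singular_chain_minus)
  then have b: "singular_chain 0 (subtopology ?T (?off \<i> \<inter> ?off (- \<i>))) ?b"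
    by (rule singular_chain_Int)
  \<comment> \<open>A point of the circle other than \<open>\<i>\<close> and \<open>- \<i>\<close>
    has nonzero real part, so each 0-simplex of the cut lies over one of the two half
    circles.\<close>
  have "Poly_Mapping.keys ?b \<subseteq> singular_simplex_set 0 (subtopology ?T (?H 1)) \<union>
        singular_simplex_set 0 (subtopology ?T (?H (-1)))"
  proof
    fix f assume "f \<in> Poly_Mapping.keys ?b"
    then have f: "singular_simplex 0 ?T f" and ff: "f (\<lambda>j. if j = 0 then 1 else 0) \<in> ?off \<i> \<inter> ?off (- \<i>)"
      using b by (auto simp: singular_chain_def singular_simplex_subtopology standard_simplex_0)
    obtain s \<alpha> where s: "f (\<lambda>j. if j = 0 then 1 else 0) = (s, \<alpha>)" by fastforce
    then have "\<alpha> \<in> sphere 0 1"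
      using f by (auto simp: singular_simplex_def continuous_map_def standard_simplex_0 Pi_iff)
    moreover have "\<alpha> = \<i> \<or> \<alpha> = - \<i>" if "\<alpha> \<in> sphere 0 1" "Re \<alpha> = 0"
      using that by (auto simp: complex_eq_iff cmod_def abs_if split: if_splits)
    ultimately have "Re \<alpha> \<noteq> 0"
      using s ff by auto
    then show "f \<in> singular_simplex_set 0 (subtopology ?T (?H 1)) \<union>
        singular_simplex_set 0 (subtopology ?T (?H (-1)))"
      using s f by (auto simp: singular_simplex_subtopology standard_simplex_0)
  qed
  then obtain d1 d2 where d: "?b = d1 + d2" "singular_chain 0 (subtopology ?T (?H 1)) d1"
      "singular_chain 0 (subtopology ?T (?H (-1))) d2"
    using frag_split unfolding singular_chain_def by metis
  let ?e = "eval_cochain (\<lambda>_. 1)"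
  have "?e d1 + ?e d2 = 0"
    using eval_cochain_1_boundary [of c1] d by (simp add: eval_cochain_add)
  \<comment> \<open>The cut as a whole has augmentation zero, so its two halves have opposite
    augmentations.\<close>
  then obtain m where m: "?e d1 = m" "?e d2 = - m" by (metis add.commute eq_neg_iff_add_eq_0)
  let ?pt = "\<lambda>v. restrict (\<lambda>_. (z, v)) (standard_simplex 0)"
  have pt: "singular_simplex 0 (subtopology ?T (?H \<epsilon>)) (?pt (of_real \<epsilon>))" if "\<epsilon> = 1 \<or> \<epsilon> = -1" for \<epsilon>
    using z that by (auto simp: singular_simplex_subtopology singular_simplex_def)
  have "homologous_rel 0 (subtopology ?T (?H 1)) {} d1 (frag_cmul m (frag_of (?pt 1)))"
    using homologous_rel_0_frag_cmul [OF path_connected_times_half_circle [OF S] pt d(2)] m by simp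
  then obtain w1 where w1: "singular_chain (Suc 0) (subtopology ?T (?H 1)) w1"
      "chain_boundary (Suc 0) w1 = d1 - frag_cmul m (frag_of (?pt 1))"
    by (auto simp: homologous_rel_def singular_boundary)
  have "homologous_rel 0 (subtopology ?T (?H (-1))) {} d2 (frag_cmul (- m) (frag_of (?pt (-1))))"
    using homologous_rel_0_frag_cmul [OF path_connected_times_half_circle [OF S] pt d(3)] m by simp
  then obtain w2 where w2: "singular_chain (Suc 0) (subtopology ?T (?H (-1))) w2"
      "chain_boundary (Suc 0) w2 = d2 + frag_cmul m (frag_of (?pt (-1)))"
    by (auto simp: homologous_rel_def singular_boundary)
  \<comment> \<open>\<open>w\<close> collects the cut into \<open>m\<close> copies of
    \<open>(z, 1)\<close> and \<open>- m\<close> copies of \<open>(z, - 1)\<close>; it lies in both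
    slit cylinders, since the half circles avoid both slits.\<close>
  define w where "w = w1 + w2"
  have "?H \<epsilon> \<subseteq> ?off \<i>" "?H \<epsilon> \<subseteq> ?off (- \<i>)" for \<epsilon> by auto
  then have w: "singular_chain (Suc 0) (subtopology ?T (?off \<i>)) w"
      "singular_chain (Suc 0) (subtopology ?T (?off (- \<i>))) w"
    unfolding w_def using w1 w2 by (meson singular_chain_add singular_chain_mono)+
  define \<mu> where "\<mu> = (\<lambda>a b. chain_map (Suc 0) (\<lambda>\<alpha>. (z, \<alpha>)) (frag_of (circle_arc a b)))"
  have cz: "continuous_map circle ?T (\<lambda>\<alpha>. (z, \<alpha>))"
    using z by (auto intro: continuous_map_pairedI)
  have sa: "singular_chain (Suc 0) circle (frag_of (circle_arc a b))" for a b
    by (simp add: singular_chain_of singular_simplex_arc)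
  have sm: "simplex_map 0 (Pair z) (restrict (\<lambda>_. v) (standard_simplex 0)) = ?pt v" for v
    by (auto simp: simplex_map_def)
  have \<mu>b: "chain_boundary (Suc 0) (\<mu> a b) = frag_of (?pt (cis b)) - frag_of (?pt (cis a))" for a b
  proof -
    have "chain_boundary (Suc 0) (\<mu> a b) =
        chain_map 0 (\<lambda>\<alpha>. (z, \<alpha>)) (chain_boundary (Suc 0) (frag_of (circle_arc a b)))"
      unfolding \<mu>_def using chain_boundary_chain_map [OF sa] by (metis diff_Suc_Suc diff_zero)
    then show ?thesis by (simp add: arc_boundary chain_map_diff sm)
  qed
  have \<mu>1: "singular_chain (Suc 0) (subtopology ?T (?off \<i>)) (\<mu> 0 pi)"
  proof -
    have "cis (pi * t (Suc 0)) \<noteq> - \<i>" if t: "t \<in> standard_simplex (Suc 0)" for t :: "nat \<Rightarrow> real"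
    proof -
      have "0 \<le> t (Suc 0)" "t (Suc 0) \<le> 1" using t by (auto simp: standard_simplex_def)
      then have "sin (pi * t (Suc 0)) \<ge> 0" by (intro sin_ge_zero) (simp_all add: mult_left_le)
      then show ?thesis by (auto simp: complex_eq_iff)
    qed
    then show ?thesis
      using singular_chain_chain_map [OF sa cz, of 0 pi]
      by (auto simp: \<mu>_def singular_chain_subtopology simplex_map_def circle_arc_def)
  qed
  have \<mu>2: "singular_chain (Suc 0) (subtopology ?T (?off (- \<i>))) (\<mu> pi (2 * pi))"
  proof -
    have "cis (pi * t 0 + 2 * pi * t (Suc 0)) \<noteq> \<i>" if t: "t \<in> standard_simplex (Suc 0)" for t :: "nat \<Rightarrow> real"
    proof -
      have t01: "t 0 = 1 - t (Suc 0)" "0 \<le> t (Suc 0)" "t (Suc 0) \<le> 1"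
        using t by (auto simp: standard_simplex_def)
      have eq: "pi * t 0 + 2 * pi * t (Suc 0) = pi * t (Suc 0) + pi"
        unfolding t01(1) by (simp add: algebra_simps)
      have "sin (pi * t (Suc 0)) \<ge> 0" using t01 by (intro sin_ge_zero) (simp_all add: mult_left_le)
      then show ?thesis unfolding eq by (auto simp: complex_eq_iff)
    qed
    then show ?thesis
      using singular_chain_chain_map [OF sa cz, of pi "2 * pi"]
      by (auto simp: \<mu>_def singular_chain_subtopology simplex_map_def circle_arc_def)
  qed
  have \<mu>12: "homologous_rel (Suc 0) ?T {} (\<mu> 0 pi + \<mu> pi (2 * pi)) (\<mu> 0 (2 * pi))"
    using singular_relboundary_chain_map [OF arc_concat [of 0 pi "2*pi", unfolded homologous_rel_def] cz, of "{}"]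
    by (simp add: \<mu>_def homologous_rel_def chain_map_diff chain_map_add)
  \<comment> \<open>The boundary of \<open>c1 - w\<close> is \<open>m\<close> times
    \<open>(z, 1) - (z, - 1)\<close>. The upper half of the meridian, which runs from
    \<open>(z, 1)\<close> to \<open>(z, - 1)\<close>, cancels it, and the lower half does the same
    for \<open>c2 + w\<close>. The two corrections add up to \<open>m\<close> full meridians, whence
    the sign of the exponent at the end.\<close>
  define e1 where "e1 = c1 - w + frag_cmul m (\<mu> 0 pi)"
  define e2 where "e2 = c2 + w + frag_cmul m (\<mu> pi (2 * pi))"
  have e1: "singular_relcycle (Suc 0) (subtopology ?T (?off \<i>)) {} e1"
    unfolding singular_cycle
  proof
    show "singular_chain (Suc 0) (subtopology ?T (?off \<i>)) e1"
      unfolding e1_def by (intro singular_chain_add singular_chain_diff singular_chain_cmul c1 w \<mu>1)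
    have "chain_boundary (Suc 0) e1 = ?b - (d1 - frag_cmul m (frag_of (?pt 1)) + (d2 + frag_cmul m (frag_of (?pt (-1)))))
        + frag_cmul m (frag_of (?pt (-1)) - frag_of (?pt 1))"
      by (simp add: e1_def w_def chain_boundary_add chain_boundary_diff chain_boundary_cmul w1 w2 \<mu>b)
    then show "chain_boundary (Suc 0) e1 = 0" by (simp add: d frag_cmul_diff_distrib2 del: minus_frag_cmul)
  qed
  have e2: "singular_relcycle (Suc 0) (subtopology ?T (?off (- \<i>))) {} e2"
    unfolding singular_cycle
  proof
    show "singular_chain (Suc 0) (subtopology ?T (?off (- \<i>))) e2"
      unfolding e2_def by (intro singular_chain_add singular_chain_diff singular_chain_cmul c2 w \<mu>2)
    have "chain_boundary (Suc 0) e2 = - ?b + (d1 - frag_cmul m (frag_of (?pt 1)) + (d2 + frag_cmul m (frag_of (?pt (-1)))))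
        + frag_cmul m (frag_of (?pt 1) - frag_of (?pt (-1)))"
      using eq by (simp add: e2_def w_def chain_boundary_add chain_boundary_diff chain_boundary_cmul w1 w2 \<mu>b)
    then show "chain_boundary (Suc 0) e2 = 0" by (simp add: d frag_cmul_diff_distrib2 del: minus_frag_cmul)
  qed
  define y where "y = chain_map (Suc 0) fst (e1 + e2)"
  have "continuous_map (subtopology ?T A) S fst" for A
    by (simp add: continuous_map_from_subtopology continuous_map_fst)
  then have "singular_relcycle (Suc 0) S {} (chain_map (Suc 0) fst e1)"
       "singular_relcycle (Suc 0) S {} (chain_map (Suc 0) fst e2)"
    using singular_relcycle_chain_map [OF e1] singular_relcycle_chain_map [OF e2] by blast+
  then have y: "singular_relcycle (Suc 0) S {} y"
    by (simp add: y_def chain_map_add singular_relcycle_add)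
  have "homologous_rel (Suc 0) ?T {} (e1 + e2) (chain_map (Suc 0) (\<lambda>s. (s, 1)) y)"
    unfolding y_def chain_map_add using e1 e2
    by (intro homologous_rel_add cycle_off_a_point [of \<i>] cycle_off_a_point [of "- \<i>"])
      (auto simp: complex_eq_iff)
  moreover have "homologous_rel (Suc 0) ?T {} (frag_cmul m (\<mu> 0 pi + \<mu> pi (2 * pi))) (frag_cmul m (\<mu> 0 (2 * pi)))"
    using singular_relboundary_cmul [OF \<mu>12 [unfolded homologous_rel_def], of m]
    by (simp add: homologous_rel_def frag_cmul_diff_distrib2)
  ultimately have "homologous_rel (Suc 0) ?T {} ((e1 + e2) - frag_cmul m (\<mu> 0 pi + \<mu> pi (2 * pi)))
      (chain_map (Suc 0) (\<lambda>s. (s, 1)) y - frag_cmul m (\<mu> 0 (2 * pi)))"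
    by (rule homologous_rel_diff)
  moreover have "(e1 + e2) - frag_cmul m (\<mu> 0 pi + \<mu> pi (2 * pi)) = c1 + c2"
    by (simp add: e1_def e2_def frag_cmul_distrib2)
  ultimately have "homologous_rel (Suc 0) ?T {} x
      (chain_map (Suc 0) (\<lambda>s. (s, 1)) y + frag_cmul (- m) (\<mu> 0 (2 * pi)))"
    using homologous_rel_trans [OF _ h] by (simp flip: minus_frag_cmul)
  then show ?thesis
    using that [OF y, of "- m"] by (simp add: \<mu>_def)
qed

section \<open>Classes of the product and their two projections\<close>

lemma hom_induced_comp:
  assumes "continuous_map X Y f" "continuous_map Y Z g"
  shows "hom_induced p Y {} Z {} g (hom_induced p X {} Y {} f a) = hom_induced p X {} Z {} (\<lambda>x. g (f x)) a"
  using hom_induced_compose_empty [OF assms] by (simp add: o_def)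

text \<open>A constant map factors through a one-point space, whose first homology is
  trivial.\<close>

lemma hom_induced_const:
  assumes y: "y \<in> topspace Y" and a: "a \<in> carrier (homology_group 1 X)"
  shows "hom_induced 1 X {} Y {} (\<lambda>_. y) a = \<one>\<^bsub>homology_group 1 Y\<^esub>"
proof -
  let ?P = "subtopology Y {y}"
  interpret h: group_hom "homology_group 1 ?P" "homology_group 1 Y" "hom_induced 1 ?P {} Y {} id"
    by (rule hom_induced_group_hom)
  have "trivial_group (homology_group 1 ?P)"
    using y by (intro homology_dimension_axiom [of _ y]) auto
  then have "hom_induced 1 X {} ?P {} (\<lambda>_. y) a = \<one>\<^bsub>homology_group 1 ?P\<^esub>"
    using hom_induced_carrier [of 1 X "{}" ?P "{}"] by (auto simp: trivial_group_def)
  moreover have "continuous_map X ?P (\<lambda>_. y)" "continuous_map ?P Y id"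
    using y by (auto simp: continuous_map_from_subtopology)
  ultimately show ?thesis
    using hom_induced_comp [of X ?P "\<lambda>_. y" Y id 1 a] by simp
qed

text \<open>The projection to \<open>S\<close> kills the meridian and undoes the inclusion at 1,
  which identifies the surface part of \<open>x\<close>. The projection to the circle kills the
  surface part and keeps the meridian, which ties \<open>m\<close> to an observable class without
  any claim that \<open>m\<close> is unique.\<close>

lemma times_circle_class:
  assumes S: "path_connected_space S" and z: "z \<in> topspace S"
    and x: "x \<in> carrier (homology_group 1 (prod_topology S circle))"
  obtains m where
    "x = hom_induced 1 S {} (prod_topology S circle) {} (\<lambda>s. (s, 1))
           (hom_induced 1 (prod_topology S circle) {} S {} fst x)
         \<otimes>\<^bsub>homology_group 1 (prod_topology S circle)\<^esub>
         hom_induced 1 circle {} (prod_topology S circle) {} (\<lambda>\<alpha>. (z, \<alpha>)) circle_class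
           [^]\<^bsub>homology_group 1 (prod_topology S circle)\<^esub> (m::int)"
    "hom_induced 1 (prod_topology S circle) {} circle {} snd x = circle_class [^]\<^bsub>homology_group 1 circle\<^esub> m"
proof -
  let ?T = "prod_topology S circle"
  let ?par = "hom_induced 1 S {} ?T {} (\<lambda>s. (s, 1))"
  let ?mer = "hom_induced 1 circle {} ?T {} (\<lambda>\<alpha>. (z, \<alpha>)) circle_class"
  interpret T: group "homology_group 1 ?T" by simp
  interpret HS: group "homology_group 1 S" by simp
  interpret HC: group "homology_group 1 circle" by simp
  interpret f: group_hom "homology_group 1 ?T" "homology_group 1 S" "hom_induced 1 ?T {} S {} fst"
    by (rule hom_induced_group_hom)
  interpret s: group_hom "homology_group 1 ?T" "homology_group 1 circle" "hom_induced 1 ?T {} circle {} snd"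
    by (rule hom_induced_group_hom)
  obtain c where c: "singular_relcycle (Suc 0) ?T {} c" "x = hcl ?T c"
    using x by (rule homology_1_cases)
  obtain y m where y: "singular_relcycle (Suc 0) S {} y" and
    ym: "homologous_rel (Suc 0) ?T {} c
       (chain_map (Suc 0) (\<lambda>s. (s, 1)) y +
        frag_cmul m (chain_map (Suc 0) (\<lambda>\<alpha>. (z, \<alpha>)) (frag_of (circle_arc 0 (2 * pi)))))"
    using times_circle_cycle [OF S z c(1)] by blast
  have cp: "continuous_map S ?T (\<lambda>s. (s, 1))" and cm: "continuous_map circle ?T (\<lambda>\<alpha>. (z, \<alpha>))"
    using z by (auto intro: continuous_map_pairedI)
  have circle_arc: "singular_relcycle (Suc 0) circle {} (frag_of (circle_arc 0 (2 * pi)))"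
    by (rule arc_cycle) simp
  have mer: "?mer = hcl ?T (chain_map (Suc 0) (\<lambda>\<alpha>. (z, \<alpha>)) (frag_of (circle_arc 0 (2 * pi))))"
    unfolding circle_class_arc by (rule hom_induced_hcl [OF cm circle_arc])
  have "singular_relcycle (Suc 0) ?T {} (chain_map (Suc 0) (\<lambda>\<alpha>. (z, \<alpha>)) (frag_of (circle_arc 0 (2 * pi))))"
    by (rule singular_relcycle_chain_map [OF circle_arc cm]) simp
  then have x_eq: "x = ?par (hcl S y) \<otimes>\<^bsub>homology_group 1 ?T\<^esub> ?mer [^]\<^bsub>homology_group 1 ?T\<^esub> m"
    using ym unfolding c mer hom_induced_hcl [OF cp y] by (simp only: hcl_int_pow hcl_add hcl_eq_iff)
  have pc: "?par (hcl S y) \<in> carrier (homology_group 1 ?T)" and mc: "?mer \<in> carrier (homology_group 1 ?T)"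
    by (rule hom_induced_carrier)+
  have yc: "hcl S y \<in> carrier (homology_group 1 S)" using y by simp
  have "hom_induced 1 ?T {} S {} fst (?par (hcl S y)) = hom_induced 1 S {} S {} (\<lambda>s. s) (hcl S y)"
    by (simp add: hom_induced_comp [OF cp continuous_map_fst])
  then have 1: "hom_induced 1 ?T {} S {} fst (?par (hcl S y)) = hcl S y"
    using hom_induced_id [OF yc] by (simp add: o_def id_def)
  have "hom_induced 1 ?T {} S {} fst ?mer = hom_induced 1 circle {} S {} (\<lambda>_. z) circle_class"
    by (simp add: hom_induced_comp [OF cm continuous_map_fst])
  then have 2: "hom_induced 1 ?T {} S {} fst ?mer = \<one>\<^bsub>homology_group 1 S\<^esub>"
    using hom_induced_const [OF z circle_class_carrier] by (simp add: o_def)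
  have "hom_induced 1 ?T {} circle {} snd (?par (hcl S y)) = hom_induced 1 S {} circle {} (\<lambda>_. 1) (hcl S y)"
    by (simp add: hom_induced_comp [OF cp continuous_map_snd])
  then have 3: "hom_induced 1 ?T {} circle {} snd (?par (hcl S y)) = \<one>\<^bsub>homology_group 1 circle\<^esub>"
    using hom_induced_const [of 1 circle, OF _ yc] by (simp add: o_def)
  have "hom_induced 1 ?T {} circle {} snd ?mer = hom_induced 1 circle {} circle {} (\<lambda>\<alpha>. \<alpha>) circle_class"
    by (simp add: hom_induced_comp [OF cm continuous_map_snd])
  then have 4: "hom_induced 1 ?T {} circle {} snd ?mer = circle_class"
    using hom_induced_id [OF circle_class_carrier] by (simp add: o_def id_def)
  have "hom_induced 1 ?T {} S {} fst x = hcl S y"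
    unfolding x_eq using pc mc yc by (simp add: f.hom_mult f.hom_int_pow 1 2)
  moreover have "hom_induced 1 ?T {} circle {} snd x = circle_class [^]\<^bsub>homology_group 1 circle\<^esub> m"
    unfolding x_eq using pc mc yc by (simp add: s.hom_mult s.hom_int_pow 3 4)
  ultimately show ?thesis using that x_eq by simp
qed

section \<open>The Kronecker pairing with a class on the circle\<close>

lemma eval_cochain_cmul: "eval_cochain u (frag_cmul m c) = m * eval_cochain u c"
  by (subst eval_cochain_superset [of "Poly_Mapping.keys c"])
    (auto simp: keys_cmul eval_cochain_def sum_distrib_left mult.assoc)

lemma eval_cochain_fun_add: "eval_cochain (\<lambda>\<sigma>. u \<sigma> + v \<sigma>) c = eval_cochain u c + eval_cochain v c"
  by (simp add: eval_cochain_def distrib_left sum.distrib)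

lemma eval_cochain_fun_uminus: "eval_cochain (\<lambda>\<sigma>. - u \<sigma>) c = - eval_cochain u c"
  by (simp add: eval_cochain_def sum_negf)

lemma eval_cochain_chain_map:
  "eval_cochain u (chain_map p f c) = eval_cochain (\<lambda>\<sigma>. u (simplex_map p f \<sigma>)) c"
  by (induction c rule: frag_induction [OF subset_UNIV]) (auto simp: chain_map_diff eval_cochain_diff)

lemma coboundary_pullback:
  assumes "singular_simplex p X \<sigma>"
  shows "coboundary p (\<lambda>\<sigma>. w (simplex_map (p - Suc 0) f \<sigma>)) \<sigma> = coboundary p w (simplex_map p f \<sigma>)"
proof -
  have "singular_chain p X (frag_of \<sigma>)" using assms by (simp add: singular_chain_of)
  from chain_boundary_chain_map [OF this, of f] show ?thesis
    by (simp add: coboundary_def flip: eval_cochain_chain_map)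
qed

lemma cohomology_class_cong:
  assumes "\<And>\<sigma>. singular_simplex p X \<sigma> \<Longrightarrow> v \<sigma> = u \<sigma> + coboundary p w \<sigma>"
  shows "cohomology_class p X v = cohomology_class p X u"
proof -
  have cb: "coboundary p (\<lambda>\<sigma>. w \<sigma> + w' \<sigma>) \<sigma> = coboundary p w \<sigma> + coboundary p w' \<sigma>"
           "coboundary p (\<lambda>\<sigma>. - w \<sigma>) \<sigma> = - coboundary p w \<sigma>" for w w' \<sigma>
    by (simp_all add: coboundary_def eval_cochain_fun_add eval_cochain_fun_uminus)
  have *: "cohomology_class p X v \<subseteq> cohomology_class p X u"
    if "\<And>\<sigma>. singular_simplex p X \<sigma> \<Longrightarrow> v \<sigma> = u \<sigma> + coboundary p w \<sigma>" for u v w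
  proof
    fix x assume "x \<in> cohomology_class p X v"
    then obtain w' where w': "\<And>\<sigma>. singular_simplex p X \<sigma> \<Longrightarrow> x \<sigma> = v \<sigma> + coboundary p w' \<sigma>"
      by (auto simp: cohomology_class_def)
    show "x \<in> cohomology_class p X u"
      unfolding cohomology_class_def
      by (intro CollectI exI [of _ "\<lambda>\<sigma>. w \<sigma> + w' \<sigma>"]) (simp add: cb w' that)
  qed
  show ?thesis
    using * [of v u w] * [of u v "\<lambda>\<sigma>. - w \<sigma>"] assms by (simp add: cb)
qed

lemma self_in_cohomology_class: "u \<in> cohomology_class p X u"
  unfolding cohomology_class_def
  by (rule CollectI, rule exI [where x = "\<lambda>_. 0"]) (simp add: coboundary_def eval_cochain_def)

text \<open>The pullback is a union over all representatives of the class; pulling back a coboundary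
  gives a coboundary, so the members of this union coincide.\<close>

lemma cohomology_pullback_class:
  assumes f: "continuous_map X Y f"
  shows "cohomology_pullback p X f (cohomology_class p Y u) = cohomology_class p X (\<lambda>\<sigma>. u (simplex_map p f \<sigma>))"
proof -
  have "cohomology_class p X (\<lambda>\<sigma>. v (simplex_map p f \<sigma>)) = cohomology_class p X (\<lambda>\<sigma>. u (simplex_map p f \<sigma>))"
    if v: "v \<in> cohomology_class p Y u" for v
  proof -
    obtain w where "\<And>\<sigma>. singular_simplex p Y \<sigma> \<Longrightarrow> v \<sigma> = u \<sigma> + coboundary p w \<sigma>"
      using v unfolding cohomology_class_def by blast
    then show ?thesis
      using singular_simplex_simplex_map [OF _ f]
      by (intro cohomology_class_cong [where w = "\<lambda>\<sigma>. w (simplex_map (p - Suc 0) f \<sigma>)"])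
        (simp add: coboundary_pullback)
  qed
  then show ?thesis
    unfolding cohomology_pullback_def using self_in_cohomology_class by blast
qed

lemma kronecker_pullback:
  assumes f: "continuous_map X Y f" and \<theta>: "\<theta> \<in> cohomology 1 Y" and a: "a \<in> carrier (homology_group 1 X)"
  shows "kronecker (cohomology_pullback 1 X f \<theta>) a = kronecker \<theta> (hom_induced 1 X {} Y {} f a)"
proof -
  obtain u where u: "cocycle (Suc 0) Y u" "\<theta> = cohomology_class (Suc 0) Y u"
    using \<theta> by (auto simp: cohomology_def)
  obtain c where c: "singular_relcycle (Suc 0) X {} c" "a = hcl X c"
    using a by (rule homology_1_cases)
  have fc: "singular_relcycle (Suc 0) Y {} (chain_map (Suc 0) f c)"
    by (rule singular_relcycle_chain_map [OF c(1) f]) simp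
  have "cocycle (Suc 0) X (\<lambda>\<sigma>. u (simplex_map (Suc 0) f \<sigma>))"
    unfolding cocycle_def
  proof (intro allI impI)
    fix \<sigma> assume \<sigma>: "singular_simplex (Suc (Suc 0)) X \<sigma>"
    have "coboundary (Suc (Suc 0)) (\<lambda>\<sigma>. u (simplex_map (Suc 0) f \<sigma>)) \<sigma> =
          coboundary (Suc (Suc 0)) u (simplex_map (Suc (Suc 0)) f \<sigma>)"
      using coboundary_pullback [OF \<sigma>, of u f] by simp
    then show "coboundary (Suc (Suc 0)) (\<lambda>\<sigma>. u (simplex_map (Suc 0) f \<sigma>)) \<sigma> = 0"
      using u singular_simplex_simplex_map [OF \<sigma> f] by (simp add: cocycle_def)
  qed
  then have "kronecker (cohomology_pullback 1 X f \<theta>) a = eval_cochain (\<lambda>\<sigma>. u (simplex_map (Suc 0) f \<sigma>)) c"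
    unfolding u One_nat_def cohomology_pullback_class [OF f] c(2) using c by (intro kronecker_eq)
  also have "\<dots> = kronecker \<theta> (hcl Y (chain_map (Suc 0) f c))"
    unfolding u kronecker_eq [OF u(1) fc] by (simp add: eval_cochain_chain_map)
  finally show ?thesis using hom_induced_hcl [OF f c(1)] c by simp
qed

lemma kronecker_int_pow:
  assumes \<theta>: "\<theta> \<in> cohomology 1 X" and a: "a \<in> carrier (homology_group 1 X)"
  shows "kronecker \<theta> (a [^]\<^bsub>homology_group 1 X\<^esub> (m::int)) = m * kronecker \<theta> a"
proof -
  obtain u where u: "cocycle (Suc 0) X u" "\<theta> = cohomology_class (Suc 0) X u"
    using \<theta> by (auto simp: cohomology_def)
  obtain c where c: "singular_relcycle (Suc 0) X {} c" "a = hcl X c"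
    using a by (rule homology_1_cases)
  show ?thesis
    unfolding u c(2) hcl_int_pow [OF c(1)] kronecker_eq [OF u(1) c(1)]
      kronecker_eq [OF u(1) singular_relcycle_cmul [OF c(1)]]
    by (rule eval_cochain_cmul)
qed

lemma kronecker_mult:
  assumes \<theta>: "\<theta> \<in> cohomology 1 X"
    and a: "a \<in> carrier (homology_group 1 X)" and b: "b \<in> carrier (homology_group 1 X)"
  shows "kronecker \<theta> (a \<otimes>\<^bsub>homology_group 1 X\<^esub> b) = kronecker \<theta> a + kronecker \<theta> b"
proof -
  obtain u where u: "cocycle (Suc 0) X u" "\<theta> = cohomology_class (Suc 0) X u"
    using \<theta> by (auto simp: cohomology_def)
  obtain c where c: "singular_relcycle (Suc 0) X {} c" "a = hcl X c"
    using a by (rule homology_1_cases)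
  obtain d where d: "singular_relcycle (Suc 0) X {} d" "b = hcl X d"
    using b by (rule homology_1_cases)
  show ?thesis
    unfolding u c(2) d(2) hcl_add kronecker_eq [OF u(1) c(1)] kronecker_eq [OF u(1) d(1)]
      kronecker_eq [OF u(1) singular_relcycle_add [OF c(1) d(1)]]
    by (rule eval_cochain_add)
qed

text \<open>The graph projects to \<open>l\<close> on the surface and to the image of
  \<open>l\<close> under \<open>C\<close> on the circle. The latter is the \<open>m\<close>-th power
  of the circle class, and pairing with \<open>\<theta>\<close>, which has value 1 there, returns
  \<open>m\<close>.\<close>

lemma graph_class:
  assumes S: "path_connected_space S" and z: "z \<in> topspace S" and C: "continuous_map S circle C"
    and \<theta>: "\<theta> \<in> cohomology 1 circle" "kronecker \<theta> circle_class = 1"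
    and l: "l \<in> carrier (homology_group 1 S)"
  shows "hom_induced 1 S {} (prod_topology S circle) {} (\<lambda>s. (s, C s)) l =
    hom_induced 1 S {} (prod_topology S circle) {} (\<lambda>s. (s, 1)) l
    \<otimes>\<^bsub>homology_group 1 (prod_topology S circle)\<^esub>
    hom_induced 1 circle {} (prod_topology S circle) {} (\<lambda>\<alpha>. (z, \<alpha>)) circle_class
      [^]\<^bsub>homology_group 1 (prod_topology S circle)\<^esub> kronecker (cohomology_pullback 1 S C \<theta>) l"
proof -
  let ?T = "prod_topology S circle"
  let ?x = "hom_induced 1 S {} ?T {} (\<lambda>s. (s, C s)) l"
  have cg: "continuous_map S ?T (\<lambda>s. (s, C s))"
    using C by (auto intro: continuous_map_pairedI)
  have "hom_induced 1 ?T {} S {} fst ?x = hom_induced 1 S {} S {} (\<lambda>s. s) l"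
    by (simp add: hom_induced_comp [OF cg continuous_map_fst])
  then have 1: "hom_induced 1 ?T {} S {} fst ?x = l"
    using hom_induced_id [OF l] by (simp add: o_def id_def)
  have "hom_induced 1 ?T {} circle {} snd ?x = hom_induced 1 S {} circle {} C l"
    by (simp add: hom_induced_comp [OF cg continuous_map_snd])
  then have 2: "hom_induced 1 ?T {} circle {} snd ?x = hom_induced 1 S {} circle {} C l"
    by (simp add: o_def)
  have "?x \<in> carrier (homology_group 1 ?T)" by (rule hom_induced_carrier)
  from times_circle_class [OF S z this] obtain m where
    m: "?x = hom_induced 1 S {} ?T {} (\<lambda>s. (s, 1)) l \<otimes>\<^bsub>homology_group 1 ?T\<^esub>
        hom_induced 1 circle {} ?T {} (\<lambda>\<alpha>. (z, \<alpha>)) circle_class [^]\<^bsub>homology_group 1 ?T\<^esub> (m::int)"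
    and m': "hom_induced 1 S {} circle {} C l = circle_class [^]\<^bsub>homology_group 1 circle\<^esub> m"
    unfolding 1 2 by blast
  have "kronecker (cohomology_pullback 1 S C \<theta>) l = m"
    unfolding kronecker_pullback [OF C \<theta>(1) l] m' kronecker_int_pow [OF \<theta>(1) circle_class_carrier] \<theta>(2) by simp
  then show ?thesis using m by simp
qed

text \<open>With \<open>c = cis a\<close> the map sends the angle \<open>t\<close> to
  \<open>a - t\<close>, so the standard loop becomes the clockwise loop starting at
  \<open>a\<close>.\<close>

lemma twisted_conjugation_class:
  assumes "norm c = 1"
  shows "hom_induced 1 circle {} circle {} (\<lambda>\<alpha>. c * cnj \<alpha>) circle_class = inv\<^bsub>homology_group 1 circle\<^esub> circle_class"
proof -
  obtain a where a: "c = cis a" using assms cis_Arg [of c] by (metis div_by_1 norm_zero of_real_1 sgn_eq zero_neq_one)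
  have cont: "continuous_map circle circle (\<lambda>\<alpha>. c * cnj \<alpha>)"
    using assms by (auto simp: norm_mult intro!: continuous_intros)
  have circle_arc: "singular_relcycle (Suc 0) circle {} (frag_of (circle_arc 0 (2 * pi)))"
    by (rule arc_cycle) simp
  have "simplex_map (Suc 0) (\<lambda>\<alpha>. c * cnj \<alpha>) (circle_arc 0 (2 * pi)) = circle_arc a (a - 2 * pi)"
    unfolding simplex_map_def circle_arc_def One_nat_def
  proof (rule restrict_ext)
    fix t :: "nat \<Rightarrow> real" assume t: "t \<in> standard_simplex (Suc 0)"
    then have t0: "t 0 = 1 - t (Suc 0)" by (simp add: standard_simplex_def)
    show "((\<lambda>\<alpha>. c * cnj \<alpha>) \<circ> (\<lambda>t\<in>standard_simplex (Suc 0). cis (0 * t 0 + 2 * pi * t (Suc 0)))) t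
        = cis (a * t 0 + (a - 2 * pi) * t (Suc 0))"
      using t by (simp add: a t0 cis_cnj cis_mult algebra_simps)
  qed
  then show ?thesis
    unfolding circle_class_arc hom_induced_hcl [OF cont circle_arc] hcl_uminus [OF circle_arc]
    using arc_backwards [of a] by (simp add: hcl_eq_iff)
qed

section \<open>The algebra of the gluing relations\<close>

text \<open>Both groups are the quotient of \<open>G\<close> by the same normal subgroup.\<close>

lemma iso_of_common_kernel:
  assumes h: "group_hom G H h" "h ` carrier G = carrier H"
    and k: "group_hom G K k" "k ` carrier G = carrier K"
    and eq: "kernel G H h = kernel G K k"
  shows "H \<cong> K"
proof -
  have gr: "group (G Mod kernel G H h)"
    using group_hom.normal_kernel [OF h(1)] by (rule normal.factorgroup_is_group)
  have "(G Mod kernel G H h) \<cong> H" "(G Mod kernel G H h) \<cong> K"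
    using group_hom.FactGroup_iso [OF h] group_hom.FactGroup_iso [OF k] eq by simp_all
  then show ?thesis
    using group.iso_sym [OF gr] iso_trans by blast
qed

text \<open>For moduli with a common factor, two residues have a common solution as soon as they
  agree modulo the gcd. Subtracting the part of \<open>x - y\<close> that Bezout attributes to
  \<open>j\<close> leaves the residue mod \<open>j\<close> alone and adjusts the one mod
  \<open>k\<close>.\<close>

lemma crt_gcd:
  fixes x y :: int and j k :: nat
  assumes "x mod int (gcd j k) = y mod int (gcd j k)"
  obtains m where "m mod int j = x mod int j" "m mod int k = y mod int k"
proof -
  obtain q where q: "x - y = int (gcd j k) * q"
    using assms by (metis mod_eq_dvd_iff dvdE)
  obtain u v where uv: "u * int j + v * int k = int (gcd j k)"
    using bezout_int [of "int j" "int k"] by auto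
  show ?thesis
  proof
    show "(x - q * u * int j) mod int j = x mod int j"
      by (metis mod_diff_right_eq mod_mult_self2_is_0 diff_zero)
    have "x - q * u * int j = y + (q * v) * int k"
      using q unfolding uv [symmetric] by (simp add: algebra_simps)
    then show "(x - q * u * int j) mod int k = y mod int k" by simp
  qed
qed

text \<open>\<open>A\<close> is additive only up to multiples of \<open>k\<close>; this ambiguity
  disappears modulo any divisor of \<open>k\<close>, in particular modulo the gcd.\<close>

lemma hom_int_mod:
  assumes "j dvd k" and A: "A \<in> hom G (integer_mod_group k)" and xy: "x \<in> carrier G" "y \<in> carrier G"
  shows "A (x \<otimes>\<^bsub>G\<^esub> y) mod int j = (A x + A y) mod int j"
proof -
  have "A (x \<otimes>\<^bsub>G\<^esub> y) = (A x + A y) mod int k" using A xy by (simp add: hom_def)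
  then show ?thesis using assms(1) by (simp add: mod_mod_cancel)
qed

text \<open>Here \<open>G1\<close> and \<open>G2\<close> stand for the homology of the exteriors,
  \<open>L\<close> for that of the surface, \<open>p1\<close> and \<open>p2\<close> for the
  parallels, \<open>m1\<close> and \<open>m2\<close> for the meridians. The map \<open>t\<close>
  presents \<open>HX\<close> and the map \<open>q\<close> the cokernel as quotients of
  \<open>G1\<close> times \<open>G2\<close>, so it suffices to match their kernels. In
  \<open>ker\<close> the integer \<open>m\<close> is the meridian part of a class on the common
  boundary.\<close>

lemma glued_cokernel:
  fixes HX :: "('x, 'x1) monoid_scheme" and G1 :: "('g1, 'p1) monoid_scheme" and G2 :: "('g2, 'p2) monoid_scheme"
    and H1 :: "('h1, 'q1) monoid_scheme" and H2 :: "('h2, 'q2) monoid_scheme" and L :: "('l, 'l1) monoid_scheme"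
    and j k :: nat and c :: "'l \<Rightarrow> int"
  defines "n \<equiv> gcd j k"
  assumes gX: "comm_group HX" and gG: "comm_group G1" "comm_group G2"
    and gH: "comm_group H1" "comm_group H2" and gL: "group L"
    and pos: "j > 0" "k > 0"
    and j1: "j1 \<in> hom G1 HX" and j2: "j2 \<in> hom G2 HX"
    and surj: "\<And>x. x \<in> carrier HX \<Longrightarrow> \<exists>a\<in>carrier G1. \<exists>b\<in>carrier G2. x = j1 a \<otimes>\<^bsub>HX\<^esub> j2 b"
    and ker: "\<And>a b. \<lbrakk>a \<in> carrier G1; b \<in> carrier G2\<rbrakk> \<Longrightarrow> j1 a \<otimes>\<^bsub>HX\<^esub> j2 b = \<one>\<^bsub>HX\<^esub> \<longleftrightarrow>
      (\<exists>l\<in>carrier L. \<exists>m::int. a = p1 l \<otimes>\<^bsub>G1\<^esub> m1 [^]\<^bsub>G1\<^esub> m \<and>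
         b = inv\<^bsub>G2\<^esub> (p2 l \<otimes>\<^bsub>G2\<^esub> m2 [^]\<^bsub>G2\<^esub> (c l - m)))"
    and s1: "(\<lambda>a. (\<rho>1 a, A1 a)) \<in> iso G1 (H1 \<times>\<times> integer_mod_group j)"
    and s2: "(\<lambda>a. (\<rho>2 a, A2 a)) \<in> iso G2 (H2 \<times>\<times> integer_mod_group k)"
    and p1: "\<And>l. l \<in> carrier L \<Longrightarrow> p1 l \<in> carrier G1 \<and> \<rho>1 (p1 l) = i1 l \<and> A1 (p1 l) = 0"
    and p2: "\<And>l. l \<in> carrier L \<Longrightarrow> p2 l \<in> carrier G2 \<and> \<rho>2 (p2 l) = i2 l \<and> A2 (p2 l) = 0"
    and m1: "m1 \<in> carrier G1" "\<rho>1 m1 = \<one>\<^bsub>H1\<^esub>" "A1 m1 = 1 mod int j"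
    and m2: "m2 \<in> carrier G2" "\<rho>2 m2 = \<one>\<^bsub>H2\<^esub>" "A2 m2 = 1 mod int k"
    and i: "i1 \<in> hom L H1" "i2 \<in> hom L H2"
    and c: "\<And>l l'. \<lbrakk>l \<in> carrier L; l' \<in> carrier L\<rbrakk> \<Longrightarrow> c (l \<otimes>\<^bsub>L\<^esub> l') = c l + c l'"
  shows "HX \<cong> cokernel L (H1 \<times>\<times> (H2 \<times>\<times> integer_mod_group n)) (\<lambda>l. (i1 l, i2 l, c l mod int n))"
proof -
  define E where "E = H1 \<times>\<times> (H2 \<times>\<times> integer_mod_group n)"
  define f where "f = (\<lambda>l. (i1 l, i2 l, c l mod int n))"
  define G where "G = G1 \<times>\<times> G2"
  interpret X: comm_group HX by fact
  interpret G1: comm_group G1 by fact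
  interpret G2: comm_group G2 by fact
  interpret H1: comm_group H1 by fact
  interpret H2: comm_group H2 by fact
  interpret L: group L by fact
  have n: "n > 0" "n dvd j" "n dvd k" using pos by (auto simp: n_def)
  have Zc: "carrier (integer_mod_group n) = {0..<int n}"
    using n by (simp add: carrier_integer_mod_group)
  have gE: "group E" unfolding E_def by (intro DirProd_group) (auto simp: H1.is_group H2.is_group)
  then interpret E: group E .
  have cE: "x \<otimes>\<^bsub>E\<^esub> y = y \<otimes>\<^bsub>E\<^esub> x" if "x \<in> carrier E" "y \<in> carrier E" for x y
    using that by (auto simp: E_def mult_DirProd' H1.m_comm H2.m_comm add.commute)
  have commE: "comm_group E" using gE cE by (rule group.group_comm_groupI)
  have gG': "group G" unfolding G_def by (intro DirProd_group) (auto simp: G1.is_group G2.is_group)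
  have f: "f \<in> hom L E"
    using i n by (auto simp: hom_def f_def E_def c Zc Pi_iff mod_add_eq)
  interpret f: group_hom L E f using gL gE f by (simp add: group_hom_def group_hom_axioms_def)
  have sub: "subgroup (f ` carrier L) E" by (rule f.img_is_subgroup)
  then have nor: "(f ` carrier L) \<lhd> E" using comm_group.normal_iff_subgroup [OF commE] by blast
  have h1: "\<rho>1 \<in> hom G1 H1" "A1 \<in> hom G1 (integer_mod_group j)"
    using s1 by (auto simp: iso_def hom_paired)
  have h2: "\<rho>2 \<in> hom G2 H2" "A2 \<in> hom G2 (integer_mod_group k)"
    using s2 by (auto simp: iso_def hom_paired)
  interpret r1: group_hom G1 H1 \<rho>1 using h1 by (simp add: group_hom_def group_hom_axioms_def)
  interpret r2: group_hom G2 H2 \<rho>2 using h2 by (simp add: group_hom_def group_hom_axioms_def)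
  interpret a1: group_hom G1 "integer_mod_group j" A1 using h1 by (simp add: group_hom_def group_hom_axioms_def)
  interpret a2: group_hom G2 "integer_mod_group k" A2 using h2 by (simp add: group_hom_def group_hom_axioms_def)
  define h where "h = (\<lambda>(a, b). (\<rho>1 a, inv\<^bsub>H2\<^esub> \<rho>2 b, (A1 a - A2 b) mod int n))"
  have h: "h \<in> hom G E"
  proof (rule homI)
    fix x assume "x \<in> carrier G"
    then show "h x \<in> carrier E" using n by (auto simp: G_def E_def h_def Zc)
  next
    fix x y assume x: "x \<in> carrier G" and y: "y \<in> carrier G"
    obtain a b a' b' where xy: "x = (a, b)" "y = (a', b')" by fastforce
    have ab: "a \<in> carrier G1" "b \<in> carrier G2" "a' \<in> carrier G1" "b' \<in> carrier G2"
      using x y xy by (auto simp: G_def)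
    have "(A1 (a \<otimes>\<^bsub>G1\<^esub> a') - A2 (b \<otimes>\<^bsub>G2\<^esub> b')) mod int n = ((A1 a + A1 a') - (A2 b + A2 b')) mod int n"
      using hom_int_mod [OF n(2) h1(2) ab(1,3)] hom_int_mod [OF n(3) h2(2) ab(2,4)] by (rule mod_diff_cong)
    also have "\<dots> = ((A1 a - A2 b) mod int n + (A1 a' - A2 b') mod int n) mod int n"
      by (simp add: mod_add_eq algebra_simps)
    finally show "h (x \<otimes>\<^bsub>G\<^esub> y) = h x \<otimes>\<^bsub>E\<^esub> h y"
      using ab by (simp add: xy h_def G_def E_def H2.inv_mult)
  qed
  define q where "q = (\<lambda>x. (f ` carrier L) #>\<^bsub>E\<^esub> h x)"
  have "(\<lambda>x. (f ` carrier L) #>\<^bsub>E\<^esub> x) \<circ> h \<in> hom G (E Mod f ` carrier L)"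
    using h normal.r_coset_hom_Mod [OF nor] by (rule hom_compose)
  then have q: "group_hom G (E Mod f ` carrier L) q"
    using gG' normal.factorgroup_is_group [OF nor]
    by (simp add: group_hom_def group_hom_axioms_def q_def o_def)
  have "h ` carrier G = carrier E"
  proof
    show "h ` carrier G \<subseteq> carrier E" using h by (auto simp: hom_def)
    show "carrier E \<subseteq> h ` carrier G"
    proof
      fix e assume "e \<in> carrier E"
      then obtain x y z where e: "e = (x, y, z)" "x \<in> carrier H1" "y \<in> carrier H2" "0 \<le> z" "z < int n"
        by (cases e) (auto simp: E_def Zc)
      \<comment> \<open>The whole residue is put into \<open>a\<close>, with
        \<open>A2 b = 0\<close>; reducing it mod \<open>n\<close> loses nothing because
        \<open>n\<close> divides \<open>j\<close>.\<close>
      have "z mod int j \<in> carrier (integer_mod_group j)" using pos by (simp add: carrier_integer_mod_group)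
      then obtain a where a: "a \<in> carrier G1" "\<rho>1 a = x" "A1 a = z mod int j"
        using s1 e by (auto simp: iso_def bij_betw_def) (smt (verit, best) Pair_inject SigmaI imageE)
      obtain b where b: "b \<in> carrier G2" "\<rho>2 b = inv\<^bsub>H2\<^esub> y" "A2 b = 0"
      proof -
        have "(inv\<^bsub>H2\<^esub> y, 0) \<in> carrier (H2 \<times>\<times> integer_mod_group k)" using e by simp
        also have "\<dots> = (\<lambda>a. (\<rho>2 a, A2 a)) ` carrier G2" using s2 by (simp add: iso_def bij_betw_def)
        finally show ?thesis using that by auto
      qed
      have "(z mod int j) mod int n = z" using e n by (simp add: mod_mod_cancel)
      then show "e \<in> h ` carrier G"
        using a b e by (intro image_eqI [of _ _ "(a, b)"]) (auto simp: h_def G_def)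
    qed
  qed
  then have q_surj: "q ` carrier G = carrier (E Mod f ` carrier L)"
    by (simp add: q_def carrier_FactGroup flip: image_image)
  define t where "t = (\<lambda>(a, b). j1 a \<otimes>\<^bsub>HX\<^esub> j2 b)"
  have j1c: "j1 a \<in> carrier HX" if "a \<in> carrier G1" for a using that j1 by (auto simp: hom_def)
  have j2c: "j2 a \<in> carrier HX" if "a \<in> carrier G2" for a using that j2 by (auto simp: hom_def)
  have "t \<in> hom G HX"
    using j1 j2 by (auto simp: hom_def t_def G_def j1c j2c X.m_ac)
  then have t: "group_hom G HX t"
    using gG' by (simp add: group_hom_def group_hom_axioms_def X.is_group)
  have t_surj: "t ` carrier G = carrier HX"
    using surj j1c j2c by (force simp: t_def G_def)
  have keq: "t x = \<one>\<^bsub>HX\<^esub> \<longleftrightarrow> q x = f ` carrier L" if x: "x \<in> carrier G" for x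
  proof -
    obtain a b where ab: "x = (a, b)" "a \<in> carrier G1" "b \<in> carrier G2" using x by (auto simp: G_def)
    have hx: "h x \<in> carrier E" using h x by (auto simp: hom_def)
    have "q x = f ` carrier L \<longleftrightarrow> h x \<in> f ` carrier L"
      unfolding q_def using E.coset_join1 [OF _ hx sub] E.coset_join2 [OF hx sub] by blast
    also have "\<dots> \<longleftrightarrow> (\<exists>l\<in>carrier L. \<exists>m::int. a = p1 l \<otimes>\<^bsub>G1\<^esub> m1 [^]\<^bsub>G1\<^esub> m \<and>
         b = inv\<^bsub>G2\<^esub> (p2 l \<otimes>\<^bsub>G2\<^esub> m2 [^]\<^bsub>G2\<^esub> (c l - m)))"
    proof
      assume "h x \<in> f ` carrier L"
      then obtain l where l: "l \<in> carrier L" "\<rho>1 a = i1 l" "inv\<^bsub>H2\<^esub> \<rho>2 b = i2 l"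
        "(A1 a - A2 b) mod int n = c l mod int n"
        by (auto simp: h_def f_def ab)
      have "A1 a mod int n = (A2 b + c l) mod int n"
        using mod_add_cong [OF l(4) refl [of "A2 b mod int n"]] by (simp add: algebra_simps)
      \<comment> \<open>The number of meridians is prescribed twice, mod \<open>j\<close> by
        \<open>a\<close> and mod \<open>k\<close> by \<open>b\<close> and \<open>l\<close>.
        Membership of \<open>h x\<close> in the image says exactly that the two prescriptions agree
        modulo the gcd.\<close>
      then obtain m where m: "m mod int j = A1 a mod int j" "m mod int k = (A2 b + c l) mod int k"
        unfolding n_def by (rule crt_gcd)
      have A1a: "A1 a mod int j = A1 a" using a1.hom_closed [OF ab(2)] pos by (simp add: carrier_integer_mod_group)
      let ?a = "p1 l \<otimes>\<^bsub>G1\<^esub> m1 [^]\<^bsub>G1\<^esub> m"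
      let ?b = "p2 l \<otimes>\<^bsub>G2\<^esub> m2 [^]\<^bsub>G2\<^esub> (c l - m)"
      have ca: "?a \<in> carrier G1" "?b \<in> carrier G2" using p1 p2 l m1 m2 by auto
      have "\<rho>1 ?a = \<rho>1 a"
        using p1 [OF l(1)] m1 l(2) ab by (simp add: r1.hom_int_pow) (metis H1.r_one r1.hom_closed)
      moreover have "A1 ?a = A1 a"
        using p1 [OF l(1)] m1 m A1a
        by (simp add: a1.hom_int_pow int_pow_integer_mod_group mod_mult_right_eq)
      ultimately have 1: "a = ?a"
        using s1 ca ab by (auto simp: iso_def bij_betw_def inj_on_def)
      have ib: "inv\<^bsub>G2\<^esub> ?b \<in> carrier G2" using ca by simp
      have "\<rho>2 ?b = i2 l"
        using p2 [OF l(1)] m2 i l(1) by (simp add: r2.hom_int_pow) (metis H2.r_one r2.hom_closed)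
      then have "\<rho>2 (inv\<^bsub>G2\<^esub> ?b) = \<rho>2 b"
        using ca l(3) ab by (metis H2.inv_inv r2.hom_closed r2.hom_inv)
      moreover have "A2 (inv\<^bsub>G2\<^esub> ?b) = A2 b"
      proof -
        have "A2 ?b = (c l - m) mod int k"
          using p2 [OF l(1)] m2 by (simp add: a2.hom_int_pow int_pow_integer_mod_group mod_mult_right_eq)
        then have "A2 (inv\<^bsub>G2\<^esub> ?b) = (- ((c l - m) mod int k)) mod int k"
          using a2.hom_inv [OF ca(2)] a2.hom_closed [OF ca(2)] by simp
        also have "\<dots> = (m - c l) mod int k" by (simp add: mod_minus_eq)
        also have "\<dots> = (A2 b + c l - c l) mod int k" using m(2) by (rule mod_diff_cong) simp
        also have "\<dots> = A2 b" using a2.hom_closed [OF ab(3)] pos by (simp add: carrier_integer_mod_group)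
        finally show ?thesis .
      qed
      ultimately have "b = inv\<^bsub>G2\<^esub> ?b"
        using s2 ib ab by (auto simp: iso_def bij_betw_def inj_on_def)
      with 1 l(1) show "\<exists>l\<in>carrier L. \<exists>m::int. a = p1 l \<otimes>\<^bsub>G1\<^esub> m1 [^]\<^bsub>G1\<^esub> m \<and>
         b = inv\<^bsub>G2\<^esub> (p2 l \<otimes>\<^bsub>G2\<^esub> m2 [^]\<^bsub>G2\<^esub> (c l - m))" by blast
    next
      assume "\<exists>l\<in>carrier L. \<exists>m::int. a = p1 l \<otimes>\<^bsub>G1\<^esub> m1 [^]\<^bsub>G1\<^esub> m \<and>
         b = inv\<^bsub>G2\<^esub> (p2 l \<otimes>\<^bsub>G2\<^esub> m2 [^]\<^bsub>G2\<^esub> (c l - m))"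
      then obtain l m where l: "l \<in> carrier L" and a: "a = p1 l \<otimes>\<^bsub>G1\<^esub> m1 [^]\<^bsub>G1\<^esub> m"
        and b: "b = inv\<^bsub>G2\<^esub> (p2 l \<otimes>\<^bsub>G2\<^esub> m2 [^]\<^bsub>G2\<^esub> (c l - m))" by blast
      let ?b = "p2 l \<otimes>\<^bsub>G2\<^esub> m2 [^]\<^bsub>G2\<^esub> (c l - m)"
      have ca: "?b \<in> carrier G2" using p2 l m2 by auto
      have il: "i1 l \<in> carrier H1" "i2 l \<in> carrier H2" using i l by (auto simp: hom_def)
      have 1: "\<rho>1 a = i1 l" using p1 [OF l] m1 il by (simp add: a r1.hom_int_pow)
      have 2: "\<rho>2 ?b = i2 l" using p2 [OF l] m2 il by (simp add: r2.hom_int_pow)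
      have 3: "A1 a = m mod int j"
        using p1 [OF l] m1 by (simp add: a a1.hom_int_pow int_pow_integer_mod_group mod_mult_right_eq)
      have "A2 ?b = (c l - m) mod int k"
        using p2 [OF l] m2 by (simp add: a2.hom_int_pow int_pow_integer_mod_group mod_mult_right_eq)
      then have 4: "A2 b = (m - c l) mod int k"
        unfolding b using a2.hom_inv [OF ca] a2.hom_closed [OF ca] by (simp add: mod_minus_eq)
      have "A1 a mod int n = m mod int n" "A2 b mod int n = (m - c l) mod int n"
        using n unfolding 3 4 by (simp_all add: mod_mod_cancel)
      then have "(A1 a - A2 b) mod int n = (m - (m - c l)) mod int n" by (rule mod_diff_cong)
      moreover have "inv\<^bsub>H2\<^esub> \<rho>2 b = i2 l" unfolding b using 2 ca il by simp
      ultimately have "h x = f l" using 1 by (simp add: ab h_def f_def)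
      then show "h x \<in> f ` carrier L" using l by blast
    qed
    also have "\<dots> \<longleftrightarrow> t x = \<one>\<^bsub>HX\<^esub>" using ker ab by (simp add: t_def)
    finally show ?thesis by blast
  qed
  then have "kernel G HX t = kernel G (E Mod f ` carrier L) q"
    by (auto simp: kernel_def)
  then have "HX \<cong> E Mod f ` carrier L"
    by (rule iso_of_common_kernel [OF t t_surj q q_surj])
  then show ?thesis by (simp add: cokernel_def E_def f_def)
qed

section \<open>First homology of a glued space\<close>

lemma embedding_map_continuous: "embedding_map A X j \<Longrightarrow> continuous_map A X j"
  unfolding embedding_map_def using homeomorphic_imp_continuous_map continuous_map_into_fulltopology by blast

lemma embedding_homology_iso:
  assumes "embedding_map A X j"
  shows "hom_induced 1 A {} (subtopology X (j ` topspace A)) {} j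
    \<in> iso (homology_group 1 A) (homology_group 1 (subtopology X (j ` topspace A)))"
  using assms unfolding embedding_map_def by (rule homeomorphic_map_homology_iso)

lemma hom_induced_inclusion_hcl:
  assumes "singular_relcycle (Suc 0) (subtopology X P) {} c"
  shows "hom_induced 1 (subtopology X P) {} X {} id (hcl (subtopology X P) c) = hcl X c"
  using hom_induced_hcl [of "subtopology X P" X id c] assms chain_map_ident
  by (metis continuous_map_from_subtopology continuous_map_id singular_cycle)

lemma hom_induced_inclusion_subset_hcl:
  assumes "singular_relcycle (Suc 0) (subtopology X K) {} c" "K \<subseteq> P"
  shows "hom_induced 1 (subtopology X K) {} (subtopology X P) {} id (hcl (subtopology X K) c)
    = hcl (subtopology X P) c"
proof -
  have "subtopology X K = subtopology (subtopology X P) K"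
    using assms(2) by (simp add: subtopology_subtopology Int_absorb1)
  then show ?thesis
    using hom_induced_inclusion_hcl [of "subtopology X P" K c] assms(1) by simp
qed

text \<open>\<open>A\<close>, \<open>B\<close> and \<open>K\<close> are spaces of their own with
  embeddings into \<open>X\<close> instead of subspaces, because the points of an adjunction space
  are equivalence classes and have a different type from those of the pieces.\<close>

locale glued_space =
  squeezed_cover X "jA ` topspace A" "jB ` topspace B" d
  for X :: "'x topology" and A :: "'a topology" and B :: "'b topology" and jA jB d +
  fixes K :: "'k topology" and kA :: "'k \<Rightarrow> 'a" and kB :: "'k \<Rightarrow> 'b"
  assumes embA: "embedding_map A X jA" and embB: "embedding_map B X jB"
    and contA: "continuous_map K A kA" and contB: "continuous_map K B kB"
    and comm: "\<And>x. x \<in> topspace K \<Longrightarrow> jA (kA x) = jB (kB x)"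
    and embK: "embedding_map K X (\<lambda>x. jA (kA x))"
    and inter: "jA ` topspace A \<inter> jB ` topspace B = (\<lambda>x. jA (kA x)) ` topspace K"
    and pathK: "path_connected_space K"
begin

abbreviation "P \<equiv> jA ` topspace A"
abbreviation "Q \<equiv> jB ` topspace B"

lemma cont_jA: "continuous_map A X jA" and cont_jB: "continuous_map B X jB"
  using embA embB embedding_map_continuous by blast+

lemma lift_cycle:
  assumes "embedding_map Y X j" "singular_relcycle (Suc 0) (subtopology X (j ` topspace Y)) {} c"
  obtains a where "a \<in> carrier (homology_group 1 Y)"
    "hom_induced 1 Y {} (subtopology X (j ` topspace Y)) {} j a = hcl (subtopology X (j ` topspace Y)) c"
    "hom_induced 1 Y {} X {} j a = hcl X c"
proof -
  have "hcl (subtopology X (j ` topspace Y)) c \<in>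
      hom_induced 1 Y {} (subtopology X (j ` topspace Y)) {} j ` carrier (homology_group 1 Y)"
    using embedding_homology_iso [OF assms(1)] hcl_carrier [OF assms(2)]
    by (simp add: iso_def bij_betw_def)
  then obtain a where a: "hcl (subtopology X (j ` topspace Y)) c =
      hom_induced 1 Y {} (subtopology X (j ` topspace Y)) {} j a"
    "a \<in> carrier (homology_group 1 Y)"
    by (rule imageE)
  have "continuous_map Y (subtopology X (j ` topspace Y)) j"
    using assms(1) homeomorphic_imp_continuous_map unfolding embedding_map_def by blast
  moreover have "continuous_map (subtopology X (j ` topspace Y)) X id"
    by (simp add: continuous_map_from_subtopology)
  ultimately have "hom_induced 1 Y {} X {} (\<lambda>x. id (j x)) a = hcl X c"
    using hom_induced_comp [of Y "subtopology X (j ` topspace Y)" j X id 1 a]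
      hom_induced_inclusion_hcl [OF assms(2)] unfolding a(1) by simp
  then show ?thesis by (intro that [OF a(2) a(1) [symmetric]]) simp
qed

lemma homology_surj:
  assumes "x \<in> carrier (homology_group 1 X)"
  shows "\<exists>a\<in>carrier (homology_group 1 A). \<exists>b\<in>carrier (homology_group 1 B).
    x = hom_induced 1 A {} X {} jA a \<otimes>\<^bsub>homology_group 1 X\<^esub> hom_induced 1 B {} X {} jB b"
proof -
  obtain z where z: "singular_relcycle (Suc 0) X {} z" "x = hcl X z"
    using assms by (rule homology_1_cases)
  have "path_connectedin X (P \<inter> Q)"
    unfolding inter using path_connectedin_continuous_map_image embedding_map_continuous [OF embK]
      pathK path_connectedin_topspace by blast
  then obtain a b where ab: "singular_relcycle (Suc 0) (subtopology X P) {} a"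
    "singular_relcycle (Suc 0) (subtopology X Q) {} b" "homologous_rel (Suc 0) X {} z (a + b)"
    using one_cycle_splits z by (metis One_nat_def)
  obtain \<alpha> where \<alpha>: "\<alpha> \<in> carrier (homology_group 1 A)" "hom_induced 1 A {} X {} jA \<alpha> = hcl X a"
    by (rule lift_cycle [OF embA ab(1)])
  obtain \<beta> where \<beta>: "\<beta> \<in> carrier (homology_group 1 B)" "hom_induced 1 B {} X {} jB \<beta> = hcl X b"
    by (rule lift_cycle [OF embB ab(2)])
  show ?thesis
  proof (intro bexI)
    show "x = hom_induced 1 A {} X {} jA \<alpha> \<otimes>\<^bsub>homology_group 1 X\<^esub> hom_induced 1 B {} X {} jB \<beta>"
      unfolding \<alpha>(2) \<beta>(2) z hcl_add hcl_eq_iff by (rule ab)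
  qed (fact \<alpha> \<beta>)+
qed

text \<open>The classes are compared in the images \<open>P\<close> and \<open>Q\<close>, where
  exactness for cycles applies. Since the embeddings induce isomorphisms onto the homology of their
  images, the resulting equations pull back to \<open>A\<close> and \<open>B\<close>.\<close>

lemma homology_kernel:
  assumes a: "a \<in> carrier (homology_group 1 A)" and b: "b \<in> carrier (homology_group 1 B)"
  shows "hom_induced 1 A {} X {} jA a \<otimes>\<^bsub>homology_group 1 X\<^esub> hom_induced 1 B {} X {} jB b
      = \<one>\<^bsub>homology_group 1 X\<^esub> \<longleftrightarrow>
    (\<exists>c\<in>carrier (homology_group 1 K). a = hom_induced 1 K {} A {} kA c \<and>
       b = inv\<^bsub>homology_group 1 B\<^esub> hom_induced 1 K {} B {} kB c)"
    (is "?lhs \<longleftrightarrow> ?rhs")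
proof
  interpret hB: group_hom "homology_group 1 B" "homology_group 1 X" "hom_induced 1 B {} X {} jB"
    by (rule hom_induced_group_hom)
  interpret hBQ: group_hom "homology_group 1 B" "homology_group 1 (subtopology X Q)" "hom_induced 1 B {} (subtopology X Q) {} jB"
    by (rule hom_induced_group_hom)
  interpret HX: group "homology_group 1 X" by simp
  show ?lhs if rhs: ?rhs
  proof -
    obtain c where c: "c \<in> carrier (homology_group 1 K)" "a = hom_induced 1 K {} A {} kA c"
       "b = inv\<^bsub>homology_group 1 B\<^esub> hom_induced 1 K {} B {} kB c" using rhs by blast
    let ?k = "hom_induced 1 K {} B {} kB c"
    have k: "?k \<in> carrier (homology_group 1 B)" by (rule hom_induced_carrier)
    have "hom_induced 1 A {} X {} jA a = hom_induced 1 K {} X {} (\<lambda>x. jA (kA x)) c"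
      unfolding c by (rule hom_induced_comp [OF contA cont_jA])
    also have "\<dots> = hom_induced 1 K {} X {} (\<lambda>x. jB (kB x)) c"
      using hom_induced_eq [of K "\<lambda>x. jA (kA x)" "\<lambda>x. jB (kB x)"] comm by metis
    also have "\<dots> = hom_induced 1 B {} X {} jB ?k"
      by (rule hom_induced_comp [OF contB cont_jB, symmetric])
    finally show ?lhs using k unfolding c(3) by (simp add: hB.hom_inv)
  qed
  assume lhs: ?lhs
  have jAP: "continuous_map A (subtopology X P) jA" and jBQ: "continuous_map B (subtopology X Q) jB"
    using embA embB homeomorphic_imp_continuous_map unfolding embedding_map_def by blast+
  have incl: "continuous_map (subtopology X Y) X id" for Y
    by (simp add: continuous_map_from_subtopology)
  obtain a' where a': "singular_relcycle (Suc 0) (subtopology X P) {} a'"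
    "hom_induced 1 A {} (subtopology X P) {} jA a = hcl (subtopology X P) a'"
    by (rule homology_1_cases [OF hom_induced_carrier])
  obtain b' where b': "singular_relcycle (Suc 0) (subtopology X Q) {} b'"
    "hom_induced 1 B {} (subtopology X Q) {} jB b = hcl (subtopology X Q) b'"
    by (rule homology_1_cases [OF hom_induced_carrier])
  have "hom_induced 1 A {} X {} jA a = hcl X a'" "hom_induced 1 B {} X {} jB b = hcl X b'"
    using hom_induced_comp [OF jAP incl, of 1 a] hom_induced_comp [OF jBQ incl, of 1 b]
    unfolding a'(2) b'(2) hom_induced_inclusion_hcl [OF a'(1)] hom_induced_inclusion_hcl [OF b'(1)]
    by simp_all
  then have "homologous_rel (Suc 0) X {} (a' + b') 0"
    using lhs by (simp only: hcl_add hcl_zero hcl_eq_iff)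
  then obtain c where c: "singular_relcycle (Suc 0) (subtopology X (P \<inter> Q)) {} c"
    "homologous_rel (Suc 0) (subtopology X P) {} a' c" "homologous_rel (Suc 0) (subtopology X Q) {} b' (- c)"
    by (rule cycle_kernel [OF a'(1) b'(1)])
  obtain \<gamma> where \<gamma>: "\<gamma> \<in> carrier (homology_group 1 K)"
    "hom_induced 1 K {} (subtopology X (P \<inter> Q)) {} (\<lambda>x. jA (kA x)) \<gamma> = hcl (subtopology X (P \<inter> Q)) c"
    using lift_cycle [OF embK] c(1) unfolding inter [symmetric] by metis
  have kPQ: "continuous_map K (subtopology X (P \<inter> Q)) (\<lambda>x. jA (kA x))"
    using embK homeomorphic_imp_continuous_map unfolding embedding_map_def inter by blast
  have inclP: "continuous_map (subtopology X (P \<inter> Q)) (subtopology X P) id"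
    and inclQ: "continuous_map (subtopology X (P \<inter> Q)) (subtopology X Q) id"
    by (auto simp: continuous_map_in_subtopology continuous_map_from_subtopology)
  have "hom_induced 1 K {} (subtopology X P) {} (\<lambda>x. jA (kA x)) \<gamma> = hcl (subtopology X P) c"
    using hom_induced_comp [OF kPQ inclP, of 1 \<gamma>] \<gamma> hom_induced_inclusion_subset_hcl [OF c(1)] by simp
  moreover have "hom_induced 1 K {} (subtopology X P) {} (\<lambda>x. jA (kA x)) \<gamma> =
      hom_induced 1 A {} (subtopology X P) {} jA (hom_induced 1 K {} A {} kA \<gamma>)"
    by (rule hom_induced_comp [OF contA jAP, symmetric])
  moreover have "hcl (subtopology X P) a' = hcl (subtopology X P) c"
    unfolding hcl_eq_iff by (rule c)
  ultimately have eqA: "hom_induced 1 A {} (subtopology X P) {} jA a =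
      hom_induced 1 A {} (subtopology X P) {} jA (hom_induced 1 K {} A {} kA \<gamma>)"
    using a' by simp
  have injA: "inj_on (hom_induced 1 A {} (subtopology X P) {} jA) (carrier (homology_group 1 A))"
    using embedding_homology_iso [OF embA] by (simp add: iso_def bij_betw_def)
  have 1: "a = hom_induced 1 K {} A {} kA \<gamma>"
    by (rule inj_onD [OF injA eqA a hom_induced_carrier])
  let ?k = "hom_induced 1 K {} B {} kB \<gamma>"
  have k: "?k \<in> carrier (homology_group 1 B)" by (rule hom_induced_carrier)
  have cQ: "singular_relcycle (Suc 0) (subtopology X Q) {} c"
    using c(3) b'(1) homologous_rel_singular_relcycle singular_relcycle_minus by metis
  have "hom_induced 1 K {} (subtopology X Q) {} (\<lambda>x. jA (kA x)) \<gamma> = hcl (subtopology X Q) c"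
    using hom_induced_comp [OF kPQ inclQ, of 1 \<gamma>] \<gamma> hom_induced_inclusion_subset_hcl [OF c(1)] by simp
  moreover have "hom_induced 1 K {} (subtopology X Q) {} (\<lambda>x. jA (kA x)) \<gamma> =
      hom_induced 1 K {} (subtopology X Q) {} (\<lambda>x. jB (kB x)) \<gamma>"
    using hom_induced_eq [of K "\<lambda>x. jA (kA x)" "\<lambda>x. jB (kB x)"] comm by metis
  moreover have "hom_induced 1 K {} (subtopology X Q) {} (\<lambda>x. jB (kB x)) \<gamma> =
      hom_induced 1 B {} (subtopology X Q) {} jB ?k"
    by (rule hom_induced_comp [OF contB jBQ, symmetric])
  moreover have "hcl (subtopology X Q) b' = hcl (subtopology X Q) (- c)"
    unfolding hcl_eq_iff by (rule c)
  ultimately have eqB: "hom_induced 1 B {} (subtopology X Q) {} jB b =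
      hom_induced 1 B {} (subtopology X Q) {} jB (inv\<^bsub>homology_group 1 B\<^esub> ?k)"
    using b' hcl_uminus [OF cQ] k by (simp add: hBQ.hom_inv)
  have injB: "inj_on (hom_induced 1 B {} (subtopology X Q) {} jB) (carrier (homology_group 1 B))"
    using embedding_homology_iso [OF embB] by (simp add: iso_def bij_betw_def)
  have 2: "b = inv\<^bsub>homology_group 1 B\<^esub> ?k"
    by (rule inj_onD [OF injB eqB b hB.G.inv_closed [OF k]])
  show ?rhs using 1 2 \<gamma>(1) by blast
qed

end

section \<open>Gluing along a compact space\<close>

locale compact_gluing =
  fixes X :: "'a topology" and Y :: "'b topology" and K :: "'k topology"
    and kX :: "'k \<Rightarrow> 'a" and kY :: "'k \<Rightarrow> 'b" and \<phi> :: "'a \<Rightarrow> 'b"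
  assumes HX: "Hausdorff_space X" and HY: "Hausdorff_space Y" and cK: "compact_space K"
    and contX: "continuous_map K X kX" and contY: "continuous_map K Y kY"
    and injX: "inj_on kX (topspace K)" and injY: "inj_on kY (topspace K)"
    and \<phi>: "\<And>k. k \<in> topspace K \<Longrightarrow> \<phi> (kX k) = kY k"
begin

definition "B = kX ` topspace K"
definition G :: "(('a + 'b) \<times> ('a + 'b)) set" where "G = {(Inl x, Inr (\<phi> x)) | x. x \<in> B}"
definition "r = (G \<union> G\<inverse>)\<^sup>*"
definition "Z = adjunction_space X Y B \<phi>"
definition "jX x = r `` {Inl x :: 'a + 'b}"
definition "jY y = r `` {Inr y :: 'a + 'b}"

lemma B_subset: "B \<subseteq> topspace X"
  using contX by (auto simp: B_def continuous_map_def)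

lemma \<phi>_in: "x \<in> B \<Longrightarrow> \<phi> x \<in> topspace Y"
  using \<phi> contY by (auto simp: B_def continuous_map_def)

lemma \<phi>_inj: "inj_on \<phi> B"
  using injY \<phi> by (auto simp: inj_on_def B_def)

text \<open>Each step of the relation switches sides, and since \<open>\<phi>\<close> is injective
  on \<open>B\<close>, two consecutive steps lead back to the start. The closure therefore adds only
  the diagonal.\<close>

lemma r_iff: "(p, q) \<in> r \<longleftrightarrow> p = q \<or> (p, q) \<in> G \<union> G\<inverse>"
proof
  assume "(p, q) \<in> r"
  then show "p = q \<or> (p, q) \<in> G \<union> G\<inverse>"
    unfolding r_def
  proof (induction rule: rtrancl_induct)
    case (step y z)
    then show ?case using \<phi>_inj by (auto simp: G_def inj_on_def)
  qed simp
qed (auto simp: r_def)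

lemma equiv_r: "equiv UNIV r"
proof (rule equivI)
  show "sym r" unfolding r_def by (rule sym_rtrancl) (auto simp: sym_def)
qed (auto simp: r_def refl_on_def trans_rtrancl)

lemma jX_eq: "jX x = jX x' \<longleftrightarrow> x = x'"
  using \<phi>_inj unfolding jX_def eq_equiv_class_iff [OF equiv_r UNIV_I UNIV_I] r_iff by (auto simp: G_def)

lemma jY_eq: "jY y = jY y' \<longleftrightarrow> y = y'"
  unfolding jY_def eq_equiv_class_iff [OF equiv_r UNIV_I UNIV_I] r_iff by (auto simp: G_def)

lemma jX_eq_jY: "jX x = jY y \<longleftrightarrow> x \<in> B \<and> y = \<phi> x"
  unfolding jX_def jY_def eq_equiv_class_iff [OF equiv_r UNIV_I UNIV_I] r_iff by (auto simp: G_def)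

lemma quotient_eq: "topspace (disjoint_union_topology X Y) // r = jX ` topspace X \<union> jY ` topspace Y"
  by (auto simp: topspace_disjoint_union_topology quotient_def jX_def jY_def)

lemma openin_Z: "openin Z U \<longleftrightarrow> U \<subseteq> jX ` topspace X \<union> jY ` topspace Y \<and>
    openin X {x \<in> topspace X. jX x \<in> U} \<and> openin Y {y \<in> topspace Y. jY y \<in> U}"
proof -
  have "Inl -` {p \<in> topspace (disjoint_union_topology X Y). r `` {p} \<in> U} = {x \<in> topspace X. jX x \<in> U}"
       "Inr -` {p \<in> topspace (disjoint_union_topology X Y). r `` {p} \<in> U} = {y \<in> topspace Y. jY y \<in> U}"
    by (auto simp: topspace_disjoint_union_topology jX_def jY_def)
  then show ?thesis
    unfolding Z_def adjunction_space_def Let_def G_def [symmetric] r_def [symmetric]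
      openin_quotient_space_topology openin_disjoint_union_topology quotient_eq by simp
qed

lemma topspace_Z: "topspace Z = jX ` topspace X \<union> jY ` topspace Y"
proof
  show "topspace Z \<subseteq> jX ` topspace X \<union> jY ` topspace Y"
    using openin_Z [of "topspace Z"] by simp
  have "{x \<in> topspace X. jX x \<in> jX ` topspace X \<union> jY ` topspace Y} = topspace X"
       "{y \<in> topspace Y. jY y \<in> jX ` topspace X \<union> jY ` topspace Y} = topspace Y" by auto
  then have "openin Z (jX ` topspace X \<union> jY ` topspace Y)" by (simp add: openin_Z)
  then show "jX ` topspace X \<union> jY ` topspace Y \<subseteq> topspace Z" by (rule openin_subset)
qed

lemma closedin_Z: "closedin Z U \<longleftrightarrow> U \<subseteq> topspace Z \<and>
    closedin X {x \<in> topspace X. jX x \<in> U} \<and> closedin Y {y \<in> topspace Y. jY y \<in> U}"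
proof -
  have "{x \<in> topspace X. jX x \<in> topspace Z - U} = topspace X - {x \<in> topspace X. jX x \<in> U}"
       "{y \<in> topspace Y. jY y \<in> topspace Z - U} = topspace Y - {y \<in> topspace Y. jY y \<in> U}"
    by (auto simp: topspace_Z)
  then show ?thesis
    unfolding closedin_def [of Z] openin_Z [of "topspace Z - U"]
    by (auto simp: closedin_def topspace_Z)
qed

lemma cont_jX: "continuous_map X Z jX" and cont_jY: "continuous_map Y Z jY"
  by (auto simp: continuous_map_def openin_Z topspace_Z)

text \<open>A closed set of \<open>X\<close> meets \<open>B\<close> in the image of a closed, hence
  compact, subset of \<open>K\<close>. Its image in the Hausdorff space \<open>Y\<close> is compact
  and so closed.\<close>

lemma closed_preimage_X: "closedin X F \<Longrightarrow> closedin Y (\<phi> ` (F \<inter> B))"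
proof -
  assume F: "closedin X F"
  have "\<phi> ` (F \<inter> B) = kY ` {k \<in> topspace K. kX k \<in> F}" using \<phi> by (force simp: B_def)
  moreover have "compactin K {k \<in> topspace K. kX k \<in> F}"
    by (rule closedin_compact_space [OF cK closedin_continuous_map_preimage [OF contX F]])
  ultimately show ?thesis
    using image_compactin [OF _ contY] compactin_imp_closedin [OF HY] by simp
qed

lemma closed_preimage_Y: "closedin Y F \<Longrightarrow> closedin X {x \<in> B. \<phi> x \<in> F}"
proof -
  assume F: "closedin Y F"
  have "{x \<in> B. \<phi> x \<in> F} = kX ` {k \<in> topspace K. kY k \<in> F}" using \<phi> by (force simp: B_def)
  moreover have "compactin K {k \<in> topspace K. kY k \<in> F}"
    by (rule closedin_compact_space [OF cK closedin_continuous_map_preimage [OF contY F]])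
  ultimately show ?thesis
    using image_compactin [OF _ contX] compactin_imp_closedin [OF HX] by simp
qed

text \<open>A closed set of \<open>X\<close> becomes saturated by adding only its partners in
  \<open>Y\<close> under \<open>\<phi>\<close>, and those form a closed set by compactness of
  \<open>K\<close>.\<close>

lemma closed_map_jX: "closed_map X Z jX"
  unfolding closed_map_def
proof (intro allI impI)
  fix F assume F: "closedin X F"
  then have sub: "F \<subseteq> topspace X" by (rule closedin_subset)
  have "{x \<in> topspace X. jX x \<in> jX ` F} = F" using sub by (auto simp: jX_eq image_iff)
  moreover have "{y \<in> topspace Y. jY y \<in> jX ` F} = \<phi> ` (F \<inter> B)"
    using \<phi>_in by (auto simp: image_iff jX_eq_jY eq_commute [of "jY _"])
  ultimately show "closedin Z (jX ` F)"
    using F closed_preimage_X [OF F] sub by (auto simp: closedin_Z topspace_Z)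
qed

lemma closed_map_jY: "closed_map Y Z jY"
  unfolding closed_map_def
proof (intro allI impI)
  fix F assume F: "closedin Y F"
  then have sub: "F \<subseteq> topspace Y" by (rule closedin_subset)
  have "{y \<in> topspace Y. jY y \<in> jY ` F} = F" using sub by (auto simp: jY_eq image_iff)
  moreover have "{x \<in> topspace X. jX x \<in> jY ` F} = {x \<in> B. \<phi> x \<in> F}"
    using B_subset by (auto simp: image_iff jX_eq_jY)
  ultimately show "closedin Z (jY ` F)"
    using F closed_preimage_Y [OF F] sub by (auto simp: closedin_Z topspace_Z)
qed

lemma emb_jX: "embedding_map X Z jX"
  using cont_jX closed_map_jX by (rule injective_closed_imp_embedding_map) (auto simp: inj_on_def jX_eq)

lemma emb_jY: "embedding_map Y Z jY"
  using cont_jY closed_map_jY by (rule injective_closed_imp_embedding_map) (auto simp: inj_on_def jY_eq)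

lemma emb_kX: "embedding_map K X kX"
  using contX continuous_imp_closed_map [OF contX cK HX] injX by (rule injective_closed_imp_embedding_map)

lemma emb_K: "embedding_map K Z (\<lambda>k. jX (kX k))"
  using embedding_map_compose [OF emb_kX emb_jX] by (simp add: o_def)

lemma closed_P: "closedin Z (jX ` topspace X)" and closed_Q: "closedin Z (jY ` topspace Y)"
  using closed_map_jX closed_map_jY by (auto simp: closed_map_def)

lemma inter: "jX ` topspace X \<inter> jY ` topspace Y = (\<lambda>k. jX (kX k)) ` topspace K"
proof -
  have "jX ` topspace X \<inter> jY ` topspace Y = jX ` B"
    using B_subset \<phi>_in by (auto simp: jX_eq_jY image_iff)
  then show ?thesis by (simp add: B_def image_image)
qed

text \<open>A collar on the side of \<open>X\<close> alone suffices: \<open>D\<close> fixes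
  \<open>B\<close>, so it extends by the identity over \<open>Y\<close> to a homotopy of the glued
  space. At its end the neighbourhood \<open>V\<close> of the seam has been pushed into
  \<open>B\<close>, which belongs to both pieces.\<close>

lemma glued_space:
  assumes pathK: "path_connected_space K"
    and D: "continuous_map (prod_topology (top_of_set {0..1::real}) X) X D"
    and D0: "\<And>x. x \<in> topspace X \<Longrightarrow> D (0, x) = x"
    and DB: "\<And>t x. \<lbrakk>t \<in> {0..1}; x \<in> B\<rbrakk> \<Longrightarrow> D (t, x) = x"
    and V: "openin X V" "B \<subseteq> V" "\<And>x. x \<in> V \<Longrightarrow> D (1, x) \<in> B"
  obtains d where "glued_space Z X Y jX jY d K kX kY"
proof -
  let ?P = "jX ` topspace X" and ?Q = "jY ` topspace Y"
  obtain g where g: "homeomorphic_maps X (subtopology Z ?P) jX g"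
    using emb_jX by (auto simp: embedding_map_def homeomorphic_map_maps)
  then have gj: "g (jX x) = x" if "x \<in> topspace X" for x
    using that by (simp add: homeomorphic_maps_def)
  have contg: "continuous_map (subtopology Z ?P) X g"
    using g by (simp add: homeomorphic_maps_def)
  let ?I = "top_of_set {0..1::real}"
  define h where "h = (\<lambda>(t::real, p). if p \<in> ?P then jX (D (t, g p)) else p)"
  have h_jX: "h (t, jX x) = jX (D (t, x))" if "x \<in> topspace X" for t x
    using that by (simp add: h_def gj)
  have D_in: "D (t, x) \<in> topspace X" if "t \<in> {0..1}" "x \<in> topspace X" for t x
    using D that by (auto simp: continuous_map_def Pi_iff)
  have h_jY: "h (t, jY y) = jY y" if t: "t \<in> {0..1}" and y: "y \<in> topspace Y" for t y
  proof (cases "jY y \<in> ?P")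
    case True
    then obtain x where x: "x \<in> topspace X" "jY y = jX x" by auto
    then have "x \<in> B" using jX_eq_jY by metis
    with x h_jX DB t show ?thesis by simp
  qed (simp add: h_def)
  have "continuous_map (prod_topology ?I Z) Z h"
  proof (rule pasting_lemma_closed [where I = "{True, False}" and
        T = "\<lambda>b. {0..1} \<times> (if b then ?P else ?Q)" and f = "\<lambda>b. if b then (\<lambda>(t, p). jX (D (t, g p))) else snd"])
    show "closedin (prod_topology ?I Z) ({0..1} \<times> (if b then ?P else ?Q))" for b
      using closed_P closed_Q by (auto simp: closedin_prod_Times_iff)
    show "continuous_map (subtopology (prod_topology ?I Z) ({0..1} \<times> (if b then ?P else ?Q))) Z
        (if b then (\<lambda>(t, p). jX (D (t, g p))) else snd)" for b
    proof (cases b)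
      case True
      have "continuous_map (prod_topology ?I (subtopology Z ?P)) (prod_topology ?I X) (\<lambda>(t, p). (t, g p))"
        unfolding case_prod_unfold
        by (intro continuous_map_pairedI continuous_map_fst continuous_map_compose [OF continuous_map_snd contg, unfolded o_def])
      then have "continuous_map (prod_topology ?I (subtopology Z ?P)) Z (jX \<circ> (D \<circ> (\<lambda>(t, p). (t, g p))))"
        by (intro continuous_map_compose [OF continuous_map_compose [OF _ D] cont_jX])
      moreover have "subtopology (prod_topology ?I Z) ({0..1} \<times> ?P) = prod_topology ?I (subtopology Z ?P)"
        by (simp add: subtopology_Times subtopology_subtopology)
      ultimately show ?thesis using True by (simp add: o_def case_prod_unfold)
    qed (simp add: continuous_map_from_subtopology continuous_map_snd)
    fix b c p
    assume p: "p \<in> topspace (prod_topology ?I Z) \<inter> {0..1} \<times> (if b then ?P else ?Q) \<inter> {0..1} \<times> (if c then ?P else ?Q)"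
    obtain t q where tq: "p = (t, q)" "t \<in> {0..1}" using p by (cases p) auto
    \<comment> \<open>The two closed pieces overlap along the seam, where \<open>D\<close> is
      stationary, so the two formulas agree.\<close>
    have "jX (D (t, g q)) = q" if q: "q \<in> ?P" "q \<in> ?Q"
    proof -
      have "h (t, q) = q" using h_jY [OF tq(2)] q(2) by auto
      then show ?thesis using q(1) by (simp add: h_def)
    qed
    then show "(if b then (\<lambda>(t, p). jX (D (t, g p))) else snd) p = (if c then (\<lambda>(t, p). jX (D (t, g p))) else snd) p"
      using p tq by (auto split: if_splits)
  next
    fix p assume p: "p \<in> topspace (prod_topology ?I Z)"
    obtain t q where tq: "p = (t, q)" "t \<in> {0..1}" "q \<in> ?P \<union> ?Q" using p by (cases p) (auto simp: topspace_Z)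
    then show "\<exists>j. j \<in> {True, False} \<and> p \<in> {0..1} \<times> (if j then ?P else ?Q) \<and>
        h p = (if j then (\<lambda>(t, p). jX (D (t, g p))) else snd) p"
      by (intro exI [of _ "q \<in> ?P"]) (auto simp: h_def)
  qed auto
  moreover have h0: "h (0, p) = p" for p
    using h_jX D0 by (cases "p \<in> ?P") (auto simp: h_def gj)
  moreover have hP: "h (t, p) \<in> ?P" if "t \<in> {0..1}" "p \<in> ?P" for t p
    using that h_jX D_in by auto
  moreover have hQ: "h (t, p) \<in> ?Q" if "t \<in> {0..1}" "p \<in> ?Q" for t p
    using that h_jY by auto
  ultimately have homP: "homotopic_with (\<lambda>f. f \<in> ?P \<rightarrow> ?P) Z Z id (\<lambda>p. h (1, p))"
    and homQ: "homotopic_with (\<lambda>f. f \<in> ?Q \<rightarrow> ?Q) Z Z id (\<lambda>p. h (1, p))"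
    unfolding homotopic_with_def by (intro exI [of _ h]; simp)+
  have "openin Z (topspace Z - ?Q)" using closed_Q by blast
  moreover have "topspace Z - ?Q \<subseteq> {p. h (1, p) \<in> ?P}"
    using hP [of 1] by (auto simp: topspace_Z)
  ultimately have i1: "topspace Z - ?Q \<subseteq> Z interior_of {p. h (1, p) \<in> ?P}"
    by (simp add: interior_of_maximal)
  have Vs: "V \<subseteq> topspace X" using V openin_subset by blast
  have "{x \<in> topspace X. jX x \<in> jX ` V \<union> ?Q} = V"
    using Vs V(2) by (auto simp: jX_eq image_iff jX_eq_jY)
  moreover have "{y \<in> topspace Y. jY y \<in> jX ` V \<union> ?Q} = topspace Y" by auto
  ultimately have "openin Z (jX ` V \<union> ?Q)" using V Vs by (auto simp: openin_Z)
  moreover have "h (1, p) \<in> ?Q" if p: "p \<in> jX ` V \<union> ?Q" for p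
  proof (cases "p \<in> ?Q")
    case False
    then obtain x where x: "x \<in> V" "p = jX x" using p by auto
    then have "h (1, p) = jX (D (1, x))" "D (1, x) \<in> B" using h_jX Vs V by auto
    then show ?thesis using \<phi>_in jX_eq_jY by (metis image_eqI)
  qed (simp add: hQ)
  ultimately have i2: "jX ` V \<union> ?Q \<subseteq> Z interior_of {p. h (1, p) \<in> ?Q}"
    by (intro interior_of_maximal) auto
  have "topspace Z \<subseteq> Z interior_of {p. h (1, p) \<in> ?P} \<union> Z interior_of {p. h (1, p) \<in> ?Q}"
    using i1 i2 by blast
  with homP homQ have "squeezed_cover Z ?P ?Q (\<lambda>p. h (1, p))"
    by (rule squeezed_cover.intro)
  then have "glued_space Z X Y jX jY (\<lambda>p. h (1, p)) K kX kY"
    using emb_jX emb_jY contX contY emb_K inter pathK \<phi>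
    by (intro glued_space.intro glued_space_axioms.intro) (auto simp: jX_eq_jY B_def)
  then show ?thesis by (rule that)
qed

end

section \<open>Collars from framings\<close>

lemma oriented_manifold_chart:
  fixes A :: "('a, real^'n) atlas"
  assumes "oriented_manifold X A" "x \<in> topspace X"
  obtains U and \<phi> :: "'a \<Rightarrow> real^'n" where "chart X U \<phi>" "x \<in> U"
proof -
  have "x \<in> \<Union> (fst ` A)" using assms by (simp add: oriented_manifold_def)
  then obtain U \<phi> where U: "(U, \<phi>) \<in> A" "x \<in> U" by force
  then have "chart X U \<phi>" using assms by (auto simp: oriented_manifold_def)
  then show ?thesis using that U by blast
qed

section \<open>Framings as topological collars\<close>

lemma embedding_map_restrict:
  assumes "embedding_map X Y f"
  shows "embedding_map (subtopology X S) Y f"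
proof -
  have f: "homeomorphic_map X (subtopology Y (f ` topspace X)) f"
    using assms by (simp add: embedding_map_def)
  have "homeomorphic_map (subtopology X S) (subtopology (subtopology Y (f ` topspace X)) (f ` (topspace X \<inter> S))) f"
    using homeomorphic_imp_surjective_map [OF f] by (intro homeomorphic_map_subtopologies [OF f]) blast
  then show ?thesis
    by (simp add: embedding_map_def subtopology_subtopology Int_absorb1 image_mono)
qed

text \<open>Invariance of domain: near each point the embedding is expressed in charts as an
  injective continuous map between spaces of the same dimension.\<close>

lemma embedding_open_in_4_manifold:
  fixes S :: "'s topology" and AS :: "('s, real^2) atlas" and M :: "'a topology" and A :: "('a, real^4) atlas"
  assumes S: "oriented_manifold S AS" and M: "oriented_manifold M A"
    and T: "embedding_map (subtopology (prod_topology S euclidean) W) M (T :: 's \<times> complex \<Rightarrow> 'a)"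
    and V: "openin (prod_topology S euclidean) V" "V \<subseteq> W"
  shows "openin M (T ` V)"
proof (subst openin_subopen, intro ballI)
  let ?PS = "prod_topology S (euclidean :: complex topology)"
  fix y assume "y \<in> T ` V"
  then obtain z w where zw: "(z, w) \<in> V" "y = T (z, w)" by auto
  have Vtop: "V \<subseteq> topspace S \<times> UNIV" using openin_subset [OF V(1)] by simp
  have contT: "continuous_map (subtopology ?PS V) M T"
    using embedding_map_continuous [OF T] V(2) continuous_map_from_subtopology_mono by blast
  have injT: "inj_on T V"
    using T V(2) Vtop unfolding embedding_map_def homeomorphic_eq_everything_map
    by (auto intro: inj_on_subset)
  have "z \<in> topspace S" "y \<in> topspace M"
    using zw Vtop contT by (auto simp: continuous_map_def Pi_iff)
  then obtain U U' and \<phi> :: "'s \<Rightarrow> real^2" and \<psi> :: "'a \<Rightarrow> real^4"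
    where U: "chart S U \<phi>" "z \<in> U" and U': "chart M U' \<psi>" "y \<in> U'"
    using oriented_manifold_chart [OF S] oriented_manifold_chart [OF M] by metis
  have oU: "openin S U" "open (\<phi> ` U)" and oU': "openin M U'"
    using U U' by (auto simp: chart_def)
  obtain g where g: "homeomorphic_maps (subtopology S U) (top_of_set (\<phi> ` U)) \<phi> g"
    using U by (auto simp: chart_def homeomorphic_map_maps)
  have Usub: "U \<subseteq> topspace S" "U' \<subseteq> topspace M" using oU oU' openin_subset by blast+
  have g\<phi>: "g (\<phi> x) = x" if "x \<in> U" for x
    using g that Usub by (auto simp: homeomorphic_maps_def)
  have contg: "continuous_map (top_of_set (\<phi> ` U)) S g"
    using g by (simp add: homeomorphic_maps_def continuous_map_in_subtopology)
  have "homeomorphic_map (subtopology M U') (top_of_set (\<psi> ` U')) \<psi>"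
    using U' by (simp add: chart_def)
  then have cont\<psi>: "continuous_map (subtopology M U') euclidean \<psi>" and inj\<psi>: "inj_on \<psi> U'"
    using Usub by (auto simp: homeomorphic_eq_everything_map continuous_map_in_subtopology Int_absorb1)
  \<comment> \<open>\<open>N\<close> is the part of \<open>V\<close> that fits into both charts;
    \<open>Q\<close> below is the same set in coordinates.\<close>
  define N where "N = {q \<in> V. fst q \<in> U \<and> T q \<in> U'}"
  have "openin (subtopology ?PS V) {q \<in> topspace (subtopology ?PS V). T q \<in> U'}"
    by (rule openin_continuous_map_preimage [OF contT oU'])
  then have 1: "openin ?PS {q \<in> topspace (subtopology ?PS V). T q \<in> U'}"
    using openin_trans_full V(1) by blast
  have 2: "openin ?PS {q \<in> topspace ?PS. fst q \<in> U}"
    by (rule openin_continuous_map_preimage [OF continuous_map_fst oU(1)])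
  have "N = {q \<in> topspace (subtopology ?PS V). T q \<in> U'} \<inter> {q \<in> topspace ?PS. fst q \<in> U}"
    using Vtop by (auto simp: N_def)
  then have N: "openin ?PS N" using 1 2 by (simp add: openin_Int)
  let ?G = "\<lambda>(x, w). (g x, w)"
  define Q where "Q = {q \<in> \<phi> ` U \<times> UNIV. ?G q \<in> N}"
  have contG: "continuous_map (top_of_set (\<phi> ` U \<times> UNIV)) ?PS ?G"
  proof -
    have "continuous_map (prod_topology (top_of_set (\<phi> ` U)) euclidean) ?PS ?G"
      unfolding case_prod_unfold
      by (intro continuous_map_pairedI continuous_map_snd continuous_map_compose [OF continuous_map_fst contg, unfolded o_def])
    then show ?thesis using prod_topology_subtopology_eu [of "\<phi> ` U" "UNIV :: complex set"] by simp
  qed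
  have "openin (top_of_set (\<phi> ` U \<times> UNIV)) Q"
    using openin_continuous_map_preimage [OF contG N] by (simp add: Q_def)
  moreover have "open (\<phi> ` U \<times> (UNIV :: complex set))" using oU by (simp add: open_Times)
  ultimately have openQ: "open Q" using openin_open_trans by blast
  have "continuous_map (top_of_set Q) (subtopology ?PS N) ?G"
    using continuous_map_from_subtopology_mono [OF contG, of Q]
    by (auto simp: continuous_map_in_subtopology Q_def)
  moreover have "continuous_map (subtopology ?PS N) (subtopology M U') T"
    using continuous_map_from_subtopology_mono [OF contT, of N]
    by (auto simp: continuous_map_in_subtopology N_def)
  ultimately have "continuous_map (top_of_set Q) euclidean (\<psi> \<circ> (T \<circ> ?G))"
    using cont\<psi> by (intro continuous_map_compose)
  then have contF: "continuous_on Q (\<psi> \<circ> (T \<circ> ?G))" by simp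
  have GQ: "?G ` Q = N"
  proof
    show "N \<subseteq> ?G ` Q"
    proof
      fix q assume q: "q \<in> N"
      then have "(\<phi> (fst q), snd q) \<in> Q" "?G (\<phi> (fst q), snd q) = q"
        by (auto simp: N_def Q_def g\<phi>)
      then show "q \<in> ?G ` Q" by (metis image_eqI)
    qed
  qed (auto simp: Q_def)
  have "inj_on ?G Q" by (auto simp: inj_on_def Q_def g\<phi>)
  moreover have "inj_on T N" using injT by (rule inj_on_subset) (auto simp: N_def)
  moreover have "inj_on \<psi> (T ` N)" using inj\<psi> by (rule inj_on_subset) (auto simp: N_def)
  moreover have "(T \<circ> ?G) ` Q = T ` N" unfolding image_comp [symmetric] GQ ..
  ultimately have "inj_on (\<psi> \<circ> (T \<circ> ?G)) Q"
    by (metis GQ comp_inj_on)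
  \<comment> \<open>The source \<open>real^2\<close> times \<open>complex\<close> and the target
    \<open>real^4\<close> both have dimension 4.\<close>
  then have "open ((\<psi> \<circ> (T \<circ> ?G)) ` Q)"
    by (intro invariance_of_domain_gen openQ contF) auto
  then have F: "open (\<psi> ` T ` N)" by (simp only: image_comp [symmetric] GQ)
  have "openin (subtopology M U') {m \<in> topspace (subtopology M U'). \<psi> m \<in> \<psi> ` T ` N}"
    using openin_continuous_map_preimage [OF cont\<psi>, of "\<psi> ` T ` N"] F by simp
  moreover have "{m \<in> topspace (subtopology M U'). \<psi> m \<in> \<psi> ` T ` N} = T ` N"
    using inj\<psi> Usub by (auto simp: N_def inj_on_def)
  ultimately have "openin M (T ` N)" using openin_trans_full oU' by metis
  moreover have "y \<in> T ` N" using zw U U' by (auto simp: N_def)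
  moreover have "T ` N \<subseteq> T ` V" by (auto simp: N_def)
  ultimately show "\<exists>T'. openin M T' \<and> y \<in> T' \<and> T' \<subseteq> T ` V" by blast
qed

text \<open>The topological content extracted from a framing: an embedding of a closed tube slightly
  larger than the unit tube that is open on the interior of the larger tube. Smoothness has served
  its purpose at this point.\<close>

locale collar =
  fixes S :: "'s topology" and M :: "'a topology" and T :: "'s \<times> complex \<Rightarrow> 'a" and R :: real
  assumes compS: "compact_space S" and HM: "Hausdorff_space M" and R: "R > 1"
    and embT: "embedding_map (prod_topology S (top_of_set (cball 0 R))) M T"
    and opT: "\<And>V. \<lbrakk>openin (prod_topology S euclidean) V; V \<subseteq> topspace S \<times> ball 0 R\<rbrakk> \<Longrightarrow> openin M (T ` V)"

lemma framing_collar: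
  fixes S :: "'s topology" and AS :: "('s, real^2) atlas" and M :: "'a topology" and A :: "('a, real^4) atlas"
  assumes S: "oriented_manifold S AS" "compact_space S" and M: "oriented_manifold M A"
    and fr: "framing S AS M A i \<tau>"
  obtains T R where "collar S M T R" "\<forall>p\<in>topspace S \<times> cball 0 1. \<tau> p = T p"
proof -
  let ?PS = "prod_topology S (euclidean :: complex topology)"
  obtain W T where W: "openin ?PS W" "topspace S \<times> cball 0 1 \<subseteq> W"
    and T: "embedding_map (subtopology ?PS W) M T" "\<And>p. p \<in> topspace S \<times> cball 0 1 \<Longrightarrow> \<tau> p = T p"
    using fr by (auto simp: framing_def smooth_embedding_def)
  have "compactin S (topspace S)" "compactin (euclidean :: complex topology) (cball 0 1)"
    using S(2) by (auto simp: compact_space_def compactin_euclidean_iff)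
  \<comment> \<open>The tube lemma: \<open>S\<close> and the closed disc are compact, so the
    neighbourhood \<open>W\<close> contains a product neighbourhood.\<close>
  then obtain U V where UV: "openin S U" "openin (euclidean :: complex topology) V" "topspace S \<subseteq> U" "cball 0 1 \<subseteq> V" "U \<times> V \<subseteq> W"
    using Wallace_theorem_prod_topology W by metis
  have "compact (cball (0::complex) 1)" "open V" using UV(2) by auto
  then obtain e where e: "e > 0" "(\<Union>x\<in>cball 0 1. ball x e) \<subseteq> V"
    using compact_subset_open_imp_ball_epsilon_subset UV(4) by metis
  \<comment> \<open>Half of \<open>e\<close> keeps the whole closed disc of radius \<open>R\<close>
    strictly inside the \<open>e\<close>-neighbourhood of the unit disc.\<close>
  define R where "R = 1 + e / 2"
  have "cball 0 R \<subseteq> V"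
  proof
    fix w :: complex assume w: "w \<in> cball 0 R"
    show "w \<in> V"
    proof (cases "norm w \<le> 1")
      case False
      \<comment> \<open>The radial projection of \<open>w\<close> to the unit circle is at distance
        \<open>norm w - 1\<close>, at most \<open>e / 2\<close>.\<close>
      let ?x = "w /\<^sub>R norm w"
      have n: "norm w > 1" using False by (rule not_le_imp_less)
      then have w0: "w \<noteq> 0" by (intro notI) simp
      have "dist ?x w = norm w - 1"
      proof -
        have "?x - w = (1 / norm w - 1) *\<^sub>R w" by (simp add: scaleR_diff_left inverse_eq_divide)
        then have "dist ?x w = \<bar>(1 / norm w - 1) * norm w\<bar>" by (simp add: dist_norm abs_mult)
        also have "(1 / norm w - 1) * norm w = 1 - norm w" using w0 by (simp add: left_diff_distrib)
        finally show ?thesis using n by simp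
      qed
      then have "w \<in> ball ?x e" using w e(1) by (simp add: R_def)
      moreover have "?x \<in> cball 0 1" using w0 by simp
      ultimately show ?thesis using e(2) by blast
    next
      case True
      then have "w \<in> cball 0 1" by simp
      then show ?thesis by (rule subsetD [OF UV(4)])
    qed
  qed
  then have sub: "topspace S \<times> cball 0 R \<subseteq> W" using UV by blast
  have eq: "subtopology (subtopology ?PS W) (topspace S \<times> cball 0 R) = prod_topology S (top_of_set (cball 0 R))"
    using sub by (simp add: subtopology_subtopology subtopology_Times Int_absorb1)
  have "collar S M T R"
  proof
    show "embedding_map (prod_topology S (top_of_set (cball 0 R))) M T"
      using embedding_map_restrict [OF T(1), of "topspace S \<times> cball 0 R"] unfolding eq .
    show "openin M (T ` V)" if "openin ?PS V" "V \<subseteq> topspace S \<times> ball 0 R" for V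
    proof -
      have "topspace S \<times> ball 0 R \<subseteq> topspace S \<times> cball (0::complex) R" by (intro Sigma_mono) auto
      then have "V \<subseteq> W" using that(2) sub by blast
      then show ?thesis using embedding_open_in_4_manifold [OF S(1) M T(1) that(1)] by blast
    qed
    show "Hausdorff_space M" using M by (simp add: oriented_manifold_def)
  qed (use S e in \<open>auto simp: R_def\<close>)
  then show ?thesis using that T(2) by blast
qed

section \<open>Path connectedness of manifolds\<close>

lemma oriented_manifold_locally_path_connected:
  assumes "oriented_manifold X (A :: ('a, real^'n) atlas)"
  shows "locally_path_connected_space X"
  unfolding locally_path_connected_space_def neighbourhood_base_of
proof (intro allI impI, elim conjE)
  fix W x assume W: "openin X W" "x \<in> W"
  then have "x \<in> topspace X" using openin_subset by blast
  then obtain U and \<phi> :: "'a \<Rightarrow> real^'n" where U: "chart X U \<phi>" "x \<in> U" using oriented_manifold_chart [OF assms] by metis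
  then have oU: "openin X U" "open (\<phi> ` U)" and Usub: "U \<subseteq> topspace X"
    by (auto simp: chart_def dest: openin_subset)
  obtain g where g: "homeomorphic_maps (subtopology X U) (top_of_set (\<phi> ` U)) \<phi> g"
    using U by (auto simp: chart_def homeomorphic_map_maps)
  have g\<phi>: "g (\<phi> y) = y" if "y \<in> U" for y using g that Usub by (auto simp: homeomorphic_maps_def)
  have contg: "continuous_map (top_of_set (\<phi> ` U)) X g"
    using g by (simp add: homeomorphic_maps_def continuous_map_in_subtopology)
  have cont\<phi>: "continuous_map (subtopology X U) euclidean \<phi>"
    using g by (simp add: homeomorphic_maps_def continuous_map_in_subtopology)
  have "openin (top_of_set (\<phi> ` U)) {v \<in> topspace (top_of_set (\<phi> ` U)). g v \<in> W}"
    by (rule openin_continuous_map_preimage [OF contg W(1)])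
  then have "open {v \<in> \<phi> ` U. g v \<in> W}" using openin_open_trans oU(2) by fastforce
  moreover have "\<phi> x \<in> {v \<in> \<phi> ` U. g v \<in> W}" using U W g\<phi> by auto
  ultimately obtain e where e: "e > 0" "ball (\<phi> x) e \<subseteq> {v \<in> \<phi> ` U. g v \<in> W}"
    by (meson open_contains_ball)
  let ?V = "g ` ball (\<phi> x) e"
  have "continuous_map (top_of_set (ball (\<phi> x) e)) X g"
    using contg e(2) by (intro continuous_map_from_subtopology_mono [OF contg]) auto
  moreover have "path_connectedin (top_of_set (ball (\<phi> x) e)) (ball (\<phi> x) e)"
    by (simp add: convex_imp_path_connected)
  ultimately have "path_connectedin X ?V" using path_connectedin_continuous_map_image by blast
  moreover have "?V = {y \<in> topspace (subtopology X U). \<phi> y \<in> ball (\<phi> x) e}"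
    using e(2) g\<phi> Usub by (force simp: image_iff)
  then have "openin (subtopology X U) ?V"
    using openin_continuous_map_preimage [OF cont\<phi>, of "ball (\<phi> x) e"] by simp
  then have "openin X ?V" using openin_trans_full oU(1) by blast
  moreover have "x \<in> ?V" using e(1) g\<phi> [OF U(2)] by (metis centre_in_ball image_eqI)
  moreover have "?V \<subseteq> W" using e(2) by blast
  ultimately show "\<exists>U V. openin X U \<and> path_connectedin X V \<and> x \<in> U \<and> U \<subseteq> V \<and> V \<subseteq> W" by blast
qed

lemma manifold_path_connected:
  assumes "closed_oriented_connected_manifold X (A :: ('a, real^'n) atlas)"
  shows "path_connected_space X"
  using assms oriented_manifold_locally_path_connected path_connected_eq_connected_space
  unfolding closed_oriented_connected_manifold_def by blast

text \<open>For \<open>t\<close> from 0 to 1, a homotopy of \<open>[1, R]\<close> rel endpoints from the identity to a map that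
  collapses \<open>[1, (1 + R) / 2]\<close> to 1.\<close>

definition squeeze :: "real \<Rightarrow> real \<Rightarrow> real \<Rightarrow> real" where
  "squeeze R t \<rho> = (1 - t) * \<rho> + t * max 1 (min \<rho> (2 * \<rho> - R))"

lemma squeeze_0 [simp]: "squeeze R 0 \<rho> = \<rho>"
  by (simp add: squeeze_def)

lemma squeeze_const: "max 1 (min \<rho> (2 * \<rho> - R)) = \<rho> \<Longrightarrow> squeeze R t \<rho> = \<rho>"
  by (simp only: squeeze_def) (simp add: left_diff_distrib)

lemma squeeze_ends: "R > 1 \<Longrightarrow> squeeze R t 1 = 1" "R > 1 \<Longrightarrow> squeeze R t R = R"
  by (intro squeeze_const; simp)+

lemma squeeze_1: "\<rho> \<le> (1 + R) / 2 \<Longrightarrow> squeeze R 1 \<rho> = 1"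
  by (simp add: squeeze_def min_def max_def)

lemma squeeze_range:
  assumes "R > 1" "t \<in> {0..1}" "1 \<le> \<rho>" "\<rho> \<le> R"
  shows "1 \<le> squeeze R t \<rho>" "squeeze R t \<rho> \<le> R"
proof -
  let ?m = "max 1 (min \<rho> (2 * \<rho> - R))"
  have m: "1 \<le> ?m" "?m \<le> R" using assms by auto
  have t: "0 \<le> t" "0 \<le> 1 - t" using assms by auto
  have "(1 - t) * 1 + t * 1 \<le> (1 - t) * \<rho> + t * ?m"
    by (rule add_mono [OF mult_left_mono [OF assms(3) t(2)] mult_left_mono [OF m(1) t(1)]])
  then show "1 \<le> squeeze R t \<rho>" by (simp only: squeeze_def) simp
  have "(1 - t) * \<rho> + t * ?m \<le> (1 - t) * R + t * R"
    by (rule add_mono [OF mult_left_mono [OF assms(4) t(2)] mult_left_mono [OF m(2) t(1)]])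
  then show "squeeze R t \<rho> \<le> R" by (simp only: squeeze_def) (simp add: left_diff_distrib)
qed

section \<open>The exterior of a tube and its collar homotopy\<close>

context collar
begin

text \<open>Only the open unit tube is removed, so the boundary stays in \<open>outer\<close>;
  \<open>interior_tube\<close> reconciles this with \<open>exterior\<close>, which removes the
  interior of the closed tube.\<close>

definition "outer = topspace M - T ` (topspace S \<times> ball 0 1)"
definition "Ext = subtopology M outer"
definition "annulus = T ` (topspace S \<times> {\<alpha>. 1 \<le> norm \<alpha> \<and> norm \<alpha> \<le> R})"
definition "rim = T ` (topspace S \<times> sphere 0 1)"

lemma contT: "continuous_map (prod_topology S (top_of_set (cball 0 R))) M T"
  by (rule embedding_map_continuous [OF embT])

lemma injT: "inj_on T (topspace S \<times> cball 0 R)"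
  using embT by (simp add: embedding_map_def homeomorphic_eq_everything_map)

lemma T_in: "z \<in> topspace S \<Longrightarrow> norm \<alpha> \<le> R \<Longrightarrow> T (z, \<alpha>) \<in> topspace M"
  using contT by (auto simp: continuous_map_def Pi_iff)

lemma T_eq: "\<lbrakk>z \<in> topspace S; norm \<alpha> \<le> R; z' \<in> topspace S; norm \<alpha>' \<le> R\<rbrakk> \<Longrightarrow> T (z, \<alpha>) = T (z', \<alpha>') \<longleftrightarrow> z = z' \<and> \<alpha> = \<alpha>'"
  using inj_on_eq_iff [OF injT, of "(z, \<alpha>)" "(z', \<alpha>')"] by auto

lemma T_outer:
  assumes "z \<in> topspace S" "norm \<alpha> \<le> R"
  shows "T (z, \<alpha>) \<in> outer \<longleftrightarrow> 1 \<le> norm \<alpha>"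
proof -
  have "T (z, \<alpha>) \<in> T ` (topspace S \<times> ball 0 1) \<longleftrightarrow> norm \<alpha> < 1"
    using assms R T_eq by (fastforce simp: image_iff)
  then show ?thesis using T_in [OF assms] by (auto simp: outer_def)
qed

lemma openin_tube: "r \<le> R \<Longrightarrow> openin M (T ` (topspace S \<times> ball 0 r))"
  by (rule opT) (auto simp: openin_prod_Times_iff)

lemma topspace_Ext: "topspace Ext = outer"
  by (auto simp: Ext_def outer_def)

text \<open>A point at radius 1 is a limit of points of slightly larger radius. Because
  \<open>T\<close> is injective on the tube of radius \<open>R > 1\<close>, these lie outside the
  closed unit tube, so the point is not interior.\<close>

lemma interior_tube: "M interior_of (T ` (topspace S \<times> cball 0 1)) = T ` (topspace S \<times> ball 0 1)"
proof
  show "T ` (topspace S \<times> ball 0 1) \<subseteq> M interior_of (T ` (topspace S \<times> cball 0 1))"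
    using R openin_tube [of 1] by (intro interior_of_maximal) auto
  show "M interior_of (T ` (topspace S \<times> cball 0 1)) \<subseteq> T ` (topspace S \<times> ball 0 1)"
  proof
    fix p assume p: "p \<in> M interior_of (T ` (topspace S \<times> cball 0 1))"
    then obtain z \<alpha> where z: "p = T (z, \<alpha>)" "z \<in> topspace S" "norm \<alpha> \<le> 1"
      using interior_of_subset [of M] by fastforce
    have "norm \<alpha> < 1"
    proof (rule ccontr)
      assume "\<not> norm \<alpha> < 1"
      then have n: "norm \<alpha> = 1" using z by simp
      \<comment> \<open>The radial path through the point in question, which is reached at
        \<open>s = 1\<close>.\<close>
      have "continuous_map (top_of_set {0..R}) (prod_topology S (top_of_set (cball 0 R))) (\<lambda>s. (z, of_real s * \<alpha>))"
        using z(2) n R by (auto simp: continuous_map_in_subtopology norm_mult intro!: continuous_map_pairedI continuous_intros)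
      from continuous_map_compose [OF this contT]
      have c: "continuous_map (top_of_set {0..R}) M (\<lambda>s. T (z, of_real s * \<alpha>))" by (simp add: o_def)
      let ?J = "{s \<in> topspace (top_of_set {0..R}). T (z, of_real s * \<alpha>) \<in> M interior_of (T ` (topspace S \<times> cball 0 1))}"
      have "openin (top_of_set {0..R}) ?J"
        by (rule openin_continuous_map_preimage [OF c openin_interior_of])
      moreover have "1 \<in> ?J" using p z R by simp
      ultimately obtain e where e: "e > 0" "\<And>s. s \<in> {0..R} \<Longrightarrow> dist s 1 < e \<Longrightarrow> s \<in> ?J"
        unfolding openin_euclidean_subtopology_iff by blast
      \<comment> \<open>Just beyond 1, yet capped at \<open>R\<close> so that \<open>T\<close> is
        still known to be injective there.\<close>
      define s where "s = min R (1 + e / 2)"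
      have s: "s > 1" "s \<le> R" "s \<in> {0..R}" "dist s 1 < e" using e R by (auto simp: s_def dist_real_def)
      then have "T (z, of_real s * \<alpha>) \<in> T ` (topspace S \<times> cball 0 1)"
        using e(2) [of s] interior_of_subset [of M] by blast
      then obtain z' \<beta> where "T (z, of_real s * \<alpha>) = T (z', \<beta>)" "z' \<in> topspace S" "norm \<beta> \<le> 1" by fastforce
      then have "norm (of_real s * \<alpha>) \<le> 1"
        using T_eq [of z "of_real s * \<alpha>" z' \<beta>] z s n R by (simp add: norm_mult)
      then show False using s n by (simp add: norm_mult)
    qed
    then show "p \<in> T ` (topspace S \<times> ball 0 1)" using z by auto
  qed
qed

lemma annulus_subset: "annulus \<subseteq> outer"
  using T_outer by (auto simp: annulus_def)

lemma closedin_annulus: "closedin M annulus"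
proof -
  have "compactin (prod_topology S (top_of_set (cball 0 R))) (topspace S \<times> {\<alpha>::complex. 1 \<le> norm \<alpha> \<and> norm \<alpha> \<le> R})"
  proof -
    have "{\<alpha>::complex. 1 \<le> norm \<alpha> \<and> norm \<alpha> \<le> R} = cball 0 R \<inter> {\<alpha>. 1 \<le> norm \<alpha>}" by auto
    moreover have "closed {\<alpha>::complex. 1 \<le> norm \<alpha>}" by (intro closed_Collect_le continuous_intros)
    ultimately have "compact {\<alpha>::complex. 1 \<le> norm \<alpha> \<and> norm \<alpha> \<le> R}" by (simp add: compact_Int_closed)
    then show ?thesis
      using compS by (auto simp: compactin_Times compact_space_def compactin_subtopology)
  qed
  then show ?thesis
    unfolding annulus_def using image_compactin [OF _ contT] compactin_imp_closedin [OF HM] by blast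
qed

text \<open>The radius is squeezed inside the annulus and nothing moves outside it. The two formulas
  fit together on the outer end, of radius \<open>R\<close>, while the inner end, the rim, is kept
  fixed as the gluing requires.\<close>

lemma collar_homotopy:
  obtains D V where
    "continuous_map (prod_topology (top_of_set {0..1::real}) Ext) Ext D"
    "\<forall>x\<in>topspace Ext. D (0, x) = x"
    "\<forall>t\<in>{0..1}. \<forall>x\<in>rim. D (t, x) = x"
    "openin Ext V" "rim \<subseteq> V" "\<forall>x\<in>V. D (1, x) \<in> rim"
proof -
  let ?I = "top_of_set {0..1::real}"
  let ?C = "prod_topology S (top_of_set (cball (0::complex) R))"
  let ?far = "topspace M - T ` (topspace S \<times> ball 0 R)"
  obtain g where g: "homeomorphic_maps ?C (subtopology M (T ` topspace ?C)) T g"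
    using embT by (auto simp: embedding_map_def homeomorphic_map_maps)
  have gT: "g (T (z, \<alpha>)) = (z, \<alpha>)" if "z \<in> topspace S" "norm \<alpha> \<le> R" for z \<alpha>
    using g that by (auto simp: homeomorphic_maps_def)
  \<comment> \<open>Rescaling \<open>\<alpha>\<close> so that its radius becomes the squeezed one;
    on the annulus the radius is at least 1, so the division is harmless.\<close>
  define c where "c = (\<lambda>(t, z::'s, \<alpha>::complex). (z, of_real (squeeze R t (norm \<alpha>) / norm \<alpha>) * \<alpha>))"
  define D where "D = (\<lambda>(t, x). if x \<in> annulus then T (c (t, g x)) else x)"
  have D_T: "D (t, T (z, \<alpha>)) = T (z, of_real (squeeze R t (norm \<alpha>) / norm \<alpha>) * \<alpha>)"
    if "z \<in> topspace S" "1 \<le> norm \<alpha>" "norm \<alpha> \<le> R" for t z \<alpha>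
    using that by (auto simp: D_def c_def gT annulus_def)
  have nc: "norm (of_real (squeeze R t (norm \<alpha>) / norm \<alpha>) * \<alpha>) = squeeze R t (norm \<alpha>)"
    if "t \<in> {0..1}" "1 \<le> norm \<alpha>" "norm \<alpha> \<le> R" for t and \<alpha> :: complex
  proof -
    have "norm \<alpha> \<noteq> 0" using that by auto
    moreover have "squeeze R t (norm \<alpha>) \<ge> 0" using squeeze_range(1) [OF R that] by simp
    ultimately show ?thesis by (simp add: norm_mult norm_divide)
  qed
  have D_annulus: "D (t, x) \<in> annulus" if t: "t \<in> {0..1}" and x: "x \<in> annulus" for t x
  proof -
    obtain z \<alpha> where z: "x = T (z, \<alpha>)" "z \<in> topspace S" "1 \<le> norm \<alpha>" "norm \<alpha> \<le> R"
      using x by (auto simp: annulus_def)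
    then show ?thesis
      using squeeze_range [OF R t, of "norm \<alpha>"] nc [OF t, of \<alpha>] by (simp add: D_T annulus_def)
  qed
  have D_fixed: "D (t, T (z, \<alpha>)) = T (z, \<alpha>)" if "z \<in> topspace S" "norm \<alpha> = 1 \<or> norm \<alpha> = R" for t z \<alpha>
    using that R by (subst D_T) (auto simp: squeeze_ends)
  \<comment> \<open>A point of the annulus outside the open tube of radius \<open>R\<close> has
    radius exactly \<open>R\<close>, where \<open>squeeze\<close> is stationary.\<close>
  have D_far: "D (t, x) = x" if "x \<in> ?far" for t x
  proof (cases "x \<in> annulus")
    case True
    then obtain z \<alpha> where z: "x = T (z, \<alpha>)" "z \<in> topspace S" "1 \<le> norm \<alpha>" "norm \<alpha> \<le> R"
      by (auto simp: annulus_def)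
    then have "\<not> norm \<alpha> < R" using that by auto
    then show ?thesis using z D_fixed by auto
  qed (simp add: D_def)
  have far_sub: "?far \<subseteq> outer" using R by (auto simp: outer_def)
  have cov: "outer \<subseteq> annulus \<union> ?far"
  proof
    fix x assume x: "x \<in> outer"
    show "x \<in> annulus \<union> ?far"
    proof (cases "x \<in> ?far")
      case False
      then obtain z \<alpha> where z: "x = T (z, \<alpha>)" "z \<in> topspace S" "norm \<alpha> < R"
        using x by (auto simp: outer_def)
      then have "1 \<le> norm \<alpha>" using T_outer [of z \<alpha>] x by simp
      then show ?thesis using z by (auto simp: annulus_def)
    qed simp
  qed
  have "continuous_map (prod_topology ?I Ext) Ext D"
  proof (rule pasting_lemma_closed [where I = "{True, False}" and
        T = "\<lambda>b. {0..1} \<times> (if b then annulus else ?far)" and f = "\<lambda>b. if b then (\<lambda>(t, x). T (c (t, g x))) else snd"])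
    have "closedin Ext annulus" "closedin Ext ?far"
      using closedin_annulus annulus_subset openin_tube [of R] far_sub
      by (auto simp: Ext_def closedin_subtopology_Int_closed closedin_closed_subtopology intro: closedin_subset_topspace)
    then show "closedin (prod_topology ?I Ext) ({0..1} \<times> (if b then annulus else ?far))" for b
      by (auto simp: closedin_prod_Times_iff)
    show "continuous_map (subtopology (prod_topology ?I Ext) ({0..1} \<times> (if b then annulus else ?far))) Ext
        (if b then (\<lambda>(t, x). T (c (t, g x))) else snd)" for b
    proof (cases b)
      case True
      let ?A = "{\<alpha>::complex. 1 \<le> norm \<alpha> \<and> norm \<alpha> \<le> R}"
      have "continuous_map (subtopology M annulus) ?C g"
        using g by (auto simp: homeomorphic_maps_def annulus_def intro: continuous_map_from_subtopology_mono)
      then have "continuous_map (subtopology M annulus) (subtopology ?C (topspace S \<times> ?A)) g"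
        by (auto simp: continuous_map_in_subtopology annulus_def gT)
      moreover have "subtopology ?C (topspace S \<times> ?A) = prod_topology S (top_of_set ?A)"
        by (simp add: subtopology_Times subtopology_subtopology) (metis (no_types, lifting) Int_absorb1 mem_Collect_eq mem_cball_0 subsetI)
      ultimately have g': "continuous_map (subtopology M annulus) (prod_topology S (top_of_set ?A)) g" by simp
      have 1: "continuous_map (prod_topology ?I (subtopology M annulus)) (prod_topology ?I (prod_topology S (top_of_set ?A)))
          (\<lambda>(t, x). (t, g x))"
        unfolding case_prod_unfold
        by (intro continuous_map_pairedI continuous_map_fst continuous_map_compose [OF continuous_map_snd g', unfolded o_def])
      have 2: "continuous_map (prod_topology ?I (prod_topology S (top_of_set ?A))) ?C c"
      proof -
        have 3: "continuous_map (prod_topology ?I (top_of_set ?A)) (top_of_set (cball 0 R))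
            (\<lambda>(t, \<alpha>). of_real (squeeze R t (norm \<alpha>) / norm \<alpha>) * \<alpha>)"
        proof -
          have "continuous_on ({0..1} \<times> ?A) (\<lambda>(t, \<alpha>). of_real (squeeze R t (norm \<alpha>) / norm \<alpha>) * \<alpha>)"
            unfolding squeeze_def case_prod_unfold by (intro continuous_intros) auto
          moreover have "norm (of_real (squeeze R t (norm \<alpha>) / norm \<alpha>) * \<alpha>) \<le> R" if "t \<in> {0..1}" "\<alpha> \<in> ?A" for t and \<alpha> :: complex
            using nc [of t \<alpha>] squeeze_range [OF R, of t "norm \<alpha>"] that by simp
          ultimately show ?thesis
            unfolding prod_topology_subtopology_eu continuous_map_in_subtopology by auto
        qed
        have 4: "continuous_map (prod_topology ?I (prod_topology S (top_of_set ?A))) (prod_topology ?I (top_of_set ?A))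
            (\<lambda>p. (fst p, snd (snd p)))"
          by (intro continuous_map_pairedI continuous_map_fst
              continuous_map_compose [OF continuous_map_snd continuous_map_snd, unfolded o_def])
        have "continuous_map (prod_topology ?I (prod_topology S (top_of_set ?A))) (top_of_set (cball 0 R))
            (\<lambda>p. of_real (squeeze R (fst p) (norm (snd (snd p))) / norm (snd (snd p))) * snd (snd p))"
          using continuous_map_compose [OF 4 3] by (simp add: o_def)
        moreover have "continuous_map (prod_topology ?I (prod_topology S (top_of_set ?A))) S (\<lambda>p. fst (snd p))"
          using continuous_map_compose [OF continuous_map_snd continuous_map_fst] by (simp add: o_def)
        ultimately show ?thesis unfolding c_def case_prod_unfold by (intro continuous_map_pairedI)
      qed
      have "continuous_map (prod_topology ?I (subtopology M annulus)) M (T \<circ> (c \<circ> (\<lambda>(t, x). (t, g x))))"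
        by (intro continuous_map_compose [OF continuous_map_compose [OF 1 2] contT])
      moreover have "(T \<circ> (c \<circ> (\<lambda>(t, x). (t, g x)))) p \<in> outer" if "p \<in> {0..1} \<times> annulus" for p
      proof -
        have "D p \<in> outer" using D_annulus annulus_subset that by auto
        moreover have "(T \<circ> (c \<circ> (\<lambda>(t, x). (t, g x)))) p = D p" using that by (auto simp: D_def)
        ultimately show ?thesis by simp
      qed
      ultimately have "continuous_map (prod_topology ?I (subtopology M annulus)) Ext (T \<circ> (c \<circ> (\<lambda>(t, x). (t, g x))))"
        unfolding Ext_def continuous_map_in_subtopology by (auto simp del: comp_apply)
      moreover have "subtopology (prod_topology ?I Ext) ({0..1} \<times> annulus) = prod_topology ?I (subtopology M annulus)"
        using annulus_subset by (simp add: subtopology_Times subtopology_subtopology Ext_def Int_absorb1)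
      ultimately show ?thesis using True by (simp add: o_def case_prod_unfold)
    qed (simp add: continuous_map_from_subtopology continuous_map_snd)
    fix b b' p
    assume p: "p \<in> topspace (prod_topology ?I Ext) \<inter> {0..1} \<times> (if b then annulus else ?far) \<inter> {0..1} \<times> (if b' then annulus else ?far)"
    obtain t x where tx: "p = (t, x)" by (cases p) auto
    have "T (c (t, g x)) = x" if "x \<in> annulus" "x \<in> ?far"
      using D_far [OF that(2)] that(1) by (simp add: D_def)
    then show "(if b then (\<lambda>(t, x). T (c (t, g x))) else snd) p = (if b' then (\<lambda>(t, x). T (c (t, g x))) else snd) p"
      using p tx by (auto split: if_splits)
  next
    fix p assume p: "p \<in> topspace (prod_topology ?I Ext)"
    obtain t x where tx: "p = (t, x)" "t \<in> {0..1}" "x \<in> annulus \<union> ?far"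
      using p cov by (cases p) (auto simp: topspace_Ext)
    then show "\<exists>j. j \<in> {True, False} \<and> p \<in> {0..1} \<times> (if j then annulus else ?far) \<and>
        D p = (if j then (\<lambda>(t, x). T (c (t, g x))) else snd) p"
      by (intro exI [of _ "x \<in> annulus"]) (auto simp: D_def)
  qed auto
  moreover have "D (0, x) = x" for x
  proof (cases "x \<in> annulus")
    case True
    then obtain z \<alpha> where z: "x = T (z, \<alpha>)" "z \<in> topspace S" "1 \<le> norm \<alpha>" "norm \<alpha> \<le> R"
      by (auto simp: annulus_def)
    moreover have "\<alpha> \<noteq> 0" using z by auto
    ultimately show ?thesis by (simp add: D_T)
  qed (simp add: D_def)
  moreover have "D (t, x) = x" if "x \<in> rim" for t x
    using that D_fixed by (auto simp: rim_def)
  \<comment> \<open>The radius \<open>(1 + R) / 2\<close> is the point up to which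
    \<open>squeeze R 1\<close> is constantly 1, so this neighbourhood collapses onto the
    rim.\<close>
  moreover have "openin Ext (outer \<inter> T ` (topspace S \<times> ball 0 ((1 + R) / 2)))"
    using openin_tube [of "(1 + R) / 2"] R by (simp add: Ext_def openin_subtopology_Int2)
  moreover have "rim \<subseteq> outer \<inter> T ` (topspace S \<times> ball 0 ((1 + R) / 2))"
    using T_outer R by (auto simp: rim_def)
  moreover have "D (1, x) \<in> rim" if x: "x \<in> outer \<inter> T ` (topspace S \<times> ball 0 ((1 + R) / 2))" for x
  proof -
    obtain z \<alpha> where z: "x = T (z, \<alpha>)" "z \<in> topspace S" "norm \<alpha> < (1 + R) / 2" using x by auto
    then have a: "1 \<le> norm \<alpha>" "norm \<alpha> \<le> R" using T_outer [of z \<alpha>] x R by auto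
    have "squeeze R 1 (norm \<alpha>) = 1" using squeeze_1 z by simp
    then show ?thesis using D_T [OF z(2) a, of 1] nc [of 1 \<alpha>] a z by (auto simp: rim_def)
  qed
  ultimately show ?thesis by (intro that) auto
qed

end

lemma (in collar) boundary_map:
  "continuous_map (prod_topology S circle) Ext T" "inj_on T (topspace (prod_topology S circle))"
proof -
  have "continuous_map (subtopology (prod_topology S (top_of_set (cball 0 R))) (UNIV \<times> sphere 0 1)) M T"
    using contT by (rule continuous_map_from_subtopology)
  moreover have "cball 0 R \<inter> sphere 0 1 = (sphere 0 1 :: complex set)" using R by auto
  then have "subtopology (prod_topology S (top_of_set (cball 0 R))) (UNIV \<times> sphere 0 1) = prod_topology S circle"
    by (simp add: subtopology_Times subtopology_subtopology)
  ultimately show "continuous_map (prod_topology S circle) Ext T"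
    using T_outer R by (auto simp: Ext_def continuous_map_in_subtopology)
  show "inj_on T (topspace (prod_topology S circle))"
    by (rule inj_on_subset [OF injT]) (use R in auto)
qed

text \<open>In \<open>M\<close> the tube is filled in again, and the meridian contracts across the
  disc fibre over \<open>z\<close>.\<close>

lemma (in collar) meridian_null_homologous:
  assumes "z \<in> topspace S"
  shows "hom_induced 1 circle {} M {} (\<lambda>\<alpha>. T (z, \<alpha>)) circle_class = \<one>\<^bsub>homology_group 1 M\<^esub>"
proof -
  have "homotopic_with (\<lambda>_. True) circle (top_of_set (cball 0 R)) (\<lambda>\<alpha>. \<alpha>) (\<lambda>_. 0)"
  proof (rule homotopic_with_linear)
    show "closed_segment \<alpha> 0 \<subseteq> cball 0 R" if "\<alpha> \<in> sphere 0 1" for \<alpha> :: complex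
      using that R by (intro closed_segment_subset) auto
  qed (auto intro: continuous_intros)
  moreover have "continuous_map (top_of_set (cball 0 R)) M (T \<circ> (\<lambda>\<alpha>. (z, \<alpha>)))"
    using assms by (intro continuous_map_compose [OF _ contT] continuous_map_pairedI) auto
  ultimately have "homotopic_with (\<lambda>_. True) circle M ((T \<circ> (\<lambda>\<alpha>. (z, \<alpha>))) \<circ> (\<lambda>\<alpha>. \<alpha>)) ((T \<circ> (\<lambda>\<alpha>. (z, \<alpha>))) \<circ> (\<lambda>_. 0))"
    by (intro homotopic_with_compose_continuous_map_left) auto
  from homology_homotopy_empty [OF this, of 1]
  have "hom_induced 1 circle {} M {} (\<lambda>\<alpha>. T (z, \<alpha>)) circle_class = hom_induced 1 circle {} M {} (\<lambda>_. T (z, 0)) circle_class"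
    by (simp add: o_def)
  also have "\<dots> = \<one>\<^bsub>homology_group 1 M\<^esub>"
    using assms R T_in by (intro hom_induced_const) auto
  finally show ?thesis .
qed

lemma (in collar) exterior_eq:
  assumes "\<And>p. p \<in> topspace S \<times> cball 0 1 \<Longrightarrow> \<tau> p = T p"
  shows "exterior S M \<tau> = Ext"
proof -
  have "\<tau> ` (topspace S \<times> cball 0 1) = T ` (topspace S \<times> cball 0 1)"
    using assms by (rule image_cong [OF refl])
  then show ?thesis by (simp add: exterior_def Ext_def outer_def interior_tube)
qed

section \<open>The fibre sum\<close>

lemma non_torsion_imp_nonempty:
  assumes "non_torsion M (surface_class S \<mu> M i)" "\<mu> \<in> carrier (homology_group 2 S)"
  shows "topspace S \<noteq> {}"
proof
  \<comment> \<open>The empty space counts as connected, so a base point for the meridian has to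
    come from elsewhere: an empty surface has trivial second homology and would represent the zero
    class, which is torsion.\<close>
  assume "topspace S = {}"
  then have "trivial_group (homology_group 2 S)" by (rule trivial_homology_group_empty)
  then have \<mu>: "\<mu> = \<one>\<^bsub>homology_group 2 S\<^esub>" using assms(2) by (auto simp: trivial_group_def)
  interpret h: group_hom "homology_group 2 S" "homology_group 2 M" "hom_induced 2 S {} M {} i"
    by (rule hom_induced_group_hom)
  have "surface_class S \<mu> M i [^]\<^bsub>homology_group 2 M\<^esub> (1::nat) = \<one>\<^bsub>homology_group 2 M\<^esub>"
    unfolding surface_class_def \<mu> by simp
  then show False using assms(1) unfolding non_torsion_def by (metis zero_less_one)
qed

lemma splitting_iso:
  "splitting S M \<tau> k \<A> \<Longrightarrow> (\<lambda>a. (hom_induced 1 (exterior S M \<tau>) {} M {} id a, \<A> a))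
    \<in> iso (homology_group 1 (exterior S M \<tau>)) (homology_group 1 M \<times>\<times> integer_mod_group k)"
proof -
  have "split_map S M \<tau> \<A> = (\<lambda>a. (hom_induced 1 (exterior S M \<tau>) {} M {} id a, \<A> a))"
    by (simp add: fun_eq_iff split_map_def)
  then show "splitting S M \<tau> k \<A> \<Longrightarrow> ?thesis" by (simp add: splitting_def)
qed

theorem theorem4p6:
  fixes S :: "'s topology" and AS :: "('s, real^2) atlas"
    and M :: "'a topology" and AM :: "('a, real^4) atlas"
    and N :: "'b topology" and AN :: "('b, real^4) atlas"
    and \<mu>S :: "'s chain set" and \<mu>M :: "'a chain set" and \<mu>N :: "'b chain set"
    and g kM kN :: nat
    and iM :: "'s \<Rightarrow> 'a" and iN :: "'s \<Rightarrow> 'b"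
    and \<tau>M :: "'s \<times> complex \<Rightarrow> 'a" and \<tau>N :: "'s \<times> complex \<Rightarrow> 'b"
    and \<A>M :: "'a chain set \<Rightarrow> int" and \<A>N :: "'b chain set \<Rightarrow> int"
    and C :: "'s \<Rightarrow> complex"
    and \<theta> :: "complex cochain set"
  assumes S: "closed_oriented_connected_manifold S AS" "fundamental_class S AS \<mu>S" "genus_of S g"
    and M: "closed_oriented_connected_manifold M AM" "fundamental_class M AM \<mu>M"
    and N: "closed_oriented_connected_manifold N AN" "fundamental_class N AN \<mu>N"
    and emb: "smooth_embedding S AS M AM iM" "smooth_embedding S AS N AN iN"
    and self_int: "self_intersection_4 M \<mu>M (surface_class S \<mu>S M iM) = 0"
                  "self_intersection_4 N \<mu>N (surface_class S \<mu>S N iN) = 0"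
    and non_tor: "non_torsion M (surface_class S \<mu>S M iM)"
                 "non_torsion N (surface_class S \<mu>S N iN)"
    and divis: "maximal_divisibility M \<mu>M (surface_class S \<mu>S M iM) kM"
               "maximal_divisibility N \<mu>N (surface_class S \<mu>S N iN) kN"
    and fr: "framing S AS M AM iM \<tau>M" "framing S AS N AN iN \<tau>N"
    and split: "splitting S M \<tau>M kM \<A>M" "splitting S N \<tau>N kN \<A>N"
    and adap: "adapted S M iM \<tau>M \<A>M" "adapted S N iN \<tau>N \<A>N"
    and C: "smooth_circle_map S AS C"
    and \<theta>: "\<theta> \<in> cohomology 1 circle" "kronecker \<theta> circle_class = 1"
  shows "let n = gcd kM kN;
             r = (\<lambda>l. kronecker (cohomology_pullback 1 S C \<theta>) l mod int n)
         in homology_group 1 (fibre_sum S M \<tau>M N \<tau>N C) \<cong>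
            cokernel (homology_group 1 S)
              (homology_group 1 M \<times>\<times> (homology_group 1 N \<times>\<times> integer_mod_group n))
              (\<lambda>l. (hom_induced 1 S {} M {} iM l, hom_induced 1 S {} N {} iN l, r l))"
proof -
  let ?K = "prod_topology S circle"
  let ?X = "exterior S M \<tau>M" and ?Y = "exterior S N \<tau>N"
  let ?c = "kronecker (cohomology_pullback 1 S C \<theta>)"
  have oS: "oriented_manifold S AS" and cS: "compact_space S"
    and oM: "oriented_manifold M AM" and oN: "oriented_manifold N AN"
    using S M N by (auto simp: closed_oriented_connected_manifold_def)
  have pS: "path_connected_space S" by (rule manifold_path_connected [OF S(1)])
  have "\<mu>S \<in> carrier (homology_group 2 S)" using S(2) by (simp add: fundamental_class_def)
  then have "topspace S \<noteq> {}" using non_torsion_imp_nonempty non_tor(1) by blast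
  then obtain z where z: "z \<in> topspace S" by blast
  have contC: "continuous_map S circle C" using C by (simp add: smooth_circle_map_def)
  obtain TM RM where "collar S M TM RM" and \<tau>M: "\<forall>p\<in>topspace S \<times> cball 0 1. \<tau>M p = TM p"
    by (rule framing_collar [OF oS cS oM fr(1)])
  then interpret cM: collar S M TM RM by blast
  obtain TN RN where "collar S N TN RN" and \<tau>N: "\<forall>p\<in>topspace S \<times> cball 0 1. \<tau>N p = TN p"
    by (rule framing_collar [OF oS cS oN fr(2)])
  then interpret cN: collar S N TN RN by blast
  have X: "?X = cM.Ext" by (rule cM.exterior_eq [OF bspec [OF \<tau>M]])
  have Y: "?Y = cN.Ext" by (rule cN.exterior_eq [OF bspec [OF \<tau>N]])
  \<comment> \<open>\<open>\<tau>M\<close> and \<open>\<tau>N\<close> are controlled only on the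
    closed unit tube; \<open>TM\<close> and \<open>TN\<close> continue them across the collar and
    agree with them on the boundary.\<close>
  have eqM: "\<tau>M p = TM p" and eqN: "\<tau>N p = TN p" if "p \<in> topspace ?K" for p
    using that \<tau>M \<tau>N by auto
  have contX: "continuous_map ?K ?X \<tau>M"
    unfolding X by (rule continuous_map_eq [OF cM.boundary_map(1) eqM [symmetric]])
  have contN: "continuous_map ?K ?Y \<tau>N"
    unfolding Y by (rule continuous_map_eq [OF cN.boundary_map(1) eqN [symmetric]])
  have injM: "inj_on \<tau>M (topspace ?K)"
    by (rule iffD2 [OF inj_on_cong [OF eqM] cM.boundary_map(2)])
  have injN: "inj_on \<tau>N (topspace ?K)"
    by (rule iffD2 [OF inj_on_cong [OF eqN] cN.boundary_map(2)])
  define \<rho> where "\<rho> = (\<lambda>(s, \<alpha>). (s :: 's, C s * cnj \<alpha>))"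
  have nC: "norm (C s) = 1" if "s \<in> topspace S" for s
    using contC that by (auto simp: continuous_map_in_subtopology)
  have cont\<rho>: "continuous_map ?K ?K \<rho>"
    unfolding \<rho>_def case_prod_unfold
    by (intro continuous_map_pairedI continuous_map_fst continuous_map_circle_mult
        continuous_map_compose [OF continuous_map_fst contC, unfolded o_def]
        continuous_map_compose [OF continuous_map_snd continuous_map_circle_cnj, unfolded o_def])
  have "C s \<noteq> 0" if "s \<in> topspace S" for s using nC [OF that] by auto
  then have inj\<rho>: "inj_on \<rho> (topspace ?K)" by (auto simp: \<rho>_def inj_on_def)
  have injY: "inj_on (\<tau>N \<circ> \<rho>) (topspace ?K)"
    by (rule comp_inj_on [OF inj\<rho> inj_on_subset [OF injN continuous_map_image_subset_topspace [OF cont\<rho>]]])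
  have contY: "continuous_map ?K ?Y (\<tau>N \<circ> \<rho>)" by (rule continuous_map_compose [OF cont\<rho> contN])
  \<comment> \<open>The product of surface and circle serves as the seam, parametrised by
    \<open>\<tau>M\<close> on one side and by \<open>\<tau>N \<circ> \<rho>\<close> on the other, so
    that the partial inverse inside \<open>gluing_map\<close> disappears.\<close>
  interpret glue: compact_gluing ?X ?Y ?K \<tau>M "\<tau>N \<circ> \<rho>" "gluing_map S \<tau>M \<tau>N C"
  proof
    show "Hausdorff_space ?X" "Hausdorff_space ?Y"
      unfolding X Y cM.Ext_def cN.Ext_def using cM.HM cN.HM by (simp_all add: Hausdorff_space_subtopology)
    show "compact_space ?K" using cS by (simp add: compact_space_prod_topology compact_space_subtopology)
    fix k assume "k \<in> topspace ?K"
    then show "gluing_map S \<tau>M \<tau>N C (\<tau>M k) = (\<tau>N \<circ> \<rho>) k"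
      using injM by (simp add: gluing_map_def \<rho>_def)
  qed (use contX contY injM injY in auto)
  have Z: "glue.Z = fibre_sum S M \<tau>M N \<tau>N C"
    by (simp add: glue.Z_def fibre_sum_def glue.B_def)
  have B: "glue.B = cM.rim"
    using eqM by (auto simp: glue.B_def cM.rim_def)
  have pK: "path_connected_space ?K"
    using pS path_connected_sphere [of "0 :: complex" 1] by (simp add: path_connected_space_prod_topology)
  \<comment> \<open>The collar is taken inside the exterior of \<open>M\<close>; the exterior of
    \<open>N\<close> remains fixed.\<close>
  obtain D V where D: "continuous_map (prod_topology (top_of_set {0..1::real}) ?X) ?X D"
    "\<forall>x\<in>topspace ?X. D (0, x) = x"
    "\<forall>t\<in>{0..1}. \<forall>x\<in>glue.B. D (t, x) = x"
    "openin ?X V" "glue.B \<subseteq> V" "\<forall>x\<in>V. D (1, x) \<in> glue.B"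
    unfolding B X by (rule cM.collar_homotopy)
  obtain d where "glued_space glue.Z ?X ?Y glue.jX glue.jY d ?K \<tau>M (\<tau>N \<circ> \<rho>)"
    by (rule glue.glued_space [OF pK D(1) D(2,3) [rule_format] D(4,5) D(6) [rule_format]])
  then interpret gl: glued_space glue.Z ?X ?Y glue.jX glue.jY d ?K \<tau>M "\<tau>N \<circ> \<rho>" .
  interpret hX: group_hom "homology_group 1 ?K" "homology_group 1 ?X" "hom_induced 1 ?K {} ?X {} \<tau>M"
    by (rule hom_induced_group_hom)
  interpret hY: group_hom "homology_group 1 ?K" "homology_group 1 ?Y" "hom_induced 1 ?K {} ?Y {} (\<tau>N \<circ> \<rho>)"
    by (rule hom_induced_group_hom)
  interpret hN: group_hom "homology_group 1 ?K" "homology_group 1 ?Y" "hom_induced 1 ?K {} ?Y {} \<tau>N"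
    by (rule hom_induced_group_hom)
  interpret hz: group_hom "homology_group 1 circle" "homology_group 1 ?K" "hom_induced 1 circle {} ?K {} (\<lambda>\<alpha>. (z, \<alpha>))"
    by (rule hom_induced_group_hom)
  let ?par = "hom_induced 1 S {} ?K {} (\<lambda>s. (s, 1))"
  let ?mer = "hom_induced 1 circle {} ?K {} (\<lambda>\<alpha>. (z, \<alpha>)) circle_class"
  let ?mX = "meridian S M \<tau>M z" and ?mY = "meridian S N \<tau>N z"
  let ?pX = "parallel S M \<tau>M" and ?pY = "parallel S N \<tau>N"
  have parc: "?par l \<in> carrier (homology_group 1 ?K)" for l by (rule hom_induced_carrier)
  have merc: "?mer \<in> carrier (homology_group 1 ?K)" by (rule hom_induced_carrier)
  have mYc: "?mY \<in> carrier (homology_group 1 ?Y)" unfolding meridian_def by (rule hom_induced_carrier)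
  have mXc: "?mX \<in> carrier (homology_group 1 ?X)" unfolding meridian_def by (rule hom_induced_carrier)
  have pYc: "?pY l \<in> carrier (homology_group 1 ?Y)" for l unfolding parallel_def by (rule hom_induced_carrier)
  have pXc: "?pX l \<in> carrier (homology_group 1 ?X)" for l unfolding parallel_def by (rule hom_induced_carrier)
  have cpar: "continuous_map S ?K (\<lambda>s. (s, 1))" and cmer: "continuous_map circle ?K (\<lambda>\<alpha>. (z, \<alpha>))"
    and cgraph: "continuous_map S ?K (\<lambda>s. (s, C s))"
    using z contC by (auto intro: continuous_map_pairedI)
  have X_par: "hom_induced 1 ?K {} ?X {} \<tau>M (?par l) = ?pX l" for l
    unfolding parallel_def by (rule hom_induced_comp [OF cpar contX])
  have X_mer: "hom_induced 1 ?K {} ?X {} \<tau>M ?mer = ?mX"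
    unfolding meridian_def by (rule hom_induced_comp [OF cmer contX])
  have N_par: "hom_induced 1 ?K {} ?Y {} \<tau>N (?par l) = ?pY l" for l
    unfolding parallel_def by (rule hom_induced_comp [OF cpar contN])
  have N_mer: "hom_induced 1 ?K {} ?Y {} \<tau>N ?mer = ?mY"
    unfolding meridian_def by (rule hom_induced_comp [OF cmer contN])
  \<comment> \<open>Since 1 is its own conjugate, \<open>\<rho>\<close> carries the section at 1 to
    the graph of \<open>C\<close>; its surplus over the parallel is \<open>?c l\<close>
    meridians.\<close>
  have Y_par: "hom_induced 1 ?K {} ?Y {} (\<tau>N \<circ> \<rho>) (?par l) = ?pY l \<otimes>\<^bsub>homology_group 1 ?Y\<^esub> ?mY [^]\<^bsub>homology_group 1 ?Y\<^esub> ?c l"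
    if l: "l \<in> carrier (homology_group 1 S)" for l
  proof -
    have "hom_induced 1 ?K {} ?Y {} (\<tau>N \<circ> \<rho>) (?par l) = hom_induced 1 S {} ?Y {} (\<lambda>s. \<tau>N (s, C s)) l"
      using hom_induced_comp [OF cpar contY, of 1 l] by (simp add: \<rho>_def)
    also have "\<dots> = hom_induced 1 ?K {} ?Y {} \<tau>N (hom_induced 1 S {} ?K {} (\<lambda>s. (s, C s)) l)"
      by (rule hom_induced_comp [OF cgraph contN, symmetric])
    also have "\<dots> = ?pY l \<otimes>\<^bsub>homology_group 1 ?Y\<^esub> ?mY [^]\<^bsub>homology_group 1 ?Y\<^esub> ?c l"
      unfolding graph_class [OF pS z contC \<theta> l] using parc merc
      by (simp add: hN.hom_int_pow N_par N_mer)
    finally show ?thesis .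
  qed
  \<comment> \<open>On the fibre over \<open>z\<close> the map \<open>\<rho>\<close> is conjugation
    followed by a rotation, which reverses the circle.\<close>
  have Y_mer: "hom_induced 1 ?K {} ?Y {} (\<tau>N \<circ> \<rho>) ?mer = inv\<^bsub>homology_group 1 ?Y\<^esub> ?mY"
  proof -
    have "continuous_map circle circle (\<lambda>\<alpha>. C z * cnj \<alpha>)"
      using nC [OF z] by (intro continuous_map_circle_mult continuous_map_circle_cnj) simp
    from hom_induced_comp [OF this cmer, of 1 circle_class]
    have "hom_induced 1 circle {} ?K {} (\<lambda>\<alpha>. (z, C z * cnj \<alpha>)) circle_class = inv\<^bsub>homology_group 1 ?K\<^esub> ?mer"
      unfolding twisted_conjugation_class [OF nC [OF z]] by (simp add: hz.hom_inv)
    moreover have "hom_induced 1 ?K {} ?K {} \<rho> ?mer = hom_induced 1 circle {} ?K {} (\<lambda>\<alpha>. (z, C z * cnj \<alpha>)) circle_class"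
      using hom_induced_comp [OF cmer cont\<rho>, of 1 circle_class] by (simp add: \<rho>_def)
    moreover have "hom_induced 1 ?K {} ?Y {} (\<tau>N \<circ> \<rho>) ?mer = hom_induced 1 ?K {} ?Y {} \<tau>N (hom_induced 1 ?K {} ?K {} \<rho> ?mer)"
      using hom_induced_comp [OF cont\<rho> contN, of 1 ?mer] by (simp add: o_def)
    ultimately show ?thesis using merc by (simp add: hN.hom_inv N_mer)
  qed
  have X_class: "hom_induced 1 ?K {} ?X {} \<tau>M (?par l \<otimes>\<^bsub>homology_group 1 ?K\<^esub> ?mer [^]\<^bsub>homology_group 1 ?K\<^esub> (m::int)) =
      ?pX l \<otimes>\<^bsub>homology_group 1 ?X\<^esub> ?mX [^]\<^bsub>homology_group 1 ?X\<^esub> m" for l m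
    using parc merc by (simp add: hX.hom_int_pow X_par X_mer)
  have Y_class: "hom_induced 1 ?K {} ?Y {} (\<tau>N \<circ> \<rho>) (?par l \<otimes>\<^bsub>homology_group 1 ?K\<^esub> ?mer [^]\<^bsub>homology_group 1 ?K\<^esub> (m::int)) =
      ?pY l \<otimes>\<^bsub>homology_group 1 ?Y\<^esub> ?mY [^]\<^bsub>homology_group 1 ?Y\<^esub> (?c l - m)"
    if "l \<in> carrier (homology_group 1 S)" for l m
  proof -
    \<comment> \<open>The reversed meridian turns the exponent \<open>m\<close> into
      \<open>- m\<close>, which produces the exponent \<open>?c l - m\<close> expected by the
      algebra.\<close>
    have "(inv\<^bsub>homology_group 1 ?Y\<^esub> ?mY) [^]\<^bsub>homology_group 1 ?Y\<^esub> m = ?mY [^]\<^bsub>homology_group 1 ?Y\<^esub> (- m)"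
      using mYc by (simp add: hY.H.int_pow_inv hY.H.int_pow_neg)
    then have "?mY [^]\<^bsub>homology_group 1 ?Y\<^esub> ?c l \<otimes>\<^bsub>homology_group 1 ?Y\<^esub>
        (inv\<^bsub>homology_group 1 ?Y\<^esub> ?mY) [^]\<^bsub>homology_group 1 ?Y\<^esub> m = ?mY [^]\<^bsub>homology_group 1 ?Y\<^esub> (?c l - m)"
      using hY.H.int_pow_mult [OF mYc, of "?c l" "- m"] by simp
    then show ?thesis
      using parc merc mYc pYc that by (simp add: hY.hom_int_pow Y_par Y_mer hY.H.m_assoc)
  qed
  have cl: "\<exists>l\<in>carrier (homology_group 1 S). \<exists>m::int. x = ?par l \<otimes>\<^bsub>homology_group 1 ?K\<^esub> ?mer [^]\<^bsub>homology_group 1 ?K\<^esub> m"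
    if x: "x \<in> carrier (homology_group 1 ?K)" for x
  proof -
    obtain m where "x = ?par (hom_induced 1 ?K {} S {} fst x) \<otimes>\<^bsub>homology_group 1 ?K\<^esub>
        ?mer [^]\<^bsub>homology_group 1 ?K\<^esub> (m::int)"
      by (rule times_circle_class [OF pS z x])
    moreover have "hom_induced 1 ?K {} S {} fst x \<in> carrier (homology_group 1 S)" by (rule hom_induced_carrier)
    ultimately show ?thesis by blast
  qed
  have "homology_group 1 glue.Z \<cong> cokernel (homology_group 1 S)
              (homology_group 1 M \<times>\<times> (homology_group 1 N \<times>\<times> integer_mod_group (gcd kM kN)))
              (\<lambda>l. (hom_induced 1 S {} M {} iM l, hom_induced 1 S {} N {} iN l, ?c l mod int (gcd kM kN)))"
  proof (rule glued_cokernel [where ?j1.0 = "hom_induced 1 ?X {} glue.Z {} glue.jX"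
        and ?j2.0 = "hom_induced 1 ?Y {} glue.Z {} glue.jY" and ?p1.0 = ?pX and ?p2.0 = ?pY and ?m1.0 = ?mX and ?m2.0 = ?mY])
    show "kM > 0" "kN > 0" using divis by (auto simp: maximal_divisibility_def)
    show "\<exists>a\<in>carrier (homology_group 1 ?X). \<exists>b\<in>carrier (homology_group 1 ?Y).
        x = hom_induced 1 ?X {} glue.Z {} glue.jX a \<otimes>\<^bsub>homology_group 1 glue.Z\<^esub> hom_induced 1 ?Y {} glue.Z {} glue.jY b"
      if "x \<in> carrier (homology_group 1 glue.Z)" for x
      using that by (rule gl.homology_surj)
    show "(hom_induced 1 ?X {} glue.Z {} glue.jX a \<otimes>\<^bsub>homology_group 1 glue.Z\<^esub> hom_induced 1 ?Y {} glue.Z {} glue.jY b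
        = \<one>\<^bsub>homology_group 1 glue.Z\<^esub>) \<longleftrightarrow>
      (\<exists>l\<in>carrier (homology_group 1 S). \<exists>m::int. a = ?pX l \<otimes>\<^bsub>homology_group 1 ?X\<^esub> ?mX [^]\<^bsub>homology_group 1 ?X\<^esub> m \<and>
         b = inv\<^bsub>homology_group 1 ?Y\<^esub> (?pY l \<otimes>\<^bsub>homology_group 1 ?Y\<^esub> ?mY [^]\<^bsub>homology_group 1 ?Y\<^esub> (?c l - m)))"
      if a: "a \<in> carrier (homology_group 1 ?X)" and b: "b \<in> carrier (homology_group 1 ?Y)" for a b
      unfolding gl.homology_kernel [OF a b]
    proof
      assume "\<exists>x\<in>carrier (homology_group 1 ?K). a = hom_induced 1 ?K {} ?X {} \<tau>M x \<and>
          b = inv\<^bsub>homology_group 1 ?Y\<^esub> hom_induced 1 ?K {} ?Y {} (\<tau>N \<circ> \<rho>) x"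
      then obtain x where x: "x \<in> carrier (homology_group 1 ?K)" "a = hom_induced 1 ?K {} ?X {} \<tau>M x"
          "b = inv\<^bsub>homology_group 1 ?Y\<^esub> hom_induced 1 ?K {} ?Y {} (\<tau>N \<circ> \<rho>) x" by blast
      obtain l m where l: "l \<in> carrier (homology_group 1 S)"
        "x = ?par l \<otimes>\<^bsub>homology_group 1 ?K\<^esub> ?mer [^]\<^bsub>homology_group 1 ?K\<^esub> (m::int)"
        using cl [OF x(1)] by blast
      show "\<exists>l\<in>carrier (homology_group 1 S). \<exists>m::int. a = ?pX l \<otimes>\<^bsub>homology_group 1 ?X\<^esub> ?mX [^]\<^bsub>homology_group 1 ?X\<^esub> m \<and>
         b = inv\<^bsub>homology_group 1 ?Y\<^esub> (?pY l \<otimes>\<^bsub>homology_group 1 ?Y\<^esub> ?mY [^]\<^bsub>homology_group 1 ?Y\<^esub> (?c l - m))"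
        using x(2,3) unfolding l(2) X_class Y_class [OF l(1)] using l(1) by blast
    next
      assume "\<exists>l\<in>carrier (homology_group 1 S). \<exists>m::int. a = ?pX l \<otimes>\<^bsub>homology_group 1 ?X\<^esub> ?mX [^]\<^bsub>homology_group 1 ?X\<^esub> m \<and>
         b = inv\<^bsub>homology_group 1 ?Y\<^esub> (?pY l \<otimes>\<^bsub>homology_group 1 ?Y\<^esub> ?mY [^]\<^bsub>homology_group 1 ?Y\<^esub> (?c l - m))"
      then obtain l m where l: "l \<in> carrier (homology_group 1 S)"
        "a = ?pX l \<otimes>\<^bsub>homology_group 1 ?X\<^esub> ?mX [^]\<^bsub>homology_group 1 ?X\<^esub> (m::int)"
        "b = inv\<^bsub>homology_group 1 ?Y\<^esub> (?pY l \<otimes>\<^bsub>homology_group 1 ?Y\<^esub> ?mY [^]\<^bsub>homology_group 1 ?Y\<^esub> (?c l - m))" by blast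
      show "\<exists>x\<in>carrier (homology_group 1 ?K). a = hom_induced 1 ?K {} ?X {} \<tau>M x \<and>
          b = inv\<^bsub>homology_group 1 ?Y\<^esub> hom_induced 1 ?K {} ?Y {} (\<tau>N \<circ> \<rho>) x"
        unfolding l(2,3) X_class [symmetric] Y_class [OF l(1), symmetric]
      proof (intro bexI conjI)
        show "?par l \<otimes>\<^bsub>homology_group 1 ?K\<^esub> ?mer [^]\<^bsub>homology_group 1 ?K\<^esub> m \<in> carrier (homology_group 1 ?K)"
          using parc merc by (intro hX.G.m_closed hX.G.int_pow_closed)
      qed (rule refl)+
    qed
    show "(\<lambda>a. (hom_induced 1 ?X {} M {} id a, \<A>M a)) \<in> iso (homology_group 1 ?X) (homology_group 1 M \<times>\<times> integer_mod_group kM)"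
      "(\<lambda>a. (hom_induced 1 ?Y {} N {} id a, \<A>N a)) \<in> iso (homology_group 1 ?Y) (homology_group 1 N \<times>\<times> integer_mod_group kN)"
      using split by (auto intro: splitting_iso)
    show "?pX l \<in> carrier (homology_group 1 ?X) \<and> hom_induced 1 ?X {} M {} id (?pX l) = hom_induced 1 S {} M {} iM l \<and> \<A>M (?pX l) = 0"
      "?pY l \<in> carrier (homology_group 1 ?Y) \<and> hom_induced 1 ?Y {} N {} id (?pY l) = hom_induced 1 S {} N {} iN l \<and> \<A>N (?pY l) = 0"
      if "l \<in> carrier (homology_group 1 S)" for l
      using adap that pXc pYc by (auto simp: adapted_def split_map_def)
    show "?mX \<in> carrier (homology_group 1 ?X)" "?mY \<in> carrier (homology_group 1 ?Y)" by (rule mXc mYc)+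
    show "\<A>M ?mX = 1 mod int kM" "\<A>N ?mY = 1 mod int kN"
      using split z by (auto simp: splitting_def)
    have "continuous_map circle ?X (\<lambda>\<alpha>. \<tau>M (z, \<alpha>))" "continuous_map circle ?Y (\<lambda>\<alpha>. \<tau>N (z, \<alpha>))"
      using continuous_map_compose [OF cmer contX] continuous_map_compose [OF cmer contN] by (simp_all add: o_def)
    moreover have "continuous_map ?X M id" "continuous_map ?Y N id"
      by (simp_all add: exterior_def continuous_map_from_subtopology)
    ultimately have "hom_induced 1 ?X {} M {} id ?mX = hom_induced 1 circle {} M {} (\<lambda>\<alpha>. \<tau>M (z, \<alpha>)) circle_class"
      "hom_induced 1 ?Y {} N {} id ?mY = hom_induced 1 circle {} N {} (\<lambda>\<alpha>. \<tau>N (z, \<alpha>)) circle_class"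
      unfolding meridian_def by (simp_all add: hom_induced_comp)
    \<comment> \<open>The contraction of the meridian was carried out for \<open>TM\<close> and
      \<open>TN\<close>; on the unit circle they coincide with the given framings.\<close>
    moreover have "hom_induced 1 circle {} M {} (\<lambda>\<alpha>. \<tau>M (z, \<alpha>)) = hom_induced 1 circle {} M {} (\<lambda>\<alpha>. TM (z, \<alpha>))"
      "hom_induced 1 circle {} N {} (\<lambda>\<alpha>. \<tau>N (z, \<alpha>)) = hom_induced 1 circle {} N {} (\<lambda>\<alpha>. TN (z, \<alpha>))"
      using z by (auto intro!: hom_induced_eq eqM eqN)
    ultimately show "hom_induced 1 ?X {} M {} id ?mX = \<one>\<^bsub>homology_group 1 M\<^esub>"
      "hom_induced 1 ?Y {} N {} id ?mY = \<one>\<^bsub>homology_group 1 N\<^esub>"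
      using cM.meridian_null_homologous [OF z] cN.meridian_null_homologous [OF z] by simp_all
    \<comment> \<open>Additivity is obtained on the circle, after moving \<open>C\<close> from the
      cohomology class to the homology class.\<close>
    show "?c (l \<otimes>\<^bsub>homology_group 1 S\<^esub> l') = ?c l + ?c l'"
      if l: "l \<in> carrier (homology_group 1 S)" "l' \<in> carrier (homology_group 1 S)" for l l'
    proof -
      interpret h: group_hom "homology_group 1 S" "homology_group 1 circle" "hom_induced 1 S {} circle {} C"
        by (rule hom_induced_group_hom)
      show ?thesis
        unfolding kronecker_pullback [OF contC \<theta>(1) l(1)] kronecker_pullback [OF contC \<theta>(1) l(2)]
          kronecker_pullback [OF contC \<theta>(1) h.G.m_closed [OF l]] h.hom_mult [OF l]
        by (rule kronecker_mult [OF \<theta>(1) h.hom_closed [OF l(1)] h.hom_closed [OF l(2)]])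
    qed
  qed (simp_all add: hom_induced_empty_hom)
  then show ?thesis by (simp add: Z Let_def)
qed

end
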